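(* Let $X=(X_n)_{n\in\mathbb{Z}}$ be the i.i.d. increments of a skip-free to the left random walk with $0<\mathbb{E}[X_0]<\infty$. Let $S_0=0$, $S_n=\sum_{k=0}^{n-1}X_k$ for $n\ge1$, $c=\mathbb{P}[S_n=-1\text{ for some }n>0]$, and for $k\ge0$ let $\tilde\pi(k)=c^{k-1}\mathbb{P}[X_0=k-1]$, $\bar\pi(k)=c^k\mathbb{P}[X_0\ge k]$. Then the $R$-probability of $[\mathbb{Z},0,X]$ exists (where $R$ is the record vertex-shift), and its distribution is $MEKT(\bar\pi,\tilde\pi)\circ\hat\Phi_R^{-1}$, the push-forward under the extended backward map $\hat\Phi_R$ of the bi-variate ECS ordered marked Eternal Kesten Tree $MEKT(\bar\pi,\tilde\pi)$ with the marked bush law specified in the context.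
   Context: **Increments.** "I.i.d. increments of a skip-free to the left random walk" means: $X=(X_n)_{n\in\mathbb{Z}}$ is i.i.d., each $X_n$ takes values in $\{-1,0,1,2,\dots\}$, $\mathbb{P}[X_0=-1]>0$ and $\mathbb{E}[X_0]<\infty$. **Networks and $R$-probability.** $[\mathbb{Z},i,x]$ denotes the equivalence class, up to translation, of the line $\mathbb{Z}$ rooted at $i$ with mark $x_n$ on the edge $(n,n+1)$; it is identified with the sequence $(x_{n+i})_{n\in\mathbb{Z}}$, and the local topology is the product topology on integer sequences. The record map is $R_x(i)=\inf\{j>i:\sum_{l=i}^{j-1}x_l\ge 0\}$ if the infimum exists and $R_x(i)=i$ otherwise. The $R$-probability of $[\mathbb{Z},0,X]$ is the weak limit as $n\to\infty$ of the distributions of $[\mathbb{Z},R_X^n(0),X]$, if it exists. **Family Trees.** A Family Tree is a locally finite directed tree with out-degrees at most $1$; $F(v)$ is the parent of $v$ (endpoint of its outgoing edge). It is ordered if the children of every vertex are totally ordered by $<$. $d_1(u)$ is the number of children of $u$. Rooted ordered $\mathbb{Z}$-marked (on vertices) Family Trees are considered up to isomorphism, with the local topology. **$MEKT(\bar\pi,\tilde\pi)$.** Take an i.i.d. sequence $([\mathbf{T}_i,\mathbf{o}_i,Z_i])_{i\in\mathbb{Z}}$ of finite rooted ordered marked Family Trees with the following law (the law of the marked bush): $\mathbf{o}_i$ has no parent; the pair (mark $Z_i(\mathbf{o}_i)$, number of children $d_1(\mathbf{o}_i)$ in $\mathbf{T}_i$) has joint law $\mathbb{P}[Z_i(\mathbf{o}_i)=n,d_1(\mathbf{o}_i)=k]=\mathbb{P}[X_0=n+k]c^k$,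 $n,k\ge0$ (so $d_1(\mathbf{o}_i)\sim\bar\pi$); given this pair, the descendant trees of the children of $\mathbf{o}_i$ are i.i.d. ordered Galton-Watson trees with offspring distribution $\tilde\pi$ (uniform order among children); all vertices other than $\mathbf{o}_i$ have mark $-1$. Then add a directed edge $(\mathbf{o}_i,\mathbf{o}_{i+1})$ for each $i\in\mathbb{Z}$, declare $\mathbf{o}_i$ to be the smallest child of $\mathbf{o}_{i+1}$, keep the marks, and root at $\mathbf{o}_0$. The law of the resulting tree is $MEKT(\bar\pi,\tilde\pi)$. **RLS order and succession line.** On an ordered Family Tree, write $u\prec v$ if either $v=F^k(u)$ for some $k>0$, or $u,v$ have a common ancestor $w=F^m(u)=F^n(v)$, with $m,n$ smallest positive such integers, and $F^{m-1}(u)<F^{n-1}(v)$. Put $b(u)=\max\{v:v\prec u\}$ and $a(u)=\min\{v:v\succ u\}$ (with respect to $\prec$) when they exist. The succession line of $(T,o)$ is $(u_n)_{n\in\mathbb{Z}}$ with $u_0=o$; for $n<0$, $u_n=b(u_{n+1})$ if it exists and $u_n=u_{n+1}$ otherwise; for $n>0$, $u_n=a(u_{n-1})$ if it exists and $u_n=u_{n-1}$ otherwise. **Extended backward map.** Let $[T,o,M]$ be a rooted ordered marked Family Tree with at most one bi-infinite directed path and marks $M(u)\ge-1$, with succession line $(u_n)$. Then $\hat\Phi_R([T,o,M])=[\mathbb{Z},0,x]$, where $x_n=d_1(u_{n+1})-1$ if $u_{n+1}$ is not on the bi-infinite path and $x_n=d_1(u_{n+1})+M(u_{n+1})-1$ if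 $u_{n+1}$ is on the bi-infinite path ($d_1$ computed in $T$). *)

theory Defs
  imports "HOL-Probability.Probability"
begin

section \<open>Marked lines, the record vertex-shift and its point-map probability\<close>

text \<open>The class \<open>[\<int>, i, x]\<close> of the marked line rooted at \<open>i\<close> is identified with the
  shifted sequence.  The type \<open>int \<Rightarrow> int\<close> carries the product topology of the discrete
  topologies, which is the local topology on marked lines.\<close>

definition rooted_line :: "int \<Rightarrow> (int \<Rightarrow> int) \<Rightarrow> (int \<Rightarrow> int)" where
  "rooted_line i x = (\<lambda>n. x (n + i))"

definition record_map :: "(int \<Rightarrow> int) \<Rightarrow> int \<Rightarrow> int" where
  "record_map x i =
     (if \<exists>j>i. (\<Sum>l\<in>{i..<j}. x l) \<ge> 0 then Inf {j. j > i \<and> (\<Sum>l\<in>{i..<j}. x l) \<ge> 0} else i)"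

definition weakly_converges ::
    "(nat \<Rightarrow> 'b::topological_space measure) \<Rightarrow> 'b measure \<Rightarrow> bool" where
  "weakly_converges \<mu> \<nu> \<longleftrightarrow>
     (\<forall>f :: 'b \<Rightarrow> real. continuous_on UNIV f \<and> bounded (range f) \<longrightarrow>
        (\<lambda>n. integral\<^sup>L (\<mu> n) f) \<longlonglongrightarrow> integral\<^sup>L \<nu> f)"

definition is_R_probability ::
    "'a measure \<Rightarrow> (int \<Rightarrow> 'a \<Rightarrow> int) \<Rightarrow> (int \<Rightarrow> int) measure \<Rightarrow> bool" where
  "is_R_probability M X \<nu> \<longleftrightarrow>
     prob_space \<nu> \<and> sets \<nu> = sets borel \<and>
     weakly_converges
       (\<lambda>n. distr M borel
          (\<lambda>\<omega>. let x = (\<lambda>k. X k \<omega>) in rooted_line ((record_map x ^^ n) 0) x)) \<nu>"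


section \<open>Rooted ordered marked Family Trees\<close>

text \<open>Out-degrees at most one are built in: the outgoing edge of \<open>u\<close>, if there is one, leads to
  the parent of \<open>u\<close>.  Only the values of \<open>parent\<close> and \<open>mark\<close> on \<open>verts\<close> are meaningful.
  \<open>(u, v) \<in> sib_less\<close> means that \<open>u\<close> and \<open>v\<close> are siblings and \<open>u < v\<close>.\<close>

record 'v rom_tree =
  verts :: "'v set"
  parent :: "'v \<Rightarrow> 'v option"
  sib_less :: "('v \<times> 'v) set"
  root :: 'v
  mark :: "'v \<Rightarrow> int"

definition arcs :: "'v rom_tree \<Rightarrow> ('v \<times> 'v) set" where
  "arcs T = {(u, v). u \<in> verts T \<and> v \<in> verts T \<and> parent T u = Some v}"

definition children :: "'v rom_tree \<Rightarrow> 'v \<Rightarrow> 'v set" where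
  "children T v = {u. (u, v) \<in> arcs T}"

definition num_children :: "'v rom_tree \<Rightarrow> 'v \<Rightarrow> nat" where
  "num_children T v = card (children T v)"

text \<open>When out-degrees are at most one, a cycle of the underlying undirected graph is
  necessarily a directed cycle, so it suffices to exclude the latter.\<close>

definition family_tree :: "'v rom_tree \<Rightarrow> bool" where
  "family_tree T \<longleftrightarrow>
     root T \<in> verts T \<and>
     (\<forall>u\<in>verts T. \<forall>v. parent T u = Some v \<longrightarrow> v \<in> verts T) \<and>
     acyclic (arcs T) \<and>
     (\<forall>u\<in>verts T. \<forall>v\<in>verts T. (u, v) \<in> (arcs T \<union> (arcs T)\<inverse>)\<^sup>*) \<and>
     (\<forall>v\<in>verts T. finite (children T v)) \<and>
     sib_less T \<subseteq> (\<Union>v\<in>verts T. children T v \<times> children T v) \<and>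
     (\<forall>v\<in>verts T. strict_linear_order_on (children T v)
                     (sib_less T \<inter> children T v \<times> children T v))"

definition tree_iso :: "'v rom_tree \<Rightarrow> 'w rom_tree \<Rightarrow> bool" where
  "tree_iso T T' \<longleftrightarrow>
     (\<exists>f. bij_betw f (verts T) (verts T') \<and> f (root T) = root T' \<and>
        (\<forall>u\<in>verts T. mark T' (f u) = mark T u) \<and>
        (\<forall>u\<in>verts T. \<forall>v\<in>verts T.
           ((f u, f v) \<in> arcs T' \<longleftrightarrow> (u, v) \<in> arcs T) \<and>
           ((f u, f v) \<in> sib_less T' \<longleftrightarrow> (u, v) \<in> sib_less T)))"

text \<open>A Family Tree is countable, hence isomorphic to one whose vertices are natural numbers;
  isomorphism classes are represented by the sets of those copies.\<close>

definition iso_class :: "'v rom_tree \<Rightarrow> nat rom_tree set" where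
  "iso_class T = {T'. family_tree T' \<and> tree_iso T T'}"

definition tree_classes :: "nat rom_tree set set" where
  "tree_classes = {iso_class T | T :: nat rom_tree. family_tree T}"

definition tree_ball :: "nat \<Rightarrow> 'v rom_tree \<Rightarrow> 'v rom_tree" where
  "tree_ball r T =
     (let B = {v \<in> verts T. \<exists>k\<le>r. (root T, v) \<in> (arcs T \<union> (arcs T)\<inverse>) ^^ k} in
      T\<lparr>verts := B,
        parent := (\<lambda>u. case parent T u of None \<Rightarrow> None
                                        | Some v \<Rightarrow> if v \<in> B then Some v else None),
        sib_less := sib_less T \<inter> B \<times> B\<rparr>)"

definition local_topology :: "nat rom_tree set topology" where
  "local_topology = topology_generated_by
     {{c \<in> tree_classes. \<exists>T'\<in>c. tree_iso (tree_ball r T) (tree_ball r T')}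
       | r (T :: nat rom_tree). family_tree T}"

definition tree_space :: "nat rom_tree set measure" where
  "tree_space = sigma tree_classes {U. openin local_topology U}"


section \<open>RLS order, succession line and the extended backward map\<close>

definition anc :: "'v rom_tree \<Rightarrow> nat \<Rightarrow> 'v \<Rightarrow> 'v option" where
  "anc T k u = ((\<lambda>p. Option.bind p (parent T)) ^^ k) (Some u)"

definition rls :: "'v rom_tree \<Rightarrow> 'v \<Rightarrow> 'v \<Rightarrow> bool" where
  "rls T u v \<longleftrightarrow>
     (\<exists>k>0. anc T k u = Some v) \<or>
     (\<exists>m>0. \<exists>n>0. \<exists>w. anc T m u = Some w \<and> anc T n v = Some w \<and>
        (\<forall>m'>0. \<forall>n'>0. \<forall>w'. anc T m' u = Some w' \<and> anc T n' v = Some w' \<longrightarrow>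
            m \<le> m' \<and> n \<le> n') \<and>
        (the (anc T (m - 1) u), the (anc T (n - 1) v)) \<in> sib_less T)"

definition is_rls_pred :: "'v rom_tree \<Rightarrow> 'v \<Rightarrow> 'v \<Rightarrow> bool" where
  "is_rls_pred T u v \<longleftrightarrow>
     v \<in> verts T \<and> rls T v u \<and> (\<forall>w\<in>verts T. rls T w u \<longrightarrow> w = v \<or> rls T w v)"

definition is_rls_succ :: "'v rom_tree \<Rightarrow> 'v \<Rightarrow> 'v \<Rightarrow> bool" where
  "is_rls_succ T u v \<longleftrightarrow>
     v \<in> verts T \<and> rls T u v \<and> (\<forall>w\<in>verts T. rls T u w \<longrightarrow> w = v \<or> rls T v w)"

definition step_back :: "'v rom_tree \<Rightarrow> 'v \<Rightarrow> 'v" where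
  "step_back T u = (if \<exists>v. is_rls_pred T u v then THE v. is_rls_pred T u v else u)"

definition step_forth :: "'v rom_tree \<Rightarrow> 'v \<Rightarrow> 'v" where
  "step_forth T u = (if \<exists>v. is_rls_succ T u v then THE v. is_rls_succ T u v else u)"

definition succession_line :: "'v rom_tree \<Rightarrow> int \<Rightarrow> 'v" where
  "succession_line T n =
     (if n \<ge> 0 then (step_forth T ^^ nat n) (root T) else (step_back T ^^ nat (- n)) (root T))"

definition bi_infinite_path :: "'v rom_tree \<Rightarrow> (int \<Rightarrow> 'v) \<Rightarrow> bool" where
  "bi_infinite_path T p \<longleftrightarrow> (\<forall>i. (p i, p (i + 1)) \<in> arcs T)"

text \<open>The backward map is meant for trees with at most one bi-infinite path and marks at least
  \<open>-1\<close>.  The defining formula makes sense for every tree, so it is used as a total function;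
  the trees produced by \<open>join_bushes\<close> below always lie in the intended domain.\<close>

definition backward_tree :: "'v rom_tree \<Rightarrow> int \<Rightarrow> int" where
  "backward_tree T n =
     (let u = succession_line T (n + 1) in
      if \<exists>p. bi_infinite_path T p \<and> u \<in> range p
      then int (num_children T u) + mark T u - 1
      else int (num_children T u) - 1)"

text \<open>\<open>backward_tree\<close> is invariant under isomorphism, so the choice of representative is
  immaterial.\<close>

definition backward_map :: "nat rom_tree set \<Rightarrow> (int \<Rightarrow> int)" where
  "backward_map c = backward_tree (SOME T. T \<in> c)"


section \<open>Ordered Galton-Watson trees and the marked Eternal Kesten Tree\<close>

text \<open>Finite rooted ordered trees (root without parent) up to isomorphism: a vertex with the
  list of the subtrees of its children, in increasing order.\<close>

datatype ord_tree = Node "ord_tree list"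

text \<open>Probability that the ordered Galton-Watson tree is a given finite tree: the root has
  \<open>k\<close> children with probability \<open>\<pi> k\<close>, and given this their descendant trees are independent
  Galton-Watson trees.\<close>

fun gw_prob :: "(nat \<Rightarrow> real) \<Rightarrow> ord_tree \<Rightarrow> real" where
  "gw_prob \<pi> (Node ts) = \<pi> (length ts) * (\<Prod>t\<leftarrow>ts. gw_prob \<pi> t)"

text \<open>A marked bush \<open>(n, Node ts)\<close> has mark \<open>n\<close> at its root, and mark \<open>-1\<close> elsewhere.  Here
  \<open>q n k\<close> is the probability that the root has mark \<open>n\<close> and \<open>k\<close> children.\<close>

fun bush_prob :: "(nat \<Rightarrow> nat \<Rightarrow> real) \<Rightarrow> (nat \<Rightarrow> real) \<Rightarrow> nat \<times> ord_tree \<Rightarrow> real" where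
  "bush_prob q \<pi> (n, Node ts) = q n (length ts) * (\<Prod>t\<leftarrow>ts. gw_prob \<pi> t)"

definition bush_law ::
    "(nat \<Rightarrow> nat \<Rightarrow> real) \<Rightarrow> (nat \<Rightarrow> real) \<Rightarrow> (nat \<times> ord_tree) measure" where
  "bush_law q \<pi> = density (count_space UNIV) (\<lambda>b. ennreal (bush_prob q \<pi> b))"

text \<open>Vertices of a finite ordered tree as addresses: \<open>[]\<close> is the root, and \<open>w @ [k]\<close> is the
  child number \<open>k\<close> of \<open>w\<close>, counted from \<open>0\<close> in increasing order.\<close>

fun is_address :: "ord_tree \<Rightarrow> nat list \<Rightarrow> bool" where
  "is_address t [] \<longleftrightarrow> True"
| "is_address (Node ts) (k # w) \<longleftrightarrow> k < length ts \<and> is_address (ts ! k) w"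

text \<open>The vertex \<open>(i, w)\<close> is the vertex \<open>w\<close> of the \<open>i\<close>-th bush, so \<open>(i, [])\<close> is the root of that
  bush; it becomes the smallest child of \<open>(i + 1, [])\<close>.\<close>

definition join_bushes :: "(int \<Rightarrow> nat \<times> ord_tree) \<Rightarrow> (int \<times> nat list) rom_tree" where
  "join_bushes b =
     (let V = {(i, w). is_address (snd (b i)) w} in
      \<lparr>verts = V,
       parent = (\<lambda>(i, w). if w = [] then Some (i + 1, []) else Some (i, butlast w)),
       sib_less = {((i, w @ [k]), (i, w @ [l])) | i w k l. k < l} \<inter> V \<times> V
                \<union> {((i, []), (i + 1, [k])) | i k. True} \<inter> V \<times> V,
       root = (0, []),
       mark = (\<lambda>(i, w). if w = [] then int (fst (b i)) else - 1)\<rparr>)"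

definition MEKT :: "(nat \<Rightarrow> nat \<Rightarrow> real) \<Rightarrow> (nat \<Rightarrow> real) \<Rightarrow> nat rom_tree set measure" where
  "MEKT q \<pi> =
     distr (Pi\<^sub>M UNIV (\<lambda>_ :: int. bush_law q \<pi>)) tree_space (\<lambda>b. iso_class (join_bushes b))"

end

theory Submission
  imports Defs
begin

text \<open>Listing the vertices of a marked bush in post-order and writing down the number of children
  minus one, with the mark added and the one kept at the root, gives a word whose proper prefixes have
  negative sums and whose total is nonnegative: the increments of the walk up to its first record.
  This is a bijection between marked bushes and record blocks, and the powers of \<open>c\<close> cancel along
  it, so the bush law is the law of a record block.  Post-order of the joined bushes is the RLS
  order, hence the backward map of the joined tree is the two-sided concatenation of i.i.d. record
  blocks with the origin at a block boundary.

  For \<open>n \<ge> K\<close> the window \<open>[- K, K]\<close> seen from the \<open>n\<close>-th record is a function of the first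
  \<open>n + K + 1\<close> record blocks, so its law is already that of the limit.  A bounded continuous
  function is squeezed between its infimum and its supremum over such windows.\<close>

section \<open>Ancestors and the RLS order\<close>

text \<open>\<open>backward_map\<close> evaluates \<open>backward_tree\<close> at a representative
  chosen by \<open>SOME\<close>, while the sigma-algebra on classes knows only balls around the
  root; its measurability is the main obstacle. Vertices are therefore named by walks from the root.
  A name of bounded length stays in a ball of bounded radius, so each entry of the table
  \<open>diagram\<close> is a locally constant function of the class, and ancestors, RLS order,
  succession line and bi-infinite path become countable quantifications over names. Invariance under
  isomorphism follows from the same table.

  The powers of c cancel because a vertex with k children carries c^(k-1) and these exponents are
  the letters of the degree word, whose sum is -1: every subtree of a bush root contributes 1/c, and
  the factor c^k in \<open>q\<close> absorbs the k of them.

  The positive mean makes records recur almost surely, so the path to the right of 0 is entirely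
  made of blocks; this also shows that the bush law has total mass 1. Only that half of the path is
  read: the left half of the limit arises by moving the origin to the n-th record.\<close>

lemma anc_0 [simp]: "anc T 0 u = Some u"
  by (simp add: anc_def)

lemma anc_Suc: "anc T (Suc k) u = Option.bind (anc T k u) (parent T)"
  by (simp add: anc_def)

lemma anc_add: "anc T (m + n) u = Option.bind (anc T m u) (anc T n)"
proof (induction n)
  case 0
  show ?case by (cases "anc T m u") auto
next
  case (Suc n)
  then show ?case by (cases "anc T m u") (auto simp: anc_Suc)
qed

lemma anc_1 [simp]: "anc T (Suc 0) u = parent T u"
  by (simp add: anc_Suc)

lemma anc_le:
  assumes "anc T n u = Some w" "m \<le> n"
  shows "\<exists>v. anc T m u = Some v \<and> anc T (n - m) v = Some w"
proof -
  have "anc T n u = Option.bind (anc T m u) (anc T (n - m))"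
    using anc_add[of T m "n - m" u] assms by simp
  with assms show ?thesis by (cases "anc T m u") auto
qed

lemma parent_arcs:
  assumes "family_tree T" "u \<in> verts T"
  shows "parent T u = Some v \<longleftrightarrow> (u, v) \<in> arcs T"
  using assms by (auto simp: family_tree_def arcs_def)

lemma arcs_verts: "(u, v) \<in> arcs T \<Longrightarrow> u \<in> verts T \<and> v \<in> verts T"
  by (simp add: arcs_def)

lemma anc_verts:
  assumes "family_tree T" "u \<in> verts T" "anc T k u = Some v"
  shows "v \<in> verts T"
  using assms(3)
proof (induction k arbitrary: v)
  case 0
  then show ?case using assms(2) by simp
next
  case (Suc k)
  then show ?case using assms(1)
    by (cases "anc T k u") (auto simp: anc_Suc family_tree_def)
qed

lemma anc_trancl:
  assumes "family_tree T" "u \<in> verts T" "anc T (Suc k) u = Some v"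
  shows "(u, v) \<in> (arcs T)\<^sup>+"
  using assms(3)
proof (induction k arbitrary: v)
  case 0
  then show ?case using parent_arcs[OF assms(1,2)] by auto
next
  case (Suc k)
  then obtain w where w: "anc T (Suc k) u = Some w" "parent T w = Some v"
    by (cases "anc T (Suc k) u") (auto simp: anc_Suc[of T "Suc k"])
  with Suc.IH have "(u, w) \<in> (arcs T)\<^sup>+" by blast
  moreover have "(w, v) \<in> arcs T"
    using parent_arcs[OF assms(1) anc_verts[OF assms(1,2) w(1)]] w(2) by blast
  ultimately show ?case by (rule trancl_into_trancl)
qed

lemma anc_irrefl:
  assumes "family_tree T" "u \<in> verts T" "k > 0"
  shows "anc T k u \<noteq> Some u"
proof
  assume "anc T k u = Some u"
  with assms anc_trancl[OF assms(1,2), of "k - 1" u] have "(u, u) \<in> (arcs T)\<^sup>+" by simp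
  then show False using assms(1) by (auto simp: family_tree_def acyclic_def)
qed

lemma anc_inj:
  assumes "family_tree T" "u \<in> verts T" "anc T m u = Some w" "anc T n u = Some w"
  shows "m = n"
proof -
  have *: "\<not> m < n" if mn: "anc T m u = Some w" "anc T n u = Some w" for m n
  proof
    assume "m < n"
    with anc_add[of T m "n - m" u] mn have "anc T (n - m) w = Some w" by simp
    with anc_irrefl[OF assms(1) anc_verts[OF assms(1,2) mn(1)], of "n - m"] \<open>m < n\<close>
    show False by simp
  qed
  from *[of m n] *[of n m] assms show ?thesis by simp
qed

lemma sib_less_arcs:
  assumes "family_tree T" "(u, v) \<in> sib_less T"
  obtains w where "w \<in> verts T" "(u, w) \<in> arcs T" "(v, w) \<in> arcs T"
  using assms by (fastforce simp: family_tree_def children_def)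

lemma sib_less_asym:
  assumes "family_tree T" "(u, v) \<in> sib_less T"
  shows "(v, u) \<notin> sib_less T"
proof
  assume vu: "(v, u) \<in> sib_less T"
  obtain w where w: "w \<in> verts T" "(u, w) \<in> arcs T" "(v, w) \<in> arcs T"
    using sib_less_arcs[OF assms] .
  let ?R = "sib_less T \<inter> children T w \<times> children T w"
  have "strict_linear_order_on (children T w) ?R"
    using assms(1) w(1) by (auto simp: family_tree_def)
  then have "trans ?R" "irrefl ?R" by (auto simp: strict_linear_order_on_def)
  moreover have "(u, v) \<in> ?R" "(v, u) \<in> ?R"
    using w assms(2) vu by (auto simp: children_def)
  ultimately show False by (meson irrefl_def transE)
qed

lemma sib_less_irrefl: "family_tree T \<Longrightarrow> (u, u) \<notin> sib_less T"
  using sib_less_asym by metis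

text \<open>The second clause of \<open>rls\<close> without its minimality requirement. The
  exponents m and n lead to the two siblings rather than to their parent, so 0 is allowed: u or v
  may itself be one of the siblings.\<close>

definition rls_siblings :: "'v rom_tree \<Rightarrow> nat \<Rightarrow> nat \<Rightarrow> 'v \<Rightarrow> 'v \<Rightarrow> bool" where
  "rls_siblings T m n u v \<longleftrightarrow>
     (\<exists>w u' v'. anc T (Suc m) u = Some w \<and> anc T (Suc n) v = Some w \<and>
        anc T m u = Some u' \<and> anc T n v = Some v' \<and> (u', v') \<in> sib_less T)"

text \<open>If a common ancestor of \<open>u\<close> and \<open>v\<close> lay strictly below the parent of the two siblings,
  then one of the siblings would be an ancestor of both \<open>u\<close> and \<open>v\<close>, hence equal to the other.
  So the minimality clause in \<^const>\<open>rls\<close> is automatic.\<close>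

lemma rls_siblings_minimal:
  assumes T: "family_tree T" and uv: "u \<in> verts T" "v \<in> verts T"
    and s: "rls_siblings T m n u v"
    and c: "m' > 0" "n' > 0" "anc T m' u = Some x" "anc T n' v = Some x"
  shows "Suc m \<le> m' \<and> Suc n \<le> n'"
proof -
  from s obtain w u' v' where w: "anc T (Suc m) u = Some w" "anc T (Suc n) v = Some w"
    and less: "anc T m u = Some u'" "anc T n v = Some v'" "(u', v') \<in> sib_less T"
    unfolding rls_siblings_def by blast
  have ne: "u' \<noteq> v'" using sib_less_irrefl[OF T] less(3) by metis
  \<comment> \<open>A bound for one of the two exponents, stated for arbitrary vertices so that it
    also applies with u and v exchanged. If w' were at or below a, then a would be an ancestor of
    v1, and at the same level as b, because w is reached from v1 at one level only.\<close>
  have *: "m1 \<le> m'"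
    if "u1 \<in> verts T" "v1 \<in> verts T" "anc T (Suc m1) u1 = Some w" "anc T (Suc n1) v1 = Some w"
      "anc T m1 u1 = Some a" "anc T n1 v1 = Some b" "a \<noteq> b"
      "anc T (Suc m') u1 = Some w'" "anc T n' v1 = Some w'" for u1 v1 m1 n1 a b m' n' w'
  proof (rule ccontr)
    assume "\<not> m1 \<le> m'"
    then have le: "Suc m' \<le> m1" by simp
    then obtain j where j: "m1 = Suc m' + j" using le_Suc_ex by blast
    have 1: "anc T j w' = Some a"
      using that(5,8) anc_add[of T "Suc m'" j u1] j by simp
    then have 2: "anc T (n' + j) v1 = Some a" using that(9) by (simp add: anc_add)
    have "parent T a = Some w" using that(3,5) by (simp add: anc_Suc)
    then have "anc T (Suc (n' + j)) v1 = Some w" using 2 by (simp add: anc_Suc)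
    then have "Suc (n' + j) = Suc n1" using anc_inj[OF T that(2)] that(4) by blast
    with 2 that(6,7) show False by simp
  qed
  show ?thesis
    using *[OF uv w less(1,2) ne, of "m' - 1" x n']
      *[OF uv(2,1) w(2,1) less(2,1) ne[symmetric], of "n' - 1" x m'] c by simp linarith
qed

lemma rls_iff:
  assumes T: "family_tree T" and uv: "u \<in> verts T" "v \<in> verts T"
  shows "rls T u v \<longleftrightarrow> (\<exists>k. anc T (Suc k) u = Some v) \<or> (\<exists>m n. rls_siblings T m n u v)"
proof
  assume "rls T u v"
  then consider k where "k > 0" "anc T k u = Some v"
    | m n w where "m > 0" "n > 0" "anc T m u = Some w" "anc T n v = Some w"
        "(the (anc T (m - 1) u), the (anc T (n - 1) v)) \<in> sib_less T"
    unfolding rls_def by auto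
  then show "(\<exists>k. anc T (Suc k) u = Some v) \<or> (\<exists>m n. rls_siblings T m n u v)"
  proof cases
    case (1 k)
    then show ?thesis using gr0_conv_Suc by auto
  next
    case (2 m n w)
    then obtain m' n' where mn: "m = Suc m'" "n = Suc n'" using gr0_conv_Suc by auto
    obtain a where "anc T m' u = Some a" using anc_le[OF 2(3), of m'] mn by auto
    moreover obtain b where "anc T n' v = Some b" using anc_le[OF 2(4), of n'] mn by auto
    ultimately have "rls_siblings T m' n' u v" using 2 mn by (simp add: rls_siblings_def)
    then show ?thesis by blast
  qed
next
  assume "(\<exists>k. anc T (Suc k) u = Some v) \<or> (\<exists>m n. rls_siblings T m n u v)"
  then show "rls T u v"
  proof (elim disjE exE)
    fix k assume "anc T (Suc k) u = Some v"
    then show "rls T u v" unfolding rls_def by blast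
  next
    fix m n assume s: "rls_siblings T m n u v"
    then obtain w u' v' where w: "anc T (Suc m) u = Some w" "anc T (Suc n) v = Some w"
      "anc T m u = Some u'" "anc T n v = Some v'" "(u', v') \<in> sib_less T"
      unfolding rls_siblings_def by blast
    show "rls T u v" unfolding rls_def
      by (intro disjI2 exI[of _ "Suc m"] exI[of _ "Suc n"] exI[of _ w] conjI allI impI)
        (use w rls_siblings_minimal[OF T uv s] in auto)
  qed
qed

text \<open>Two ancestor relations in opposite directions would close a directed cycle. Two sibling
  relations have equal exponents by minimality and contradict the order of the siblings. In the
  mixed case, with v an ancestor of u, the parent of v is a common ancestor; minimality forces n =
  0, and v would be its own smaller or larger sibling. Asymmetry is what makes RLS neighbours
  unique.\<close>

lemma rls_asym:
  assumes T: "family_tree T" and uv: "u \<in> verts T" "v \<in> verts T" and r: "rls T u v"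
  shows "\<not> rls T v u"
proof
  assume r': "rls T v u"
  have mixed: False if uv: "u \<in> verts T" "v \<in> verts T" and k: "anc T (Suc k) u = Some v"
    and s: "rls_siblings T m n u v \<or> rls_siblings T n m v u" for u v k m n
  proof -
    from s obtain w where w: "anc T (Suc m) u = Some w" "anc T (Suc n) v = Some w"
      unfolding rls_siblings_def by blast
    have min: "Suc m \<le> m' \<and> Suc n \<le> n'"
      if "m' > 0" "n' > 0" "anc T m' u = Some w'" "anc T n' v = Some w'" for m' n' w'
      using s that rls_siblings_minimal[OF T uv] rls_siblings_minimal[OF T uv(2,1)] by blast
    obtain p where p: "anc T 1 v = Some p"
      using anc_le[OF w(2), of 1] by auto
    have kp: "anc T (Suc k + 1) u = Some p"
      unfolding anc_add[of T "Suc k"] using k p by simp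
    have "n = 0" using min[OF _ _ kp p] by simp
    then have "w = p" using w p by simp
    then have "Suc m = Suc k + 1" using anc_inj[OF T uv(1) w(1)] kp by simp
    with s \<open>n = 0\<close> k sib_less_irrefl[OF T] show False
      by (auto simp: rls_siblings_def)
  qed
  have both: False if "rls_siblings T m n u v" "rls_siblings T n' m' v u" for m n m' n'
  proof -
    have "m = m'" "n = n'"
      using that rls_siblings_minimal[OF T uv that(1), of "Suc m'" "Suc n'"]
        rls_siblings_minimal[OF T uv(2,1) that(2), of "Suc n" "Suc m"]
      by (auto simp: rls_siblings_def)
    with that sib_less_asym[OF T] show False by (auto simp: rls_siblings_def)
  qed
  have anc_both: False if "anc T (Suc k) u = Some v" "anc T (Suc k') v = Some u" for k k'
  proof -
    have "anc T (Suc k + Suc k') u = Some u"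
      unfolding anc_add[of T "Suc k"] using that by simp
    then show False using anc_irrefl[OF T uv(1), of "Suc k + Suc k'"] by simp
  qed
  from r r' show False unfolding rls_iff[OF T uv] rls_iff[OF T uv(2,1)]
  proof (elim disjE exE)
    fix k m n
    assume "anc T (Suc k) u = Some v" "rls_siblings T m n v u"
    then show False using mixed[OF uv, of k n m] by simp
  next
    fix k m n
    assume "anc T (Suc k) v = Some u" "rls_siblings T m n u v"
    then show False using mixed[OF uv(2,1), of k n m] by simp
  qed (use both anc_both in metis)+
qed

lemma is_rls_succ_unique:
  assumes "family_tree T" "is_rls_succ T u v" "is_rls_succ T u v'"
  shows "v = v'"
  using assms rls_asym[OF assms(1), of v v'] by (auto simp: is_rls_succ_def)

lemma is_rls_pred_unique:
  assumes "family_tree T" "is_rls_pred T u v" "is_rls_pred T u v'"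
  shows "v = v'"
  using assms rls_asym[OF assms(1), of v v'] by (auto simp: is_rls_pred_def)

text \<open>The graph of the step with its default value made explicit, in the shape that
  \<open>d_step\<close> copies for names.\<close>

lemma step_forth_eq:
  assumes "family_tree T"
  shows "step_forth T u = v \<longleftrightarrow>
    is_rls_succ T u v \<or> ((\<forall>w\<in>verts T. \<not> is_rls_succ T u w) \<and> u = v)"
proof (cases "\<exists>v. is_rls_succ T u v")
  case True
  then obtain w where w: "is_rls_succ T u w" by blast
  then have "step_forth T u = w"
    unfolding step_forth_def using is_rls_succ_unique[OF assms] by (metis (mono_tags) the_equality)
  with w show ?thesis using is_rls_succ_unique[OF assms] by (metis is_rls_succ_def)
next
  case False
  then show ?thesis by (auto simp: step_forth_def)
qed

lemma step_back_eq:
  assumes "family_tree T"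
  shows "step_back T u = v \<longleftrightarrow>
    is_rls_pred T u v \<or> ((\<forall>w\<in>verts T. \<not> is_rls_pred T u w) \<and> u = v)"
proof (cases "\<exists>v. is_rls_pred T u v")
  case True
  then obtain w where w: "is_rls_pred T u w" by blast
  then have "step_back T u = w"
    unfolding step_back_def using is_rls_pred_unique[OF assms] by (metis (mono_tags) the_equality)
  with w show ?thesis using is_rls_pred_unique[OF assms] by (metis is_rls_pred_def)
next
  case False
  then show ?thesis by (auto simp: step_back_def)
qed

lemma step_forth_verts: "family_tree T \<Longrightarrow> u \<in> verts T \<Longrightarrow> step_forth T u \<in> verts T"
  using step_forth_eq[of T u "step_forth T u"] by (auto simp: is_rls_succ_def)

lemma step_back_verts: "family_tree T \<Longrightarrow> u \<in> verts T \<Longrightarrow> step_back T u \<in> verts T"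
  using step_back_eq[of T u "step_back T u"] by (auto simp: is_rls_pred_def)

section \<open>Naming vertices by walks from the root\<close>

text \<open>By transitivity everything below v is below v', and v itself is gained. Hence the number
  of smaller siblings identifies a child, and being a cardinality it is preserved by
  isomorphisms.\<close>

lemma sib_less_mono_card:
  assumes T: "family_tree T" and u: "u \<in> verts T" "v \<in> children T u" "v' \<in> children T u"
    and less: "(v, v') \<in> sib_less T"
  shows "card {w \<in> children T u. (w, v) \<in> sib_less T} < card {w \<in> children T u. (w, v') \<in> sib_less T}"
proof (rule psubset_card_mono)
  have fin: "finite (children T u)" using T u by (auto simp: family_tree_def)
  then show "finite {w \<in> children T u. (w, v') \<in> sib_less T}" by simp
  have "trans (sib_less T \<inter> children T u \<times> children T u)"
    using T u by (auto simp: family_tree_def strict_linear_order_on_def)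
  then have "(w, v') \<in> sib_less T" if "w \<in> children T u" "(w, v) \<in> sib_less T" for w
    using that u less unfolding trans_def by blast
  then show "{w \<in> children T u. (w, v) \<in> sib_less T} \<subset> {w \<in> children T u. (w, v') \<in> sib_less T}"
    using less u sib_less_irrefl[OF T] by blast
qed

definition kth_child :: "'v rom_tree \<Rightarrow> nat \<Rightarrow> 'v \<Rightarrow> 'v \<Rightarrow> bool" where
  "kth_child T k u v \<longleftrightarrow> v \<in> children T u \<and> card {w \<in> children T u. (w, v) \<in> sib_less T} = k"

lemma kth_child_unique:
  assumes T: "family_tree T" and u: "u \<in> verts T" and v: "kth_child T k u v" "kth_child T k u v'"
  shows "v = v'"
proof (rule ccontr)
  assume ne: "v \<noteq> v'"
  have ch: "v \<in> children T u" "v' \<in> children T u" using v by (auto simp: kth_child_def)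
  have "total_on (children T u) (sib_less T \<inter> children T u \<times> children T u)"
    using T u by (auto simp: family_tree_def strict_linear_order_on_def)
  then have "(v, v') \<in> sib_less T \<or> (v', v) \<in> sib_less T"
    using ch ne by (auto simp: total_on_def)
  with sib_less_mono_card[OF T u ch] sib_less_mono_card[OF T u ch(2,1)] v show False
    by (auto simp: kth_child_def)
qed

text \<open>Vertices are named by walks from the root, the last step coming first: \<open>0\<close> leads to the
  parent and \<open>Suc k\<close> to the \<open>k\<close>-th child.\<close>

definition move :: "'v rom_tree \<Rightarrow> nat \<Rightarrow> 'v \<Rightarrow> 'v option" where
  "move T m u = (case m of 0 \<Rightarrow> parent T u
     | Suc k \<Rightarrow> if \<exists>v. kth_child T k u v then Some (THE v. kth_child T k u v) else None)"

fun vertex_at :: "'v rom_tree \<Rightarrow> nat list \<Rightarrow> 'v option" where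
  "vertex_at T [] = Some (root T)"
| "vertex_at T (m # a) = Option.bind (vertex_at T a) (move T m)"

lemma move_0 [simp]: "move T 0 = parent T"
  by (auto simp: move_def)

lemma move_Suc:
  assumes "family_tree T" "u \<in> verts T"
  shows "move T (Suc k) u = Some v \<longleftrightarrow> kth_child T k u v"
proof -
  have "(THE v. kth_child T k u v) = v" if "kth_child T k u v" for v
    using kth_child_unique[OF assms that] that by blast
  then show ?thesis by (auto simp: move_def)
qed

lemma move_adjacent:
  assumes "family_tree T" "u \<in> verts T" "move T m u = Some v"
  shows "(u, v) \<in> arcs T \<union> (arcs T)\<inverse>"
  using assms by (cases m) (auto simp: parent_arcs move_Suc kth_child_def children_def)

lemma vertex_at_verts:
  assumes "family_tree T" "vertex_at T a = Some v"
  shows "v \<in> verts T"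
  using assms(2)
proof (induction a arbitrary: v)
  case Nil
  then show ?case using assms(1) by (auto simp: family_tree_def)
next
  case (Cons m a)
  then obtain u where u: "vertex_at T a = Some u" "move T m u = Some v"
    by (cases "vertex_at T a") auto
  with Cons.IH move_adjacent[OF assms(1)] arcs_verts show ?case by fastforce
qed

lemma vertex_at_path:
  assumes "family_tree T" "vertex_at T a = Some v"
  shows "(root T, v) \<in> (arcs T \<union> (arcs T)\<inverse>) ^^ length a"
  using assms(2)
proof (induction a arbitrary: v)
  case Nil
  then show ?case by simp
next
  case (Cons m a)
  then obtain u where u: "vertex_at T a = Some u" "move T m u = Some v"
    by (cases "vertex_at T a") auto
  with Cons.IH move_adjacent[OF assms(1) vertex_at_verts[OF assms(1) u(1)] u(2)] show ?case
    by (auto intro: relcompI)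
qed

lemma vertex_at_append_0: "vertex_at T (replicate k 0 @ a) = Option.bind (vertex_at T a) (anc T k)"
  by (induction k) (auto simp: anc_Suc split: bind_splits)

lemma vertex_at_surj:
  assumes T: "family_tree T" and v: "v \<in> verts T"
  obtains a where "vertex_at T a = Some v"
proof -
  have "(root T, v) \<in> (arcs T \<union> (arcs T)\<inverse>)\<^sup>*" using T v by (auto simp: family_tree_def)
  then have "\<exists>a. vertex_at T a = Some v"
  proof (induction rule: rtrancl_induct)
    case base
    show ?case by (rule exI[of _ "[]"]) simp
  next
    case (step u v)
    then obtain a where a: "vertex_at T a = Some u" by blast
    have u: "u \<in> verts T" using vertex_at_verts[OF T a] .
    from step(2) show ?case
    proof
      assume "(u, v) \<in> arcs T"
      then have "vertex_at T (0 # a) = Some v" using a parent_arcs[OF T u] by simp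
      then show ?case by blast
    next
      assume "(u, v) \<in> (arcs T)\<inverse>"
      then have "kth_child T (card {w \<in> children T u. (w, v) \<in> sib_less T}) u v"
        by (simp add: kth_child_def children_def)
      then have "vertex_at T (Suc (card {w \<in> children T u. (w, v) \<in> sib_less T}) # a) = Some v"
        using a move_Suc[OF T u] by simp
      then show ?case by blast
    qed
  qed
  with that show thesis by blast
qed

text \<open>All that the backward map needs to know about the tree, expressed through the names.\<close>

definition diagram :: "'v rom_tree \<Rightarrow> nat list \<Rightarrow> nat list \<Rightarrow> bool \<times> bool \<times> bool \<times> int \<times> nat" where
  "diagram T a b = (case vertex_at T a of
      None \<Rightarrow> (False, False, False, 0, 0)
    | Some u \<Rightarrow> (True, vertex_at T b = Some u,
        (\<exists>v. vertex_at T b = Some v \<and> (u, v) \<in> sib_less T), mark T u, num_children T u))"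

section \<open>Balls around the root and their isomorphisms\<close>

lemma tree_ball_simps:
  "root (tree_ball r T) = root T" "mark (tree_ball r T) = mark T"
  "verts (tree_ball r T) = {v \<in> verts T. \<exists>k\<le>r. (root T, v) \<in> (arcs T \<union> (arcs T)\<inverse>) ^^ k}"
  "sib_less (tree_ball r T) = sib_less T \<inter> verts (tree_ball r T) \<times> verts (tree_ball r T)"
  "arcs (tree_ball r T) = arcs T \<inter> verts (tree_ball r T) \<times> verts (tree_ball r T)"
  by (auto simp: tree_ball_def Let_def arcs_def split: option.splits if_splits)

text \<open>A name of length at most \<open>r\<close> refers to a vertex of the ball of radius \<open>r\<close>, and the step
  from a vertex at distance less than \<open>r\<close> is determined by that ball.\<close>

locale ball_iso =
  fixes T :: "'v rom_tree" and T' :: "'w rom_tree" and r :: nat and f :: "'v \<Rightarrow> 'w"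
  assumes T: "family_tree T" and T': "family_tree T'"
    and bij: "bij_betw f (verts (tree_ball r T)) (verts (tree_ball r T'))"
    and f_root: "f (root T) = root T'"
    and f_mark: "\<And>u. u \<in> verts (tree_ball r T) \<Longrightarrow> mark T' (f u) = mark T u"
    and f_arcs: "\<And>u v. u \<in> verts (tree_ball r T) \<Longrightarrow> v \<in> verts (tree_ball r T) \<Longrightarrow>
      (f u, f v) \<in> arcs T' \<longleftrightarrow> (u, v) \<in> arcs T"
    and f_sib: "\<And>u v. u \<in> verts (tree_ball r T) \<Longrightarrow> v \<in> verts (tree_ball r T) \<Longrightarrow>
      (f u, f v) \<in> sib_less T' \<longleftrightarrow> (u, v) \<in> sib_less T"
begin

abbreviation "B \<equiv> verts (tree_ball r T)"
abbreviation "B' \<equiv> verts (tree_ball r T')"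

lemma adjacent_in_B:
  assumes "(root T, u) \<in> (arcs T \<union> (arcs T)\<inverse>) ^^ k" "k < r" "(u, v) \<in> arcs T \<or> (v, u) \<in> arcs T"
  shows "v \<in> B"
proof -
  have "(root T, v) \<in> (arcs T \<union> (arcs T)\<inverse>) ^^ Suc k"
    using assms by (auto intro: relcompI)
  then show ?thesis using assms(2,3) arcs_verts[of _ _ T] unfolding tree_ball_simps
    by (auto intro!: exI[of _ "Suc k"])
qed

lemma adjacent_in_B':
  assumes "(root T', u) \<in> (arcs T' \<union> (arcs T')\<inverse>) ^^ k" "k < r" "(u, v) \<in> arcs T' \<or> (v, u) \<in> arcs T'"
  shows "v \<in> B'"
proof -
  have "(root T', v) \<in> (arcs T' \<union> (arcs T')\<inverse>) ^^ Suc k"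
    using assms by (auto intro: relcompI)
  then show ?thesis using assms(2,3) arcs_verts[of _ _ T'] unfolding tree_ball_simps
    by (auto intro!: exI[of _ "Suc k"])
qed

context
  fixes k u
  assumes ku: "k < r" "u \<in> verts T" "(root T, u) \<in> (arcs T \<union> (arcs T)\<inverse>) ^^ k"
    "(root T', f u) \<in> (arcs T' \<union> (arcs T')\<inverse>) ^^ k"
begin

lemma u_B: "u \<in> B"
  using ku by (auto simp: tree_ball_simps intro!: exI[of _ k])

lemma fu_B': "f u \<in> B'"
  using bij u_B by (auto simp: bij_betw_def)

lemma children_image: "children T' (f u) = f ` children T u" and children_B: "children T u \<subseteq> B"
proof -
  show sub: "children T u \<subseteq> B" using adjacent_in_B[OF ku(3,1)] by (auto simp: children_def)
  have sub': "children T' (f u) \<subseteq> B'" using adjacent_in_B'[OF ku(4,1)] by (auto simp: children_def)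
  show "children T' (f u) = f ` children T u"
  proof
    show "children T' (f u) \<subseteq> f ` children T u"
    proof
      fix w assume w: "w \<in> children T' (f u)"
      with sub' bij obtain v where v: "v \<in> B" "w = f v" by (auto simp: bij_betw_def)
      then show "w \<in> f ` children T u" using w f_arcs[OF v(1) u_B] by (auto simp: children_def)
    qed
    show "f ` children T u \<subseteq> children T' (f u)"
      using sub f_arcs[OF _ u_B] by (auto simp: children_def)
  qed
qed

lemma inj_f: "inj_on f B"
  using bij by (simp add: bij_betw_def)

lemma num_children_f: "num_children T' (f u) = num_children T u"
  unfolding num_children_def children_image
  by (rule card_image) (rule inj_on_subset[OF inj_f children_B])

lemma kth_child_f:
  assumes "v \<in> B"
  shows "kth_child T' j (f u) (f v) \<longleftrightarrow> kth_child T j u v"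
proof -
  have "f v \<in> f ` children T u \<longleftrightarrow> v \<in> children T u"
    using inj_on_image_mem_iff[OF inj_f assms children_B] .
  moreover have "{w \<in> f ` children T u. (w, f v) \<in> sib_less T'}
    = f ` {w \<in> children T u. (w, v) \<in> sib_less T}"
    using f_sib[OF _ assms] children_B by auto
  moreover have "card (f ` {w \<in> children T u. (w, v) \<in> sib_less T}) = card {w \<in> children T u. (w, v) \<in> sib_less T}"
    by (rule card_image, rule inj_on_subset[OF inj_f]) (use children_B in auto)
  ultimately show ?thesis unfolding kth_child_def children_image by simp
qed

lemma move_f: "move T' m (f u) = map_option f (move T m u)"
proof -
  have fu: "f u \<in> verts T'" using fu_B' by (simp add: tree_ball_simps)
  have 1: "move T' m (f u) = Some (f v) \<longleftrightarrow> move T m u = Some v" if v: "v \<in> B" for v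
    using f_arcs[OF u_B v] kth_child_f[OF v] parent_arcs[OF T ku(2)] parent_arcs[OF T' fu]
      move_Suc[OF T ku(2)] move_Suc[OF T' fu] by (cases m) auto
  have 2: "v \<in> B" if "move T m u = Some v" for v
    using move_adjacent[OF T ku(2) that] adjacent_in_B[OF ku(3,1)] by auto
  \<comment> \<open>Since k < r, a step in T' ends inside the ball and so comes from a vertex of T;
    this excludes moves that exist in T' only.\<close>
  have 3: "w \<in> B'" if "move T' m (f u) = Some w" for w
    using move_adjacent[OF T' fu that] adjacent_in_B'[OF ku(4,1)] by auto
  show ?thesis
  proof (cases "move T m u")
    case (Some v)
    then show ?thesis using 1[OF 2] by simp
  next
    case None
    have "move T' m (f u) = None"
    proof (rule ccontr)
      assume "move T' m (f u) \<noteq> None"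
      then obtain w where w: "move T' m (f u) = Some w" by blast
      with 3[OF w] bij obtain v where "v \<in> B" "w = f v" by (auto simp: bij_betw_def)
      with 1[of v] w None show False by simp
    qed
    with None show ?thesis by simp
  qed
qed

end

lemma vertex_at_f: "length a \<le> r \<Longrightarrow> vertex_at T' a = map_option f (vertex_at T a)"
proof (induction a)
  case Nil
  show ?case by (simp add: f_root)
next
  case (Cons m a)
  then have IH: "vertex_at T' a = map_option f (vertex_at T a)" by simp
  show ?case
  proof (cases "vertex_at T a")
    case None
    then show ?thesis using IH by simp
  next
    case (Some u)
    have "move T' m (f u) = map_option f (move T m u)"
      using Cons.prems vertex_at_path[OF T Some] vertex_at_path[OF T', of a "f u"] IH Some
      by (intro move_f[of "length a"]) (auto intro: vertex_at_verts[OF T])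
    then show ?thesis using IH Some by simp
  qed
qed

lemma vertex_at_B: "length a \<le> r \<Longrightarrow> vertex_at T a = Some v \<Longrightarrow> v \<in> B"
  using vertex_at_path[OF T, of a v] vertex_at_verts[OF T, of a v] by (auto simp: tree_ball_simps)

text \<open>The inequalities are strict because the number of children is part of the table: a
  vertex on the boundary of the ball may have lost its children.\<close>

lemma diagram_f:
  assumes "length a < r" "length b < r"
  shows "diagram T' a b = diagram T a b"
proof (cases "vertex_at T a")
  case None
  then show ?thesis using vertex_at_f[of a] assms by (simp add: diagram_def)
next
  case (Some u)
  have u: "u \<in> B" using vertex_at_B[of a] Some assms by simp
  have a': "vertex_at T' a = Some (f u)" using vertex_at_f[of a] Some assms by simp
  have b': "vertex_at T' b = map_option f (vertex_at T b)" using vertex_at_f[of b] assms by simp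
  have nc: "num_children T' (f u) = num_children T u"
    using assms vertex_at_path[OF T Some] vertex_at_path[OF T' a'] u
    by (intro num_children_f[of "length a"]) (auto simp: tree_ball_simps)
  have "v \<in> B" if "vertex_at T b = Some v" for v
    using vertex_at_B[of b] that assms by simp
  then have "(vertex_at T' b = Some (f u)) = (vertex_at T b = Some u)"
    "(\<exists>v. vertex_at T' b = Some v \<and> (f u, v) \<in> sib_less T') =
     (\<exists>v. vertex_at T b = Some v \<and> (u, v) \<in> sib_less T)"
    using b' bij u f_sib[OF u] by (auto simp: bij_betw_def inj_on_def)
  then show ?thesis using Some a' nc f_mark[OF u] by (simp add: diagram_def)
qed

end

lemma tree_iso_ball_diagram:
  assumes "family_tree T" "family_tree T'" "tree_iso (tree_ball r T) (tree_ball r T')"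
    "length a < r" "length b < r"
  shows "diagram T' a b = diagram T a b"
proof -
  obtain f where f: "bij_betw f (verts (tree_ball r T)) (verts (tree_ball r T'))"
    "f (root T) = root T'" "\<And>u. u \<in> verts (tree_ball r T) \<Longrightarrow> mark T' (f u) = mark T u"
    and fe: "\<And>u v. u \<in> verts (tree_ball r T) \<Longrightarrow> v \<in> verts (tree_ball r T) \<Longrightarrow>
      ((f u, f v) \<in> arcs (tree_ball r T') \<longleftrightarrow> (u, v) \<in> arcs (tree_ball r T)) \<and>
      ((f u, f v) \<in> sib_less (tree_ball r T') \<longleftrightarrow> (u, v) \<in> sib_less (tree_ball r T))"
    using assms(3) unfolding tree_iso_def tree_ball_simps(1,2) by blast
  have "f u \<in> verts (tree_ball r T')" if "u \<in> verts (tree_ball r T)" for u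
    using f(1) that by (auto simp: bij_betw_def)
  with fe have "(f u, f v) \<in> arcs T' \<longleftrightarrow> (u, v) \<in> arcs T" "(f u, f v) \<in> sib_less T' \<longleftrightarrow> (u, v) \<in> sib_less T"
    if "u \<in> verts (tree_ball r T)" "v \<in> verts (tree_ball r T)" for u v
    using that unfolding tree_ball_simps(4,5) by (metis IntD1 IntI mem_Sigma_iff)+
  with f assms interpret ball_iso T T' r f
    by unfold_locales auto
  show ?thesis using diagram_f assms by simp
qed

lemma tree_iso_relpow:
  assumes bij: "bij_betw f (verts T) (verts T')" and root: "root T \<in> verts T"
    and arcs: "\<And>u v. u \<in> verts T \<Longrightarrow> v \<in> verts T \<Longrightarrow> (f u, f v) \<in> arcs T' \<longleftrightarrow> (u, v) \<in> arcs T"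
    and v: "v \<in> verts T"
  shows "(f (root T), f v) \<in> (arcs T' \<union> (arcs T')\<inverse>) ^^ k \<longleftrightarrow> (root T, v) \<in> (arcs T \<union> (arcs T)\<inverse>) ^^ k"
  using v
proof (induction k arbitrary: v)
  case 0
  then show ?case using bij root by (auto simp: bij_betw_def inj_on_def)
next
  case (Suc k)
  show ?case
  proof
    assume "(f (root T), f v) \<in> (arcs T' \<union> (arcs T')\<inverse>) ^^ Suc k"
    then obtain w where w: "(f (root T), w) \<in> (arcs T' \<union> (arcs T')\<inverse>) ^^ k"
      "(w, f v) \<in> arcs T' \<union> (arcs T')\<inverse>" by auto
    then have "w \<in> verts T'" using arcs_verts[of _ _ T'] by auto
    then obtain u where u: "u \<in> verts T" "w = f u" using bij by (auto simp: bij_betw_def)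
    with w Suc arcs show "(root T, v) \<in> (arcs T \<union> (arcs T)\<inverse>) ^^ Suc k"
      by (auto intro!: relcompI[of _ u])
  next
    assume "(root T, v) \<in> (arcs T \<union> (arcs T)\<inverse>) ^^ Suc k"
    then obtain u where u: "(root T, u) \<in> (arcs T \<union> (arcs T)\<inverse>) ^^ k"
      "(u, v) \<in> arcs T \<union> (arcs T)\<inverse>" by auto
    then have "u \<in> verts T" using arcs_verts[of _ _ T] by auto
    with u Suc arcs show "(f (root T), f v) \<in> (arcs T' \<union> (arcs T')\<inverse>) ^^ Suc k"
      by (auto intro!: relcompI[of _ "f u"])
  qed
qed

lemma tree_iso_ball:
  assumes "family_tree T" "tree_iso T T'"
  shows "tree_iso (tree_ball r T) (tree_ball r T')"
proof -
  obtain f where f: "bij_betw f (verts T) (verts T')"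
    "f (root T) = root T'" "\<And>u. u \<in> verts T \<Longrightarrow> mark T' (f u) = mark T u"
    and fe: "\<And>u v. u \<in> verts T \<Longrightarrow> v \<in> verts T \<Longrightarrow>
      ((f u, f v) \<in> arcs T' \<longleftrightarrow> (u, v) \<in> arcs T) \<and>
      ((f u, f v) \<in> sib_less T' \<longleftrightarrow> (u, v) \<in> sib_less T)"
    using assms(2) unfolding tree_iso_def by blast
  have root: "root T \<in> verts T" using assms(1) by (simp add: family_tree_def)
  have mem: "f v \<in> verts (tree_ball r T') \<longleftrightarrow> v \<in> verts (tree_ball r T)" if "v \<in> verts T" for v
    using tree_iso_relpow[OF f(1) root _ that] fe f(1,2) that
    by (auto simp: tree_ball_simps bij_betw_def)
  have sub: "verts (tree_ball r T) \<subseteq> verts T" "verts (tree_ball r T') \<subseteq> verts T'"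
    by (auto simp: tree_ball_simps)
  have "bij_betw f (verts (tree_ball r T)) (verts (tree_ball r T'))"
    unfolding bij_betw_def
  proof
    show "inj_on f (verts (tree_ball r T))"
      using f(1) sub by (auto simp: bij_betw_def intro: inj_on_subset)
    show "f ` verts (tree_ball r T) = verts (tree_ball r T')"
    proof (intro equalityI subsetI)
      fix w assume "w \<in> f ` verts (tree_ball r T)"
      then show "w \<in> verts (tree_ball r T')" using mem sub(1) by auto
    next
      fix w assume w: "w \<in> verts (tree_ball r T')"
      with sub(2) f(1) obtain v where "v \<in> verts T" "w = f v" by (auto simp: bij_betw_def)
      with w mem show "w \<in> f ` verts (tree_ball r T)" by auto
    qed
  qed
  moreover have "mark T' (f u) = mark T u" if "u \<in> verts (tree_ball r T)" for u
    using f(3) sub(1) that by blast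
  moreover have "((f u, f v) \<in> arcs (tree_ball r T') \<longleftrightarrow> (u, v) \<in> arcs (tree_ball r T)) \<and>
      ((f u, f v) \<in> sib_less (tree_ball r T') \<longleftrightarrow> (u, v) \<in> sib_less (tree_ball r T))"
    if "u \<in> verts (tree_ball r T)" "v \<in> verts (tree_ball r T)" for u v
  proof -
    have "u \<in> verts T" "v \<in> verts T" using that sub(1) by auto
    with that fe[of u v] mem[of u] mem[of v] show ?thesis unfolding tree_ball_simps(4,5) by simp
  qed
  ultimately show ?thesis unfolding tree_iso_def tree_ball_simps(1,2)
    using f(2) by (intro exI[of _ f]) simp
qed

lemma tree_iso_diagram:
  assumes "family_tree T" "family_tree T'" "tree_iso T T'"
  shows "diagram T' = diagram T"
proof (intro ext)
  fix a b :: "nat list"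
  let ?r = "Suc (max (length a) (length b))"
  show "diagram T' a b = diagram T a b"
    using tree_iso_ball_diagram[OF assms(1,2) tree_iso_ball[OF assms(1,3), of ?r]] by simp
qed

section \<open>The backward map as a function of the names\<close>

lemma bi_infinite_pathI:
  assumes T: "family_tree T" and u: "u \<in> verts T"
    and up: "\<And>k. anc T k u \<noteq> None"
    and down: "\<And>k. \<exists>v\<in>verts T. anc T k v = Some u"
  shows "\<exists>p. bi_infinite_path T p \<and> u \<in> range p"
proof -
  define deep where "deep = (\<lambda>v. v \<in> verts T \<and> (\<forall>k. \<exists>w\<in>verts T. anc T k w = Some v))"
  have anc_child: "\<exists>c\<in>children T v. anc T k w = Some c"
    if "anc T (Suc k) w = Some v" "w \<in> verts T" for v k w
  proof -
    from that(1) obtain c where c: "anc T k w = Some c" "parent T c = Some v"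
      by (cases "anc T k w") (auto simp: anc_Suc)
    then show ?thesis using parent_arcs[OF T anc_verts[OF T that(2) c(1)]] by (auto simp: children_def)
  qed
  have deep_child: "\<exists>c. deep c \<and> c \<in> children T v" if v: "deep v" for v
  proof (rule ccontr)
    assume none: "\<not> ?thesis"
    \<comment> \<open>Koenig's argument: if no child were deep, each child c would lack descendants
      at some depth \<open>K c\<close>, and since there are finitely many children, v would have
      none beyond the maximum of these depths.\<close>
    have "\<forall>c\<in>children T v. \<exists>k. \<forall>w\<in>verts T. anc T k w \<noteq> Some c"
    proof
      fix c assume c: "c \<in> children T v"
      then have "c \<in> verts T" by (simp add: children_def arcs_def)
      then show "\<exists>k. \<forall>w\<in>verts T. anc T k w \<noteq> Some c" using none c unfolding deep_def by blast
    qed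
    then obtain K where "\<forall>c\<in>children T v. \<forall>w\<in>verts T. anc T (K c) w \<noteq> Some c"
      by (rule bchoice[THEN exE])
    then have K: "\<And>c w. c \<in> children T v \<Longrightarrow> w \<in> verts T \<Longrightarrow> anc T (K c) w \<noteq> Some c"
      by blast
    have fin: "finite (children T v)" using T v by (auto simp: family_tree_def deep_def)
    define N where "N = Max (K ` children T v)"
    have KN: "K c \<le> N" if "c \<in> children T v" for c
      using fin that by (simp add: N_def)
    obtain w where w: "w \<in> verts T" "anc T (Suc N) w = Some v" using v by (auto simp: deep_def)
    then obtain c where c: "c \<in> children T v" "anc T N w = Some c" using anc_child by blast
    \<comment> \<open>A descendant of c at depth N passes, on its way up, through one at the smaller
      depth \<open>K c\<close>.\<close>
    have le: "N - K c \<le> N" by simp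
    obtain w' where w': "anc T (N - K c) w = Some w'" "anc T (N - (N - K c)) w' = Some c"
      using anc_le[OF c(2) le] by blast
    then have "anc T (K c) w' = Some c" using KN[OF c(1)] by simp
    then show False using K[OF c(1)] anc_verts[OF T w(1) w'(1)] by blast
  qed
  have "deep u" using u down by (simp add: deep_def)
  then have "\<exists>f. \<forall>n. (deep (f n) \<and> (n = 0 \<longrightarrow> f n = u)) \<and> f (Suc n) \<in> children T (f n)"
    using deep_child by (intro dependent_nat_choice) auto
  then obtain f where f: "\<And>n. deep (f n)" "\<And>n. f (Suc n) \<in> children T (f n)" "f 0 = u"
    by blast
  define p where "p i = (if i \<ge> 0 then the (anc T (nat i) u) else f (nat (- i)))" for i :: int
  have "(p i, p (i + 1)) \<in> arcs T" for i
  proof (cases "i \<ge> 0")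
    case True
    obtain v where v: "anc T (Suc (nat i)) u = Some v" using up by blast
    then obtain w where w: "anc T (nat i) u = Some w" "parent T w = Some v"
      by (cases "anc T (nat i) u") (auto simp: anc_Suc)
    have "nat (i + 1) = Suc (nat i)" using True by simp
    then have "p i = w" "p (i + 1) = v" using True v w by (simp_all add: p_def)
    then show ?thesis using w parent_arcs[OF T anc_verts[OF T u w(1)]] by simp
  next
    case False
    have "p (i + 1) = f (nat (- (i + 1)))" using False f(3) by (cases "i = -1") (auto simp: p_def)
    moreover have "nat (- i) = Suc (nat (- (i + 1)))" using False by simp
    ultimately show ?thesis using False f(2) by (simp add: p_def children_def)
  qed
  moreover have "u = p 0" by (simp add: p_def)
  ultimately show ?thesis unfolding bi_infinite_path_def by blast
qed

lemma bi_infinite_path_anc: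
  assumes T: "family_tree T" and p: "bi_infinite_path T p"
  shows "anc T k (p i) = Some (p (i + int k))"
proof (induction k)
  case (Suc k)
  have "(p (i + int k), p (i + int k + 1)) \<in> arcs T" using p by (simp add: bi_infinite_path_def)
  then have "parent T (p (i + int k)) = Some (p (i + int k + 1))" by (simp add: arcs_def)
  then show ?case using Suc by (simp add: anc_Suc algebra_simps)
qed simp

text \<open>Koenig's lemma replaces the quantifier over paths, which range over an uncountable set,
  by quantifiers over levels and vertices. These can be expressed with names and lead to measurable
  events.\<close>

lemma bi_infinite_path_iff:
  assumes T: "family_tree T" and u: "u \<in> verts T"
  shows "(\<exists>p. bi_infinite_path T p \<and> u \<in> range p) \<longleftrightarrow>
    (\<forall>k. anc T k u \<noteq> None) \<and> (\<forall>k. \<exists>v\<in>verts T. anc T k v = Some u)"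
proof
  assume "\<exists>p. bi_infinite_path T p \<and> u \<in> range p"
  then obtain p i where p: "bi_infinite_path T p" "u = p i" by blast
  have "\<exists>v\<in>verts T. anc T k v = Some u" for k
  proof
    show "anc T k (p (i - int k)) = Some u"
      using bi_infinite_path_anc[OF T p(1), of k "i - int k"] p(2) by simp
    show "p (i - int k) \<in> verts T"
      using p(1) arcs_verts[of "p (i - int k)"] by (auto simp: bi_infinite_path_def)
  qed
  then show "(\<forall>k. anc T k u \<noteq> None) \<and> (\<forall>k. \<exists>v\<in>verts T. anc T k v = Some u)"
    using bi_infinite_path_anc[OF T p(1)] p(2) by simp
qed (use bi_infinite_pathI[OF T u] in blast)

section \<open>Vertex predicates translated to names\<close>

type_synonym diag = "nat list \<Rightarrow> nat list \<Rightarrow> bool \<times> bool \<times> bool \<times> int \<times> nat"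

definition d_vert :: "diag \<Rightarrow> nat list \<Rightarrow> bool" where
  "d_vert d a = fst (d a a)"

definition d_eq :: "diag \<Rightarrow> nat list \<Rightarrow> nat list \<Rightarrow> bool" where
  "d_eq d a b = fst (snd (d a b))"

definition d_sib :: "diag \<Rightarrow> nat list \<Rightarrow> nat list \<Rightarrow> bool" where
  "d_sib d a b = fst (snd (snd (d a b)))"

definition d_mark :: "diag \<Rightarrow> nat list \<Rightarrow> int" where
  "d_mark d a = fst (snd (snd (snd (d a a))))"

definition d_num :: "diag \<Rightarrow> nat list \<Rightarrow> nat" where
  "d_num d a = snd (snd (snd (snd (d a a))))"

definition d_up :: "nat \<Rightarrow> nat list \<Rightarrow> nat list" where
  "d_up k a = replicate k 0 @ a"

definition d_rls :: "diag \<Rightarrow> nat list \<Rightarrow> nat list \<Rightarrow> bool" where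
  "d_rls d a b \<longleftrightarrow> (\<exists>k. d_eq d (d_up (Suc k) a) b) \<or>
     (\<exists>m n. d_eq d (d_up (Suc m) a) (d_up (Suc n) b) \<and> d_sib d (d_up m a) (d_up n b))"

text \<open>\<open>P\<close> stands for the RLS order on names or for its converse, so that
  successors and predecessors share one construction.\<close>

definition d_next :: "diag \<Rightarrow> (nat list \<Rightarrow> nat list \<Rightarrow> bool) \<Rightarrow> nat list \<Rightarrow> nat list \<Rightarrow> bool" where
  "d_next d P a b \<longleftrightarrow> d_vert d b \<and> P a b \<and> (\<forall>e. d_vert d e \<and> P a e \<longrightarrow> d_eq d e b \<or> P b e)"

definition d_step :: "diag \<Rightarrow> (nat list \<Rightarrow> nat list \<Rightarrow> bool) \<Rightarrow> nat list \<Rightarrow> nat list \<Rightarrow> bool" where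
  "d_step d P a b \<longleftrightarrow> d_next d P a b \<or> ((\<forall>e. d_vert d e \<longrightarrow> \<not> d_next d P a e) \<and> d_eq d a b)"

text \<open>A relation and not a function, because a vertex has many names: it is meant to hold for
  every name of the n-th iterate of the root.\<close>

fun d_iter :: "diag \<Rightarrow> (nat list \<Rightarrow> nat list \<Rightarrow> bool) \<Rightarrow> nat \<Rightarrow> nat list \<Rightarrow> bool" where
  "d_iter d P 0 a = d_eq d [] a"
| "d_iter d P (Suc n) a = (\<exists>b. d_iter d P n b \<and> d_step d P b a)"

definition d_line :: "diag \<Rightarrow> int \<Rightarrow> nat list \<Rightarrow> bool" where
  "d_line d n a = (if n \<ge> 0 then d_iter d (d_rls d) (nat n) a
     else d_iter d (\<lambda>a b. d_rls d b a) (nat (- n)) a)"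

definition d_path :: "diag \<Rightarrow> nat list \<Rightarrow> bool" where
  "d_path d a \<longleftrightarrow> (\<forall>k. d_vert d (d_up k a)) \<and> (\<forall>k. \<exists>b. d_eq d (d_up k b) a)"

definition d_backward :: "diag \<Rightarrow> int \<Rightarrow> int \<Rightarrow> bool" where
  "d_backward d n z \<longleftrightarrow> (\<exists>a. d_line d (n + 1) a \<and>
     z = (if d_path d a then int (d_num d a) + d_mark d a - 1 else int (d_num d a) - 1))"

context
  fixes T :: "'v rom_tree" and d :: diag
  assumes T: "family_tree T"
  defines "d \<equiv> diagram T"
begin

lemma d_vert: "d_vert d a \<longleftrightarrow> vertex_at T a \<noteq> None"
  by (auto simp: d_vert_def d_def diagram_def split: option.split)

lemma d_eq: "d_eq d a b \<longleftrightarrow> vertex_at T a \<noteq> None \<and> vertex_at T a = vertex_at T b"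
  by (auto simp: d_eq_def d_def diagram_def split: option.split)

lemma d_sib: "d_sib d a b \<longleftrightarrow>
    (\<exists>u v. vertex_at T a = Some u \<and> vertex_at T b = Some v \<and> (u, v) \<in> sib_less T)"
  by (auto simp: d_sib_def d_def diagram_def split: option.split)

lemma d_mark: "vertex_at T a = Some u \<Longrightarrow> d_mark d a = mark T u"
  by (simp add: d_mark_def d_def diagram_def)

lemma d_num: "vertex_at T a = Some u \<Longrightarrow> d_num d a = num_children T u"
  by (simp add: d_num_def d_def diagram_def)

lemma d_up: "vertex_at T a = Some u \<Longrightarrow> vertex_at T (d_up k a) = anc T k u"
  by (simp add: d_up_def vertex_at_append_0)

lemma ball_verts: "(\<forall>v\<in>verts T. Q v) \<longleftrightarrow> (\<forall>a v. vertex_at T a = Some v \<longrightarrow> Q v)"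
  using vertex_at_surj[OF T] vertex_at_verts[OF T] by metis

lemma d_rls:
  assumes a: "vertex_at T a = Some u" and b: "vertex_at T b = Some v"
  shows "d_rls d a b \<longleftrightarrow> rls T u v"
  unfolding d_rls_def d_eq d_sib d_up[OF a] d_up[OF b] b
    rls_iff[OF T vertex_at_verts[OF T a] vertex_at_verts[OF T b]] rls_siblings_def
  by (intro arg_cong2[where f = "(\<or>)"] ex_cong1) auto

lemma d_next:
  assumes P: "\<And>a b u v. vertex_at T a = Some u \<Longrightarrow> vertex_at T b = Some v \<Longrightarrow> P a b \<longleftrightarrow> Q u v"
    and a: "vertex_at T a = Some u" and b: "vertex_at T b = Some v"
  shows "d_next d P a b \<longleftrightarrow> Q u v \<and> (\<forall>w\<in>verts T. Q u w \<longrightarrow> w = v \<or> Q v w)"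
proof -
  have "(d_vert d e \<and> P a e \<longrightarrow> d_eq d e b \<or> P b e) \<longleftrightarrow>
    (\<forall>w. vertex_at T e = Some w \<longrightarrow> Q u w \<longrightarrow> w = v \<or> Q v w)" for e
    unfolding d_vert d_eq using P[OF a, of e] P[OF b, of e] b by (cases "vertex_at T e") auto
  then show ?thesis
    unfolding d_next_def ball_verts using P[OF a b] b by (simp add: d_vert)
qed

lemma d_step:
  assumes P: "\<And>a b u v. vertex_at T a = Some u \<Longrightarrow> vertex_at T b = Some v \<Longrightarrow> P a b \<longleftrightarrow> Q u v"
    and N: "\<And>u v. N u v \<longleftrightarrow> v \<in> verts T \<and> Q u v \<and> (\<forall>w\<in>verts T. Q u w \<longrightarrow> w = v \<or> Q v w)"
    and S: "\<And>u v. S u = v \<longleftrightarrow> N u v \<or> ((\<forall>w\<in>verts T. \<not> N u w) \<and> u = v)"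
    and a: "vertex_at T a = Some u"
  shows "d_step d P a b \<longleftrightarrow> vertex_at T b = Some (S u)"
proof -
  have nextb: "d_next d P a b \<longleftrightarrow> N u v" if "vertex_at T b = Some v" for b v
    unfolding N using d_next[where P = P and Q = Q, OF P a that] vertex_at_verts[OF T that] by blast
  have none: "(\<forall>e. d_vert d e \<longrightarrow> \<not> d_next d P a e) \<longleftrightarrow> (\<forall>w\<in>verts T. \<not> N u w)"
    unfolding ball_verts d_vert using nextb by auto
  show ?thesis
  proof (cases "vertex_at T b")
    case None
    then show ?thesis using a by (simp add: d_step_def d_next_def d_vert d_eq)
  next
    case (Some v)
    then show ?thesis unfolding d_step_def none nextb[OF Some] d_eq
      using a S[of u v] by auto
  qed
qed

text \<open>Membership in \<open>verts T\<close> is carried through the induction because it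
  provides a name for the n-th iterate.\<close>

lemma d_iter:
  assumes P: "\<And>a b u v. vertex_at T a = Some u \<Longrightarrow> vertex_at T b = Some v \<Longrightarrow> P a b \<longleftrightarrow> Q u v"
    and N: "\<And>u v. N u v \<longleftrightarrow> v \<in> verts T \<and> Q u v \<and> (\<forall>w\<in>verts T. Q u w \<longrightarrow> w = v \<or> Q v w)"
    and S: "\<And>u v. S u = v \<longleftrightarrow> N u v \<or> ((\<forall>w\<in>verts T. \<not> N u w) \<and> u = v)"
  shows "(S ^^ n) (root T) \<in> verts T \<and> (d_iter d P n a \<longleftrightarrow> vertex_at T a = Some ((S ^^ n) (root T)))"
proof (induction n arbitrary: a)
  case 0
  then show ?case using T by (auto simp: d_eq family_tree_def)
next
  case (Suc n)
  have "(S ^^ Suc n) (root T) \<in> verts T"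
    using Suc S[of "(S ^^ n) (root T)" "(S ^^ Suc n) (root T)"] N by auto
  moreover obtain b where b: "vertex_at T b = Some ((S ^^ n) (root T))"
    using Suc vertex_at_surj[OF T] by blast
  moreover have "d_step d P b' a \<longleftrightarrow> vertex_at T a = Some ((S ^^ Suc n) (root T))"
    if "vertex_at T b' = Some ((S ^^ n) (root T))" for b'
    using d_step[OF P N S that] by simp
  ultimately show ?case using Suc by auto
qed

lemma d_line: "d_line d n a \<longleftrightarrow> vertex_at T a = Some (succession_line T n)"
  using d_iter[of "d_rls d" "rls T" "is_rls_succ T" "step_forth T" "nat n" a]
    d_iter[of "\<lambda>a b. d_rls d b a" "\<lambda>u v. rls T v u" "is_rls_pred T" "step_back T" "nat (- n)" a]
  by (auto simp: d_line_def succession_line_def d_rls is_rls_succ_def is_rls_pred_def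
      step_forth_eq[OF T] step_back_eq[OF T])

lemma succession_line_verts: "succession_line T n \<in> verts T"
proof -
  have "(step_forth T ^^ k) (root T) \<in> verts T" "(step_back T ^^ k) (root T) \<in> verts T" for k
    using T by (induction k) (auto simp: family_tree_def step_forth_verts step_back_verts)
  then show ?thesis by (simp add: succession_line_def)
qed

lemma d_path:
  assumes a: "vertex_at T a = Some u"
  shows "d_path d a \<longleftrightarrow> (\<exists>p. bi_infinite_path T p \<and> u \<in> range p)"
proof -
  have "(\<exists>b. d_eq d (d_up k b) a) \<longleftrightarrow> (\<exists>v\<in>verts T. anc T k v = Some u)" for k
  proof
    assume "\<exists>b. d_eq d (d_up k b) a"
    then obtain b where b: "vertex_at T (d_up k b) = Some u" using a by (auto simp: d_eq)
    then obtain v where "vertex_at T b = Some v" "anc T k v = Some u"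
      unfolding d_up_def vertex_at_append_0 by (cases "vertex_at T b") auto
    then show "\<exists>v\<in>verts T. anc T k v = Some u" using vertex_at_verts[OF T] by blast
  next
    assume "\<exists>v\<in>verts T. anc T k v = Some u"
    then obtain v where v: "v \<in> verts T" "anc T k v = Some u" by blast
    then obtain b where "vertex_at T b = Some v" using vertex_at_surj[OF T] by blast
    then show "\<exists>b. d_eq d (d_up k b) a" using v a d_up[of b v k] by (auto simp: d_eq intro!: exI[of _ b])
  qed
  then show ?thesis
    unfolding d_path_def d_vert d_up[OF a] bi_infinite_path_iff[OF T vertex_at_verts[OF T a]]
    by simp
qed

lemma d_backward: "d_backward d n z \<longleftrightarrow> backward_tree T n = z"
proof -
  obtain a where a: "vertex_at T a = Some (succession_line T (n + 1))"
    using vertex_at_surj[OF T succession_line_verts] by blast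
  have "(if d_path d b then int (d_num d b) + d_mark d b - 1 else int (d_num d b) - 1)
      = backward_tree T n" if "vertex_at T b = Some (succession_line T (n + 1))" for b
    unfolding backward_tree_def Let_def d_path[OF that] d_num[OF that] d_mark[OF that] ..
  then have "d_backward d n z \<longleftrightarrow>
      (\<exists>b. vertex_at T b = Some (succession_line T (n + 1)) \<and> z = backward_tree T n)"
    unfolding d_backward_def d_line by (intro ex_cong1 conj_cong refl) simp
  then show ?thesis using a by auto
qed

end

text \<open>Isomorphic trees have equal diagrams, and \<open>d_backward\<close> sees nothing else;
  no isomorphism has to be carried through ancestors, successors and paths.\<close>

lemma tree_iso_backward_tree:
  assumes "family_tree T" "family_tree T'" "tree_iso T T'"
  shows "backward_tree T' = backward_tree T"
proof
  fix n
  show "backward_tree T' n = backward_tree T n"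
    using d_backward[OF assms(1), of n "backward_tree T n"]
      d_backward[OF assms(2), of n "backward_tree T n"] tree_iso_diagram[OF assms] by simp
qed

section \<open>The tree of a sequence of bushes\<close>

lemma sorted_wrt_concat_map:
  assumes "sorted_wrt (\<lambda>x y. \<forall>u\<in>set (g x). \<forall>v\<in>set (g y). R u v) xs"
    "\<And>x. x \<in> set xs \<Longrightarrow> sorted_wrt R (g x)"
  shows "sorted_wrt R (concat (map g xs))"
  using assms by (induction xs) (auto simp: sorted_wrt_append)

text \<open>The list is convex for the RLS order: each outside vertex comes before all or after all
  of it. Nothing can therefore fit between two consecutive entries, and the infinite succession line
  can be computed on finite windows.\<close>

lemma step_sorted_window:
  assumes T: "family_tree T" and L: "sorted_wrt (rls T) L" "set L \<subseteq> verts T"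
    and out: "\<And>v. v \<in> verts T \<Longrightarrow> v \<notin> set L \<Longrightarrow> (\<forall>u\<in>set L. rls T v u) \<or> (\<forall>u\<in>set L. rls T u v)"
    and p: "Suc p < length L"
  shows "step_forth T (L ! p) = L ! Suc p" "step_back T (L ! Suc p) = L ! p"
proof -
  have V: "L ! k \<in> verts T" if "k < length L" for k using that L(2) by auto
  have lt: "rls T (L ! k) (L ! l)" if "k < l" "l < length L" for k l
    using L(1) that by (simp add: sorted_wrt_nth_less)
  have lt_iff: "rls T (L ! k) (L ! l) \<longleftrightarrow> k < l" if "k < length L" "l < length L" for k l
    using lt[of k l] lt[of l k] rls_asym[OF T V V, of k l] rls_asym[OF T V V, of k k] that
    by (metis linorder_neqE_nat)
  have p': "p < length L" using p by simp
  have "is_rls_succ T (L ! p) (L ! Suc p)"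
    unfolding is_rls_succ_def
  proof (intro conjI ballI impI)
    fix w assume w: "w \<in> verts T" "rls T (L ! p) w"
    show "w = L ! Suc p \<or> rls T (L ! Suc p) w"
    proof (cases "w \<in> set L")
      case True
      then obtain k where k: "k < length L" "w = L ! k" by (auto simp: in_set_conv_nth)
      then have "p < k" using w lt_iff[OF p'] by simp
      then show ?thesis using k p lt_iff by (cases "k = Suc p") auto
    next
      case False
      then show ?thesis using out[OF w(1)] w rls_asym[OF T _ _ w(2)] p p' V by auto
    qed
  qed (use V p lt in auto)
  then show "step_forth T (L ! p) = L ! Suc p" by (simp add: step_forth_eq[OF T])
  have "is_rls_pred T (L ! Suc p) (L ! p)"
    unfolding is_rls_pred_def
  proof (intro conjI ballI impI)
    fix w assume w: "w \<in> verts T" "rls T w (L ! Suc p)"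
    show "w = L ! p \<or> rls T w (L ! p)"
    proof (cases "w \<in> set L")
      case True
      then obtain k where k: "k < length L" "w = L ! k" by (auto simp: in_set_conv_nth)
      then have "k < Suc p" using w lt_iff[OF _ p] by simp
      then show ?thesis using k p lt_iff by (cases "k = p") auto
    next
      case False
      then show ?thesis using out[OF w(1)] w rls_asym[OF T _ _ w(2)] p p' V by auto
    qed
  qed (use V p' p lt in auto)
  then show "step_back T (L ! Suc p) = L ! p" by (simp add: step_back_eq[OF T])
qed

lemma succession_line_sorted_window:
  assumes T: "family_tree T" and L: "sorted_wrt (rls T) L" "set L \<subseteq> verts T"
    and out: "\<And>v. v \<in> verts T \<Longrightarrow> v \<notin> set L \<Longrightarrow> (\<forall>u\<in>set L. rls T v u) \<or> (\<forall>u\<in>set L. rls T u v)"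
    and p: "p < length L" "L ! p = root T" and j: "0 \<le> int p + j" "int p + j < int (length L)"
  shows "succession_line T j = L ! nat (int p + j)"
proof -
  note step = step_sorted_window[OF T L out]
  have 1: "(step_forth T ^^ k) (root T) = L ! (p + k)" if "p + k < length L" for k
    using that p(2) step(1) by (induction k) auto
  have 2: "(step_back T ^^ k) (root T) = L ! (p - k)" if "k \<le> p" for k
    using that
  proof (induction k)
    case (Suc k)
    then have "p - k = Suc (p - Suc k)" by simp
    then show ?case using Suc step(2)[of "p - Suc k"] p(1) by simp
  qed (simp add: p(2))
  show ?thesis
  proof (cases "j \<ge> 0")
    case True
    then have "nat (int p + j) = p + nat j" by simp
    then show ?thesis using 1[of "nat j"] True j by (simp add: succession_line_def)
  next
    case False
    then have "nat (int p + j) = p - nat (- j)" using j by simp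
    then show ?thesis using 2[of "nat (- j)"] False j by (simp add: succession_line_def)
  qed
qed

section \<open>Addresses, post-order and degree words\<close>

fun degree_at :: "ord_tree \<Rightarrow> nat list \<Rightarrow> nat" where
  "degree_at (Node ts) [] = length ts"
| "degree_at (Node ts) (k # w) = degree_at (ts ! k) w"

text \<open>The recursive calls sit inside \<open>map postorder ts\<close>, which makes termination
  visible; \<open>postorder_Node\<close> restores the indexed form.\<close>

fun postorder :: "ord_tree \<Rightarrow> nat list list" where
  "postorder (Node ts) =
     concat (map (\<lambda>(k, p). map ((#) k) p) (zip [0..<length ts] (map postorder ts))) @ [[]]"

text \<open>The Lukasiewicz word of the tree, read in post-order: its sum is -1 and all its nonempty
  prefixes have negative sums.\<close>

fun degree_word :: "ord_tree \<Rightarrow> int list" where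
  "degree_word (Node ts) = concat (map degree_word ts) @ [int (length ts) - 1]"

text \<open>The last letter is what \<open>backward_tree\<close> reads at a vertex of the
  bi-infinite path: with k children in the bush there are k + 1 in the joined tree, the extra one
  being the root of the previous bush, and adding the mark n and subtracting 1 leaves n + k.\<close>

fun bush_word :: "nat \<times> ord_tree \<Rightarrow> int list" where
  "bush_word (n, Node ts) = concat (map degree_word ts) @ [int (n + length ts)]"

lemma postorder_Node:
  "postorder (Node ts) = concat (map (\<lambda>k. map ((#) k) (postorder (ts ! k))) [0..<length ts]) @ [[]]"
proof -
  have "map (\<lambda>(k, p). map ((#) k) p) (zip [0..<length ts] (map postorder ts)) =
      map (\<lambda>k. map ((#) k) (postorder (ts ! k))) [0..<length ts]"
    by (rule nth_equalityI) auto
  then show ?thesis by simp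
qed

declare postorder.simps [simp del]

text \<open>Degree words and bush words differ only at the root, which comes last in post-order;
  \<open>butlast\<close> isolates the common part.\<close>

lemma degree_word_concat:
  assumes "\<And>t. t \<in> set ts \<Longrightarrow> degree_word t = map (\<lambda>w. int (degree_at t w) - 1) (postorder t)"
  shows "concat (map degree_word ts) =
    map (\<lambda>w. int (degree_at (Node ts) w) - 1) (butlast (postorder (Node ts)))"
proof -
  have "map degree_word ts =
    map (\<lambda>k. map (\<lambda>w. int (degree_at (Node ts) w) - 1) (map ((#) k) (postorder (ts ! k)))) [0..<length ts]"
    by (rule nth_equalityI) (auto simp: assms)
  then show ?thesis by (simp add: postorder_Node map_concat o_def)
qed

lemma degree_word_postorder: "degree_word t = map (\<lambda>w. int (degree_at t w) - 1) (postorder t)"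
proof (induction t)
  case (Node ts)
  then show ?case using degree_word_concat[of ts] by (simp add: postorder_Node)
qed

lemma bush_word_postorder:
  "bush_word (n, t) = map (\<lambda>w. if w = [] then int n + int (degree_at t w) else int (degree_at t w) - 1) (postorder t)"
proof (cases t)
  case (Node ts)
  have "w \<noteq> []" if "w \<in> set (butlast (postorder (Node ts)))" for w
    using that by (auto simp: postorder_Node)
  then have "bush_word (n, t) = map (\<lambda>w. if w = [] then int n + int (degree_at t w)
      else int (degree_at t w) - 1) (butlast (postorder (Node ts)) @ [[]])"
    using degree_word_concat[of ts] degree_word_postorder Node by simp
  then show ?thesis using Node by (simp add: postorder_Node)
qed

lemma set_postorder: "set (postorder t) = Collect (is_address t)"
proof (induction t)
  case (Node ts)
  have "w \<in> set (postorder (Node ts)) \<longleftrightarrow> is_address (Node ts) w" for w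
    using Node by (cases w) (auto simp: postorder_Node)
  then show ?case by blast
qed

lemma finite_addresses: "finite (Collect (is_address t))"
  by (metis set_postorder List.finite_set)

lemma is_address_snoc: "is_address t (w @ [k]) \<longleftrightarrow> is_address t w \<and> k < degree_at t w"
proof (induction w arbitrary: t)
  case Nil
  then show ?case by (cases t) auto
next
  case (Cons l w)
  then show ?case by (cases t) auto
qed

lemma is_address_single: "is_address t [k] \<longleftrightarrow> k < degree_at t []"
  using is_address_snoc[of t "[]" k] by simp

lemma is_address_append: "is_address t (w @ x) \<Longrightarrow> is_address t w"
  by (induction x rule: rev_induct) (auto simp flip: append_assoc simp: is_address_snoc)

text \<open>The two clauses mirror those of \<open>rls\<close> inside one bush: w is a proper
  descendant of x, or the two addresses part below their closest common ancestor p.\<close>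

definition postorder_less :: "nat list \<Rightarrow> nat list \<Rightarrow> bool" where
  "postorder_less w x \<longleftrightarrow> (\<exists>s. s \<noteq> [] \<and> w = x @ s) \<or>
     (\<exists>p k l s s'. k < l \<and> w = p @ k # s \<and> x = p @ l # s')"

lemma postorder_less_Cons: "postorder_less w x \<Longrightarrow> postorder_less (k # w) (k # x)"
  unfolding postorder_less_def by (metis append_Cons)

lemma sorted_postorder: "sorted_wrt postorder_less (postorder t)"
proof (induction t)
  case (Node ts)
  have "postorder_less (k # w) (l # x)" if "k < l" for k l w x
    unfolding postorder_less_def using that by (intro disjI2 exI[of _ "[]"]) auto
  then have "sorted_wrt (\<lambda>k l. \<forall>w\<in>set (map ((#) k) (postorder (ts ! k))).
      \<forall>x\<in>set (map ((#) l) (postorder (ts ! l))). postorder_less w x) [0..<length ts]"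
    by (intro sorted_wrt_mono_rel[OF _ strict_sorted_iff[THEN iffD2]]) auto
  moreover have "sorted_wrt postorder_less (map ((#) k) (postorder (ts ! k)))" if "k < length ts" for k
    unfolding sorted_wrt_map
    by (rule sorted_wrt_mono_rel[OF _ Node]) (use that in \<open>auto intro: postorder_less_Cons\<close>)
  ultimately have "sorted_wrt postorder_less
      (concat (map (\<lambda>k. map ((#) k) (postorder (ts ! k))) [0..<length ts]))"
    by (intro sorted_wrt_concat_map) auto
  moreover have "postorder_less (k # w) []" for k w
    by (simp add: postorder_less_def)
  ultimately show ?case by (auto simp: postorder_Node sorted_wrt_append)
qed

section \<open>The joined tree: Family Tree axioms and RLS order\<close>

context
  fixes b :: "int \<Rightarrow> nat \<times> ord_tree" and T :: "(int \<times> nat list) rom_tree"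
  defines "T \<equiv> join_bushes b"
begin

lemma join_verts: "(i, w) \<in> verts T \<longleftrightarrow> is_address (snd (b i)) w"
  by (simp add: T_def join_bushes_def Let_def)

lemma join_root: "root T = (0, [])" and join_mark: "mark T (i, w) = (if w = [] then int (fst (b i)) else - 1)"
  by (simp_all add: T_def join_bushes_def Let_def)

lemma join_parent: "parent T (i, w) = Some (if w = [] then (i + 1, []) else (i, butlast w))"
  by (simp add: T_def join_bushes_def Let_def)

lemma join_arcs: "((i, w), (j, x)) \<in> arcs T \<longleftrightarrow> (i, w) \<in> verts T \<and> (j, x) \<in> verts T \<and>
    (if w = [] then j = i + 1 \<and> x = [] else j = i \<and> x = butlast w)"
  by (auto simp: arcs_def join_parent)

lemma join_sib_less: "(u, v) \<in> sib_less T \<longleftrightarrow> u \<in> verts T \<and> v \<in> verts T \<and>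
    ((\<exists>i w k l. u = (i, w @ [k]) \<and> v = (i, w @ [l]) \<and> k < l) \<or> (\<exists>i k. u = (i, []) \<and> v = (i + 1, [k])))"
  by (auto simp: T_def join_bushes_def Let_def)

lemma join_children:
  assumes "(i, w) \<in> verts T"
  shows "children T (i, w) = (\<lambda>k. (i, w @ [k])) ` {..<degree_at (snd (b i)) w}
    \<union> (if w = [] then {(i - 1, [])} else {})" (is "_ = ?R")
proof (intro equalityI subsetI)
  fix u assume u: "u \<in> children T (i, w)"
  obtain j x where jx: "u = (j, x)" by (cases u)
  show "u \<in> ?R"
  proof (cases x rule: rev_exhaust)
    case Nil
    then show ?thesis using u jx by (auto simp: children_def join_arcs)
  next
    case (snoc y k)
    then show ?thesis using u jx by (auto simp: children_def join_arcs join_verts is_address_snoc)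
  qed
qed (use assms in \<open>auto simp: children_def join_arcs join_verts is_address_snoc is_address_single split: if_splits\<close>)

lemma join_num_children:
  assumes "(i, w) \<in> verts T"
  shows "num_children T (i, w) = degree_at (snd (b i)) w + (if w = [] then 1 else 0)"
proof -
  have "card ((\<lambda>k. (i, w @ [k])) ` {..<degree_at (snd (b i)) w}) = degree_at (snd (b i)) w"
    by (subst card_image) (auto simp: inj_on_def)
  moreover have "(i - 1, []) \<notin> (\<lambda>k. (i, w @ [k])) ` {..<degree_at (snd (b i)) w}" by auto
  ultimately show ?thesis
    unfolding num_children_def join_children[OF assms] by (auto simp: card_insert_disjoint)
qed

lemma join_acyclic: "acyclic (arcs T)"
proof -
  \<comment> \<open>Along an arc either the bush index grows or the address gets shorter, so no path
    returns to its start.\<close>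
  have "fst u < fst v \<or> (fst u = fst v \<and> length (snd v) < length (snd u))" if "(u, v) \<in> (arcs T)\<^sup>+" for u v
    using that
  proof (induction rule: trancl_induct)
    case (base v)
    then show ?case by (cases u; cases v) (auto simp: join_arcs split: if_splits)
  next
    case (step v x)
    then show ?case by (cases v; cases x) (auto simp: join_arcs split: if_splits)
  qed
  then show ?thesis unfolding acyclic_def by fastforce
qed

lemma join_connected:
  assumes "u \<in> verts T" "v \<in> verts T"
  shows "(u, v) \<in> (arcs T \<union> (arcs T)\<inverse>)\<^sup>*"
proof -
  let ?R = "(arcs T \<union> (arcs T)\<inverse>)\<^sup>*"
  have sym: "(x, y) \<in> ?R \<Longrightarrow> (y, x) \<in> ?R" for x y
    by (metis sym_Un_converse sym_rtrancl symD)
  have up: "((i, w), (i, [])) \<in> ?R" if "(i, w) \<in> verts T" for i w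
    using that
  proof (induction w rule: rev_induct)
    case (snoc k w)
    then have "(i, w) \<in> verts T" by (simp add: join_verts is_address_snoc)
    moreover have "((i, w @ [k]), (i, w)) \<in> arcs T" using snoc(2) calculation by (simp add: join_arcs)
    ultimately show ?case using snoc(1) by (meson UnI1 converse_rtrancl_into_rtrancl)
  qed simp
  have spine: "((i, []), (i + int n, [])) \<in> ?R" for i n
  proof (induction n)
    case (Suc n)
    have "((i + int n, []), (i + int (Suc n), [])) \<in> arcs T" by (simp add: join_arcs join_verts)
    with Suc show ?case by (meson UnI1 rtrancl_into_rtrancl)
  qed simp
  have root: "((i, []), (j, [])) \<in> ?R" for i j
  proof (cases "i \<le> j")
    case True
    then show ?thesis using spine[of i "nat (j - i)"] by simp
  next
    case False
    then show ?thesis using sym[OF spine[of j "nat (i - j)"]] by simp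
  qed
  obtain i w j x where ux: "u = (i, w)" "v = (j, x)" by (cases u; cases v)
  with up[of i w] root[of i j] sym[OF up[of j x]] assms show ?thesis
    by (meson rtrancl_trans)
qed

lemma join_sib_less_linear:
  assumes "u \<in> verts T"
  shows "strict_linear_order_on (children T u) (sib_less T \<inter> children T u \<times> children T u)"
proof -
  obtain i w where u: "u = (i, w)" by (cases u)
  show ?thesis unfolding strict_linear_order_on_def
  proof (intro conjI)
    show "trans (sib_less T \<inter> children T u \<times> children T u)"
      unfolding trans_def using assms
      by (auto simp: join_sib_less u join_children split: if_splits)
    show "irrefl (sib_less T \<inter> children T u \<times> children T u)"
      by (auto simp: irrefl_def join_sib_less)
    show "total_on (children T u) (sib_less T \<inter> children T u \<times> children T u)"
      unfolding total_on_def using assms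
      by (auto simp: join_sib_less u join_children join_verts is_address_snoc is_address_single
          split: if_splits)
  qed
qed

lemma family_tree_join: "family_tree T"
  unfolding family_tree_def
proof (intro conjI ballI allI impI)
  show "root T \<in> verts T" by (simp add: join_root join_verts)
  show "acyclic (arcs T)" by (rule join_acyclic)
  show "finite (children T v)" if "v \<in> verts T" for v
    using that by (cases v) (simp add: join_children)
  show "v \<in> verts T" if "u \<in> verts T" "parent T u = Some v" for u v
    using that by (cases u, cases "snd u" rule: rev_exhaust)
      (auto simp: join_parent join_verts is_address_snoc)
  show "sib_less T \<subseteq> (\<Union>v\<in>verts T. children T v \<times> children T v)"
  proof
    fix e assume e': "e \<in> sib_less T"
    obtain u v where e: "e = (u, v)" by (cases e)
    have uv: "u \<in> verts T" "v \<in> verts T"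
      using e' unfolding e join_sib_less by blast+
    consider i w k l where "u = (i, w @ [k])" "v = (i, w @ [l])"
      | i k where "u = (i, [])" "v = (i + 1, [k])"
      using e' unfolding e join_sib_less by blast
    then show "e \<in> (\<Union>v\<in>verts T. children T v \<times> children T v)"
    proof cases
      case 1
      with e uv show ?thesis
        by (intro UN_I[of "(i, w)"]) (auto simp: join_verts is_address_snoc children_def join_arcs)
    next
      case 2
      with e uv show ?thesis
        by (intro UN_I[of "(i + 1, [])"]) (auto simp: join_verts children_def join_arcs)
    qed
  qed
qed (use join_connected join_sib_less_linear in auto)

lemma join_anc_in_bush: "anc T (length s) (i, w @ s) = Some (i, w)"
proof (induction s arbitrary: w)
  case (Cons k s)
  have "anc T (length s) (i, (w @ [k]) @ s) = Some (i, w @ [k])" by (rule Cons)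
  then show ?case by (simp add: anc_Suc join_parent)
qed simp

lemma join_anc_spine: "anc T (length w + n) (i, w) = Some (i + int n, [])"
proof (induction n)
  case 0
  then show ?case using join_anc_in_bush[of w i "[]"] by simp
qed (simp add: anc_Suc join_parent)

lemma join_anc_cases:
  assumes "anc T k (i, w) = Some (j, x)" "x \<noteq> []"
  shows "i = j \<and> k \<le> length w"
proof (cases "k \<le> length w")
  case True
  then show ?thesis
    using join_anc_in_bush[of "drop (length w - k) w" i "take (length w - k) w"] assms by simp
next
  case False
  then show ?thesis using join_anc_spine[of w "k - length w" i] assms by simp
qed

definition join_less :: "int \<times> nat list \<Rightarrow> int \<times> nat list \<Rightarrow> bool" where
  "join_less u v \<longleftrightarrow> fst u < fst v \<or> (fst u = fst v \<and> postorder_less (snd u) (snd v))"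

text \<open>One implication is enough: it turns a list sorted by \<open>join_less\<close> into one
  sorted by \<open>rls\<close>, and the comparisons in the other direction follow from
  \<open>rls_asym\<close>.\<close>

lemma join_less_rls:
  assumes u: "(i, w) \<in> verts T" and v: "(j, x) \<in> verts T" and less: "join_less (i, w) (j, x)"
  shows "rls T (i, w) (j, x)"
proof -
  note rls_iff = rls_iff[OF family_tree_join u v]
  consider "i < j" "x = []" | k x' where "i < j" "x = k # x'" | s where "i = j" "s \<noteq> []" "w = x @ s"
    | p k l s s' where "i = j" "k < l" "w = p @ k # s" "x = p @ l # s'"
    using less by (cases x) (auto simp: join_less_def postorder_less_def)
  then show ?thesis
  proof cases
    case 1
    define n where "n = nat (j - i) - 1"
    have "anc T (Suc (length w + n)) (i, w) = Some (j, x)"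
      using join_anc_spine[of w "Suc n" i] 1 by (simp add: n_def)
    then show ?thesis unfolding rls_iff by blast
  next
    case 2
    define n where "n = nat (j - i) - 1"
    \<comment> \<open>Here w lies below the spine vertex (j - 1, []), which is the smallest child of
      (j, []), while x lies below the ordinary child number k.\<close>
    have "anc T (length w + n) (i, w) = Some (j - 1, [])" "anc T (Suc (length w + n)) (i, w) = Some (j, [])"
      using join_anc_spine[of w n i] join_anc_spine[of w "Suc n" i] 2 by (simp_all add: n_def)
    moreover have "anc T (length x') (j, x) = Some (j, [k])" "anc T (Suc (length x')) (j, x) = Some (j, [])"
      using join_anc_in_bush[of x' j "[k]"] join_anc_in_bush[of x j "[]"] 2 by simp_all
    moreover have "((j - 1, []), (j, [k])) \<in> sib_less T"
      using v is_address_append[of _ "[k]" x'] 2 by (auto simp: join_sib_less join_verts)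
    ultimately show ?thesis unfolding rls_iff rls_siblings_def by blast
  next
    case 3
    then obtain n where "length s = Suc n" by (cases s) auto
    then show ?thesis unfolding rls_iff using join_anc_in_bush[of s i x] 3 by auto
  next
    case 4
    have "anc T (length s) (i, w) = Some (i, p @ [k])" "anc T (Suc (length s)) (i, w) = Some (i, p)"
      using join_anc_in_bush[of s i "p @ [k]"] join_anc_in_bush[of "k # s" i p] 4 by simp_all
    moreover have "anc T (length s') (j, x) = Some (i, p @ [l])" "anc T (Suc (length s')) (j, x) = Some (i, p)"
      using join_anc_in_bush[of s' i "p @ [l]"] join_anc_in_bush[of "l # s'" i p] 4 by simp_all
    moreover have "((i, p @ [k]), (i, p @ [l])) \<in> sib_less T"
      using u v is_address_append[of _ "p @ [k]" s] is_address_append[of _ "p @ [l]" s'] 4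
      by (auto simp: join_sib_less join_verts)
    ultimately show ?thesis unfolding rls_iff rls_siblings_def by blast
  qed
qed

text \<open>The spine is a bi-infinite path. A vertex off the spine has descendants only in its own
  finite bush, hence none at large depth.\<close>

lemma join_bi_infinite_path:
  assumes "(i, w) \<in> verts T"
  shows "(\<exists>p. bi_infinite_path T p \<and> (i, w) \<in> range p) \<longleftrightarrow> w = []"
proof
  assume "\<exists>p. bi_infinite_path T p \<and> (i, w) \<in> range p"
  then have ex: "\<exists>v\<in>verts T. anc T k v = Some (i, w)" for k
    using bi_infinite_path_iff[OF family_tree_join assms] by blast
  show "w = []"
  proof (rule ccontr)
    assume ne: "w \<noteq> []"
    let ?A = "length ` Collect (is_address (snd (b i)))"
    have fin: "finite ?A" using finite_addresses by blast
    obtain j x where jx: "(j, x) \<in> verts T" "anc T (Suc (Max ?A)) (j, x) = Some (i, w)"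
      using ex by (metis surj_pair)
    with join_anc_cases[OF jx(2) ne] have "length x \<in> ?A" "Suc (Max ?A) \<le> length x"
      by (auto simp: join_verts)
    then show False using Max_ge[OF fin] by fastforce
  qed
next
  assume w: "w = []"
  have "bi_infinite_path T (\<lambda>j. (j, []))"
    by (simp add: bi_infinite_path_def join_arcs join_verts)
  then show "\<exists>p. bi_infinite_path T p \<and> (i, w) \<in> range p" using w by blast
qed

text \<open>The origin lies right after bush 0: position j reads the vertex number j + 1 of the
  succession line, and the root (0, []) comes last in bush 0. Thus j = -1 gives the final letter of
  bush 0, and j = 0 the first letter of bush 1.\<close>

lemma backward_tree_join:
  assumes n: "n > 0" and j: "0 \<le> int (length (concat (map (\<lambda>i. bush_word (b i)) [1 - int n..0]))) + j"
      "int (length (concat (map (\<lambda>i. bush_word (b i)) [1 - int n..0]))) + j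
        < int (length (concat (map (\<lambda>i. bush_word (b i)) [1 - int n..m])))"
    and m: "m \<ge> 0"
  shows "backward_tree T j = concat (map (\<lambda>i. bush_word (b i)) [1 - int n..m]) !
    nat (int (length (concat (map (\<lambda>i. bush_word (b i)) [1 - int n..0]))) + j)"
proof -
  define P where "P i = map (Pair i) (postorder (snd (b i)))" for i
  define V where "V = (\<lambda>u. if snd u = [] then int (fst (b (fst u))) + int (degree_at (snd (b (fst u))) (snd u))
    else int (degree_at (snd (b (fst u))) (snd u)) - 1)"
  define L where "L = concat (map P [1 - int n..m])"
  define A where "A = concat (map P [1 - int n..0])"
  have W: "bush_word (b i) = map V (P i)" for i
    using bush_word_postorder[of "fst (b i)" "snd (b i)"] by (simp add: P_def V_def o_def)
  have conc: "concat (map (\<lambda>i. bush_word (b i)) xs) = map V (concat (map P xs))" for xs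
    by (simp add: W map_concat o_def)
  have split: "[1 - int n..m] = [1 - int n..-1] @ 0 # [1..m]"
    using upto_split2[of "1 - int n" 0 m] upto_split3[of "1 - int n" 0 m] n m by simp
  have split0: "[1 - int n..0] = [1 - int n..-1] @ [0]"
    using upto_rec2[of "1 - int n" 0] n by simp
  have L: "L = A @ concat (map P [1..m])" by (simp add: L_def A_def split split0)
  obtain A' where A': "A = A' @ [(0, [])]"
    by (cases "snd (b 0)") (auto simp: A_def split0 P_def postorder_Node)
  have setL: "set L = {(i, w). (i, w) \<in> verts T \<and> 1 - int n \<le> i \<and> i \<le> m}"
    by (auto simp: L_def P_def set_postorder join_verts)
  have "sorted_wrt join_less L"
    unfolding L_def
  proof (rule sorted_wrt_concat_map)
    show "sorted_wrt (\<lambda>i j. \<forall>u\<in>set (P i). \<forall>v\<in>set (P j). join_less u v) [1 - int n..m]"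
      by (rule sorted_wrt_mono_rel[OF _ sorted_wrt_upto]) (auto simp: P_def join_less_def)
    show "sorted_wrt join_less (P i)" for i
      unfolding P_def sorted_wrt_map
      by (rule sorted_wrt_mono_rel[OF _ sorted_postorder]) (simp add: join_less_def)
  qed
  then have sorted: "sorted_wrt (rls T) L"
    by (rule sorted_wrt_mono_rel[rotated]) (auto simp: setL intro: join_less_rls)
  \<comment> \<open>The list exhausts the bushes from 1 - n to m, so any other vertex lies in an
    earlier or in a later bush.\<close>
  have out: "(\<forall>u\<in>set L. rls T v u) \<or> (\<forall>u\<in>set L. rls T u v)" if "v \<in> verts T" "v \<notin> set L" for v
  proof (cases "fst v < 1 - int n")
    case True
    then show ?thesis using that by (cases v) (auto simp: setL join_less_def intro!: join_less_rls)
  next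
    case False
    then show ?thesis using that by (cases v) (auto simp: setL join_less_def intro!: join_less_rls)
  qed
  have p: "length A' < length L" "L ! length A' = root T"
    by (simp_all add: L A' join_root)
  have lenA: "length (concat (map (\<lambda>i. bush_word (b i)) [1 - int n..0])) = Suc (length A')"
    unfolding conc A_def[symmetric] by (simp add: A')
  have lenL: "length (concat (map (\<lambda>i. bush_word (b i)) [1 - int n..m])) = length L"
    unfolding conc L_def[symmetric] by simp
  have "set L \<subseteq> verts T" using setL by auto
  have idx: "0 \<le> int (length A') + (j + 1)" "int (length A') + (j + 1) < int (length L)"
    using j unfolding lenA lenL by simp_all
  have line: "succession_line T (j + 1) = L ! nat (int (length A') + (j + 1))" (is "_ = L ! ?k")
    by (rule succession_line_sorted_window[OF family_tree_join sorted \<open>set L \<subseteq> verts T\<close> out p idx])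
  have k: "?k < length L" using idx by linarith
  then have "L ! ?k \<in> verts T" using \<open>set L \<subseteq> verts T\<close> by auto
  moreover obtain i w where iw: "L ! ?k = (i, w)" by (cases "L ! ?k")
  ultimately have v: "(i, w) \<in> verts T" by simp
  have "backward_tree T j = V (L ! ?k)"
    unfolding backward_tree_def line Let_def iw join_bi_infinite_path[OF v] join_num_children[OF v]
    by (simp add: join_mark V_def)
  also have "\<dots> = map V L ! ?k" using k by simp
  finally show ?thesis unfolding lenA unfolding conc L_def[symmetric] by (simp add: algebra_simps)
qed

end


section \<open>Isomorphism classes and copies on the natural numbers\<close>

lemma tree_iso_sym:
  assumes "root T \<in> verts T" "tree_iso T T'"
  shows "tree_iso T' T"
proof -
  obtain f where f: "bij_betw f (verts T) (verts T')"
    "f (root T) = root T'" "\<And>u. u \<in> verts T \<Longrightarrow> mark T' (f u) = mark T u"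
    and fe: "\<And>u v. u \<in> verts T \<Longrightarrow> v \<in> verts T \<Longrightarrow>
      ((f u, f v) \<in> arcs T' \<longleftrightarrow> (u, v) \<in> arcs T) \<and>
      ((f u, f v) \<in> sib_less T' \<longleftrightarrow> (u, v) \<in> sib_less T)"
    using assms(2) unfolding tree_iso_def by blast
  let ?g = "inv_into (verts T) f"
  have g: "bij_betw ?g (verts T') (verts T)" using f(1) by (rule bij_betw_inv_into)
  have gv: "?g w \<in> verts T" "f (?g w) = w" if "w \<in> verts T'" for w
    using that f(1) by (auto simp: bij_betw_def f_inv_into_f inv_into_into)
  have "?g (root T') = root T"
    using f(1,2) assms(1) by (metis bij_betw_inv_into_left)
  moreover have "mark T (?g w) = mark T' w" if "w \<in> verts T'" for w
    using f(3)[OF gv(1)[OF that]] gv(2)[OF that] by simp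
  moreover have "((?g w, ?g x) \<in> arcs T \<longleftrightarrow> (w, x) \<in> arcs T') \<and>
      ((?g w, ?g x) \<in> sib_less T \<longleftrightarrow> (w, x) \<in> sib_less T')" if "w \<in> verts T'" "x \<in> verts T'" for w x
    using fe[OF gv(1)[OF that(1)] gv(1)[OF that(2)]] gv(2)[OF that(1)] gv(2)[OF that(2)] by simp
  ultimately show ?thesis using g unfolding tree_iso_def by blast
qed

lemma tree_iso_trans:
  assumes "tree_iso T T'" "tree_iso T' T''"
  shows "tree_iso T T''"
proof -
  obtain f where f: "bij_betw f (verts T) (verts T')"
    "f (root T) = root T'" "\<And>u. u \<in> verts T \<Longrightarrow> mark T' (f u) = mark T u"
    and fe: "\<And>u v. u \<in> verts T \<Longrightarrow> v \<in> verts T \<Longrightarrow>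
      ((f u, f v) \<in> arcs T' \<longleftrightarrow> (u, v) \<in> arcs T) \<and>
      ((f u, f v) \<in> sib_less T' \<longleftrightarrow> (u, v) \<in> sib_less T)"
    using assms(1) unfolding tree_iso_def by blast
  obtain g where g: "bij_betw g (verts T') (verts T'')"
    "g (root T') = root T''" "\<And>u. u \<in> verts T' \<Longrightarrow> mark T'' (g u) = mark T' u"
    and ge: "\<And>u v. u \<in> verts T' \<Longrightarrow> v \<in> verts T' \<Longrightarrow>
      ((g u, g v) \<in> arcs T'' \<longleftrightarrow> (u, v) \<in> arcs T') \<and>
      ((g u, g v) \<in> sib_less T'' \<longleftrightarrow> (u, v) \<in> sib_less T')"
    using assms(2) unfolding tree_iso_def by blast
  have fv: "f u \<in> verts T'" if "u \<in> verts T" for u using that f(1) by (auto simp: bij_betw_def)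
  show ?thesis unfolding tree_iso_def
    by (rule exI[of _ "g \<circ> f"]) (use f g fe ge fv in \<open>auto intro: bij_betw_trans\<close>)
qed

text \<open>Applied with \<open>to_nat\<close>: the elements of \<open>tree_classes\<close> are
  classes of trees on natural numbers, whereas the vertices of \<open>join_bushes\<close> are
  pairs.\<close>

definition tree_image :: "('v \<Rightarrow> 'w) \<Rightarrow> 'v rom_tree \<Rightarrow> 'w rom_tree" where
  "tree_image f T = \<lparr>verts = f ` verts T, parent = (\<lambda>x. map_option f (parent T (inv f x))),
     sib_less = map_prod f f ` sib_less T, root = f (root T), mark = (\<lambda>x. mark T (inv f x))\<rparr>"

context
  fixes f :: "'v \<Rightarrow> 'w" and T :: "'v rom_tree"
  assumes inj: "inj f" and T: "family_tree T"
begin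

lemma tree_image_arcs: "arcs (tree_image f T) = map_prod f f ` arcs T"
  using inj by (auto simp: tree_image_def arcs_def inj_eq image_iff)

lemma tree_iso_image: "tree_iso T (tree_image f T)"
proof -
  have "(f u, f v) \<in> map_prod f f ` R \<longleftrightarrow> (u, v) \<in> R" for u v R
    using inj by (auto simp: inj_eq)
  then show ?thesis unfolding tree_iso_def tree_image_arcs using inj
    by (intro exI[of _ f]) (auto simp: tree_image_def bij_betw_def inj_on_def)
qed

lemma tree_image_children: "children (tree_image f T) (f u) = f ` children T u"
  using inj unfolding children_def tree_image_arcs by (auto simp: inj_eq)

lemma family_tree_image: "family_tree (tree_image f T)"
  unfolding family_tree_def
proof (intro conjI ballI allI impI)
  let ?I = "tree_image f T"
  have V: "verts ?I = f ` verts T" by (simp add: tree_image_def)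
  have sib: "sib_less ?I = map_prod f f ` sib_less T" by (simp add: tree_image_def)
  show "root ?I \<in> verts ?I" using T by (simp add: tree_image_def family_tree_def)
  show "v \<in> verts ?I" if "u \<in> verts ?I" "parent ?I u = Some v" for u v
    using that T inj by (auto simp: tree_image_def family_tree_def)
  have trancl: "(f u, y) \<in> (map_prod f f ` R)\<^sup>+ \<Longrightarrow> \<exists>v. y = f v \<and> (u, v) \<in> R\<^sup>+" for u y R
  proof (induction rule: trancl_induct)
    case (step y z)
    then obtain v v' w where "y = f v" "(u, v) \<in> R\<^sup>+" "y = f v'" "z = f w" "(v', w) \<in> R" by auto
    then show ?case using inj by (auto simp: inj_eq intro: trancl_into_trancl)
  qed (use inj in \<open>auto simp: inj_eq\<close>)
  show "acyclic (arcs ?I)"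
    unfolding acyclic_def
  proof (intro allI notI)
    fix x assume x: "(x, x) \<in> (arcs ?I)\<^sup>+"
    then obtain y where "(x, y) \<in> arcs ?I" by (meson tranclD)
    then obtain u where u: "x = f u" by (auto simp: tree_image_arcs)
    with x trancl[of u x "arcs T"] inj have "(u, u) \<in> (arcs T)\<^sup>+" by (auto simp: tree_image_arcs inj_eq)
    then show False using T by (auto simp: family_tree_def acyclic_def)
  qed
  have rtrancl: "(u, v) \<in> (arcs T \<union> (arcs T)\<inverse>)\<^sup>* \<Longrightarrow> (f u, f v) \<in> (arcs ?I \<union> (arcs ?I)\<inverse>)\<^sup>*" for u v
  proof (induction rule: rtrancl_induct)
    case (step v w)
    then have "(f v, f w) \<in> arcs ?I \<union> (arcs ?I)\<inverse>" by (auto simp: tree_image_arcs)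
    with step(3) show ?case by (rule rtrancl_into_rtrancl)
  qed simp
  show "(u, v) \<in> (arcs ?I \<union> (arcs ?I)\<inverse>)\<^sup>*" if "u \<in> verts ?I" "v \<in> verts ?I" for u v
    using that rtrancl T unfolding V by (auto simp: family_tree_def)
  show "finite (children ?I v)" if "v \<in> verts ?I" for v
    using that T unfolding V by (auto simp: tree_image_children family_tree_def)
  show "sib_less ?I \<subseteq> (\<Union>v\<in>verts ?I. children ?I v \<times> children ?I v)"
  proof
    fix e assume "e \<in> sib_less ?I"
    then obtain a b where ab: "(a, b) \<in> sib_less T" "e = (f a, f b)" by (auto simp: sib)
    then obtain w where "w \<in> verts T" "a \<in> children T w" "b \<in> children T w"
      using T by (auto simp: family_tree_def)
    then show "e \<in> (\<Union>v\<in>verts ?I. children ?I v \<times> children ?I v)"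
      unfolding V ab by (intro UN_I[of "f w"]) (auto simp: tree_image_children)
  qed
  show "strict_linear_order_on (children ?I v) (sib_less ?I \<inter> children ?I v \<times> children ?I v)"
    if "v \<in> verts ?I" for v
  proof -
    obtain u where u: "v = f u" "u \<in> verts T" using \<open>v \<in> verts ?I\<close> unfolding V by blast
    let ?R = "sib_less T \<inter> children T u \<times> children T u"
    have R: "sib_less ?I \<inter> children ?I v \<times> children ?I v = map_prod f f ` ?R"
      using inj by (auto simp: sib u tree_image_children inj_eq)
    have "strict_linear_order_on (children T u) ?R"
      using T u(2) by (auto simp: family_tree_def)
    then have S: "trans ?R" "irrefl ?R" "total_on (children T u) ?R"
      by (auto simp: strict_linear_order_on_def)
    have mem: "(f a, f b) \<in> map_prod f f ` ?R \<longleftrightarrow> (a, b) \<in> ?R" for a b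
      using inj by (auto simp: inj_eq)
    have mem': "\<exists>a b. x = f a \<and> y = f b" if "(x, y) \<in> map_prod f f ` ?R" for x y
      using that by auto
    have "trans (map_prod f f ` ?R)"
    proof (rule transI)
      fix x y z assume xyz: "(x, y) \<in> map_prod f f ` ?R" "(y, z) \<in> map_prod f f ` ?R"
      with mem'[OF xyz(1)] mem'[OF xyz(2)] obtain a b c where "x = f a" "y = f b" "z = f c" by blast
      with xyz show "(x, z) \<in> map_prod f f ` ?R" using transD[OF S(1), of a b c] by (simp only: mem)
    qed
    moreover have "irrefl (map_prod f f ` ?R)"
    proof (rule irreflI)
      fix x show "(x, x) \<notin> map_prod f f ` ?R"
        using S(2) inj by (auto simp: irrefl_def inj_eq)
    qed
    moreover have "total_on (f ` children T u) (map_prod f f ` ?R)"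
    proof (rule total_onI)
      fix x y assume "x \<in> f ` children T u" "y \<in> f ` children T u" "x \<noteq> y"
      then obtain a b where ab: "x = f a" "y = f b" "a \<in> children T u" "b \<in> children T u" "a \<noteq> b" by blast
      then have "(a, b) \<in> ?R \<or> (b, a) \<in> ?R" using S(3) unfolding total_on_def by blast
      then show "(x, y) \<in> map_prod f f ` ?R \<or> (y, x) \<in> map_prod f f ` ?R"
        unfolding ab mem .
    qed
    ultimately show ?thesis unfolding strict_linear_order_on_def R unfolding u tree_image_children by blast
  qed
qed

end

lemma iso_class_join:
  shows "iso_class (join_bushes b) \<in> tree_classes" "iso_class (join_bushes b) \<noteq> {}"
proof -
  let ?T = "join_bushes b" and ?f = "to_nat :: int \<times> nat list \<Rightarrow> nat"
  have T: "family_tree ?T" "root ?T \<in> verts ?T"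
    using family_tree_join[of b] by (simp_all add: family_tree_def)
  have iso: "tree_iso ?T (tree_image ?f ?T)" and fam: "family_tree (tree_image ?f ?T)"
    using tree_iso_image[of ?f ?T] family_tree_image[of ?f ?T] T by simp_all
  then have "tree_image ?f ?T \<in> iso_class ?T" by (simp add: iso_class_def)
  then show "iso_class ?T \<noteq> {}" by blast
  have "iso_class ?T = iso_class (tree_image ?f ?T)"
    unfolding iso_class_def using tree_iso_trans[OF iso] tree_iso_trans[OF tree_iso_sym[OF T(2) iso]]
    by blast
  then show "iso_class ?T \<in> tree_classes" unfolding tree_classes_def using fam by blast
qed

lemma backward_map_join: "backward_map (iso_class (join_bushes b)) = backward_tree (join_bushes b)"
proof -
  have "(SOME T. T \<in> iso_class (join_bushes b)) \<in> iso_class (join_bushes b)"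
    using iso_class_join(2) by (simp add: some_in_eq)
  then show ?thesis unfolding backward_map_def
    by (intro tree_iso_backward_tree[OF family_tree_join]) (simp_all add: iso_class_def)
qed

section \<open>Measurability\<close>

instance ord_tree :: countable
  by countable_datatype

section \<open>Locally determined sets of sequences\<close>

definition agree :: "nat \<Rightarrow> (int \<Rightarrow> 'b) \<Rightarrow> (int \<Rightarrow> 'b) \<Rightarrow> bool" where
  "agree r b b' \<longleftrightarrow> (\<forall>i\<in>{- int r..int r}. b i = b' i)"

text \<open>Openness in the product of discrete topologies, phrased without a topology on the
  entries so that it applies to sequences of bushes as well.\<close>

definition locally_determined :: "(int \<Rightarrow> 'b) set \<Rightarrow> bool" where
  "locally_determined U \<longleftrightarrow> (\<forall>b\<in>U. \<exists>r. \<forall>b'. agree r b b' \<longrightarrow> b' \<in> U)"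

lemma agree_mono: "agree s b b' \<Longrightarrow> r \<le> s \<Longrightarrow> agree r b b'"
  unfolding agree_def by force

lemma finite_int_bounded:
  assumes "finite A"
  shows "\<exists>r. \<forall>i\<in>A. i \<in> {- int r..int r}"
proof -
  define r where "r = nat (Max (insert 0 (abs ` A)))"
  have "int r = Max (insert 0 (abs ` A))" using assms by (simp add: r_def)
  then have "\<bar>i\<bar> \<le> int r" if "i \<in> A" for i using that assms by simp
  then show ?thesis by (force simp: abs_le_iff)
qed

text \<open>Over a countable alphabet there are only countably many cylinders
  \<open>C (r, l)\<close>, and the set is the union of those it contains.\<close>

lemma sets_locally_determined:
  fixes U :: "(int \<Rightarrow> 'b::countable) set"
  assumes "locally_determined U"
  shows "U \<in> sets (Pi\<^sub>M UNIV (\<lambda>_. count_space UNIV))"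
proof -
  define C where "C = (\<lambda>(r, l). {b. map b [- int r..int r] = (l :: 'b list)})"
  have "b \<in> \<Union> (C ` {p. C p \<subseteq> U})" if b: "b \<in> U" for b
  proof -
    obtain r where r: "\<And>b'. agree r b b' \<Longrightarrow> b' \<in> U"
      using assms b unfolding locally_determined_def by blast
    have "C (r, map b [- int r..int r]) \<subseteq> U"
      by (auto simp: C_def agree_def intro!: r)
    then show ?thesis by (intro UN_I[of "(r, map b [- int r..int r])"]) (auto simp: C_def)
  qed
  then have U: "U = \<Union> (C ` {p. C p \<subseteq> U})" by blast
  have "C p \<in> sets (Pi\<^sub>M UNIV (\<lambda>_. count_space UNIV))" for p
  proof -
    obtain r l where p: "p = (r, l)" by (cases p)
    have "C p = {b \<in> space (Pi\<^sub>M UNIV (\<lambda>_. count_space UNIV)).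
        \<forall>k<length l. length l = length [- int r..int r] \<and> b ([- int r..int r] ! k) = l ! k} \<inter>
        (if length l = length [- int r..int r] then UNIV else {})"
      by (auto simp: C_def p space_PiM list_eq_iff_nth_eq)
    also have "\<dots> \<in> sets (Pi\<^sub>M UNIV (\<lambda>_. count_space UNIV))"
    proof -
      have "{b \<in> space (Pi\<^sub>M UNIV (\<lambda>_. count_space UNIV)).
        \<forall>k<length l. length l = length [- int r..int r] \<and> b ([- int r..int r] ! k) = l ! k}
        \<in> sets (Pi\<^sub>M UNIV (\<lambda>_. count_space UNIV))" by measurable
      then show ?thesis by simp
    qed
    finally show ?thesis .
  qed
  then show ?thesis by (subst U) (intro sets.countable_UN', auto)
qed

lemma open_locally_determined:
  fixes U :: "(int \<Rightarrow> 'b::topological_space) set"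
  assumes "open U"
  shows "locally_determined U"
  unfolding locally_determined_def
proof
  fix b assume "b \<in> U"
  moreover have "openin (product_topology (\<lambda>_::int. euclidean :: 'b topology) UNIV) U"
    using assms by (simp add: open_fun_def)
  ultimately obtain X where X: "b \<in> (\<Pi>\<^sub>E i\<in>UNIV. X i)" "finite {i. X i \<noteq> UNIV}" "(\<Pi>\<^sub>E i\<in>UNIV. X i) \<subseteq> U"
    using product_topology_open_contains_basis[of "\<lambda>_::int. euclidean :: 'b topology" UNIV U b] by auto
  obtain r where r: "\<And>i. X i \<noteq> UNIV \<Longrightarrow> i \<in> {- int r..int r}"
    using finite_int_bounded[OF X(2)] by blast
  have "b' \<in> U" if "agree r b b'" for b'
  proof -
    have "b' i \<in> X i" for i
    proof (cases "X i = UNIV")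
      case False
      then have "b i = b' i" using that r[of i] unfolding agree_def by blast
      then show ?thesis using X(1) by (metis PiE_mem UNIV_I)
    qed simp
    then show ?thesis using X(3) by (auto simp: PiE_iff)
  qed
  then show "\<exists>r. \<forall>b'. agree r b b' \<longrightarrow> b' \<in> U" by blast
qed

text \<open>Every open set of sequences is locally determined and hence in the product
  sigma-algebra, so measurable coordinates give Borel measurability.\<close>

lemma measurable_int_sequence:
  fixes g :: "'a \<Rightarrow> int \<Rightarrow> int"
  assumes "\<And>n. (\<lambda>x. g x n) \<in> measurable M (count_space UNIV)"
  shows "g \<in> borel_measurable M"
proof -
  have "g \<in> measurable M (Pi\<^sub>M UNIV (\<lambda>_. count_space UNIV))"
    using assms by (intro measurable_PiM_single') auto
  moreover have "(\<lambda>b. b) \<in> measurable (Pi\<^sub>M UNIV (\<lambda>_. count_space UNIV)) (borel :: (int \<Rightarrow> int) measure)"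
    by (rule borel_measurableI) (auto simp: space_PiM intro!: sets_locally_determined open_locally_determined)
  ultimately show ?thesis by (rule measurable_compose)
qed

section \<open>Measurability of the joined tree\<close>

lemma join_reach:
  assumes "((0, []), v) \<in> (arcs (join_bushes b) \<union> (arcs (join_bushes b))\<inverse>) ^^ k"
  shows "\<bar>fst v\<bar> \<le> int k"
  using assms
proof (induction k arbitrary: v)
  case (Suc k)
  then obtain u where u: "((0, []), u) \<in> (arcs (join_bushes b) \<union> (arcs (join_bushes b))\<inverse>) ^^ k"
    "(u, v) \<in> arcs (join_bushes b) \<union> (arcs (join_bushes b))\<inverse>"
    by auto
  then show ?case using Suc.IH[OF u(1)] by (cases u; cases v) (auto simp: join_arcs split: if_splits)
qed simp

lemma join_arcs_agree:
  assumes "agree r b b'" "\<bar>fst u\<bar> \<le> int r" "\<bar>fst v\<bar> \<le> int r"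
  shows "(u, v) \<in> arcs (join_bushes b) \<longleftrightarrow> (u, v) \<in> arcs (join_bushes b')"
proof -
  have "b (fst u) = b' (fst u)" "b (fst v) = b' (fst v)"
    using assms unfolding agree_def by (auto simp: abs_le_iff)
  then show ?thesis by (cases u; cases v) (simp add: join_arcs join_verts)
qed

lemma join_reach_agree:
  assumes "agree r b b'" "k \<le> r"
    "((0, []), v) \<in> (arcs (join_bushes b) \<union> (arcs (join_bushes b))\<inverse>) ^^ k"
  shows "((0, []), v) \<in> (arcs (join_bushes b') \<union> (arcs (join_bushes b'))\<inverse>) ^^ k"
  using assms(2,3)
proof (induction k arbitrary: v)
  case (Suc k)
  then obtain u where u: "((0, []), u) \<in> (arcs (join_bushes b) \<union> (arcs (join_bushes b))\<inverse>) ^^ k"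
    "(u, v) \<in> arcs (join_bushes b) \<union> (arcs (join_bushes b))\<inverse>" by auto
  have "\<bar>fst u\<bar> \<le> int r" using join_reach[OF u(1)] Suc.prems by simp
  moreover have "\<bar>fst v\<bar> \<le> int r" using join_reach[OF Suc.prems(2)] Suc.prems(1) by simp
  ultimately have "(u, v) \<in> arcs (join_bushes b') \<union> (arcs (join_bushes b'))\<inverse>"
    using u(2) join_arcs_agree[OF assms(1)] by blast
  then show ?case using Suc.IH[OF _ u(1)] Suc.prems by auto
qed simp

text \<open>An arc changes the bush index by at most one, so the ball of radius r meets only the
  bushes with index in [-r, r]; the identity is then an isomorphism of the two balls.\<close>

lemma join_ball_agree:
  assumes "agree r b b'"
  shows "tree_iso (tree_ball r (join_bushes b)) (tree_ball r (join_bushes b'))"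
proof -
  let ?T = "join_bushes b" and ?T' = "join_bushes b'"
  have sym: "agree r b' b" using assms by (simp add: agree_def)
  have near: "b (fst v) = b' (fst v)"
    if "((0, []), v) \<in> (arcs (join_bushes c) \<union> (arcs (join_bushes c))\<inverse>) ^^ k" "k \<le> r" for c v k
    using join_reach[OF that(1)] that(2) assms by (auto simp: agree_def abs_le_iff)
  have mem: "v \<in> verts (join_bushes c')" if "v \<in> verts (join_bushes c)" "c (fst v) = c' (fst v)" for c c' v
    using that by (cases v) (simp add: join_verts)
  \<comment> \<open>Stated for c and c' so that it serves for both inclusions; the second premise
    lets \<open>near\<close>, which compares b with b', speak about c and c'.\<close>
  have sub: "verts (tree_ball r (join_bushes c)) \<subseteq> verts (tree_ball r (join_bushes c'))"
    if c: "agree r c c'" "\<And>i. c i = c' i \<longleftrightarrow> b i = b' i" for c c'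
  proof
    fix v assume "v \<in> verts (tree_ball r (join_bushes c))"
    then obtain k where k: "v \<in> verts (join_bushes c)" "k \<le> r"
      "((0, []), v) \<in> (arcs (join_bushes c) \<union> (arcs (join_bushes c))\<inverse>) ^^ k"
      unfolding tree_ball_simps join_root by blast
    have "v \<in> verts (join_bushes c')" using mem[OF k(1)] near[OF k(3,2)] c(2) by simp
    with join_reach_agree[OF c(1) k(2,3)] k(2)
    show "v \<in> verts (tree_ball r (join_bushes c'))" unfolding tree_ball_simps join_root by blast
  qed
  have verts: "verts (tree_ball r ?T) = verts (tree_ball r ?T')"
    using sub[OF assms] sub[OF sym] by (auto simp: eq_commute)
  have bn: "b (fst v) = b' (fst v) \<and> \<bar>fst v\<bar> \<le> int r" if "v \<in> verts (tree_ball r ?T)" for v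
  proof -
    from that obtain k where k: "k \<le> r" "((0, []), v) \<in> (arcs ?T \<union> (arcs ?T)\<inverse>) ^^ k"
      unfolding tree_ball_simps join_root by blast
    then show ?thesis using near[OF k(2,1)] join_reach[OF k(2)] by simp
  qed
  have marks: "mark ?T' v = mark ?T v" if "v \<in> verts (tree_ball r ?T)" for v
    using bn[OF that] by (cases v) (simp add: join_mark)
  have sib: "(u, v) \<in> sib_less ?T' \<longleftrightarrow> (u, v) \<in> sib_less ?T"
    if "u \<in> verts (tree_ball r ?T)" "v \<in> verts (tree_ball r ?T)" for u v
    using bn[OF that(1)] bn[OF that(2)] that unfolding join_sib_less
    by (cases u; cases v) (auto simp: join_verts)
  have arcs: "(u, v) \<in> arcs ?T' \<longleftrightarrow> (u, v) \<in> arcs ?T"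
    if "u \<in> verts (tree_ball r ?T)" "v \<in> verts (tree_ball r ?T)" for u v
    using bn[OF that(1)] bn[OF that(2)] join_arcs_agree[OF assms] by blast
  show ?thesis unfolding tree_iso_def tree_ball_simps(1,2,4,5) verts[symmetric]
    by (rule exI[of _ id]) (simp add: marks sib arcs join_root)
qed

lemma root_tree_ball: "root T \<in> verts T \<Longrightarrow> root (tree_ball r T) \<in> verts (tree_ball r T)"
  by (auto simp: tree_ball_simps intro!: exI[of _ 0])

definition ball_event :: "nat \<Rightarrow> nat rom_tree \<Rightarrow> nat rom_tree set set" where
  "ball_event r T = {c \<in> tree_classes. \<exists>T'\<in>c. tree_iso (tree_ball r T) (tree_ball r T')}"

lemma local_topology_eq:
  "local_topology = topology_generated_by {ball_event r T | r T. family_tree T}"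
  by (simp add: local_topology_def ball_event_def)

lemma openin_local_topology_subset:
  assumes "openin local_topology U"
  shows "U \<subseteq> tree_classes"
proof -
  have "U \<subseteq> topspace local_topology" using assms by (rule openin_subset)
  also have "\<dots> \<subseteq> tree_classes"
    unfolding local_topology_eq topology_generated_by_topspace by (auto simp: ball_event_def)
  finally show ?thesis .
qed

lemma locally_determined_vimage_local_topology:
  assumes "openin local_topology U"
  shows "locally_determined ((\<lambda>b. iso_class (join_bushes b)) -` U)"
proof -
  have "generate_topology_on {ball_event r T | r T. family_tree T} U"
    using assms unfolding local_topology_eq openin_topology_generated_by_iff .
  then show ?thesis
  proof induction
    case Empty
    show ?case by (simp add: locally_determined_def)
  next
    case (Int U V)
    show ?case unfolding locally_determined_def
    proof
      fix b assume b: "b \<in> (\<lambda>b. iso_class (join_bushes b)) -` (U \<inter> V)"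
      then have "b \<in> (\<lambda>b. iso_class (join_bushes b)) -` U" "b \<in> (\<lambda>b. iso_class (join_bushes b)) -` V"
        by auto
      then obtain r s where r: "\<And>b'. agree r b b' \<Longrightarrow> iso_class (join_bushes b') \<in> U" and
        s: "\<And>b'. agree s b b' \<Longrightarrow> iso_class (join_bushes b') \<in> V"
        using Int unfolding locally_determined_def by blast
      have "agree r b b' \<and> agree s b b'" if "agree (max r s) b b'" for b'
        using that by (simp add: agree_mono)
      with r s show "\<exists>r. \<forall>b'. agree r b b' \<longrightarrow> b' \<in> (\<lambda>b. iso_class (join_bushes b)) -` (U \<inter> V)"
        by (intro exI[of _ "max r s"]) auto
    qed
  next
    case (UN K)
    show ?case unfolding locally_determined_def
    proof
      fix b assume "b \<in> (\<lambda>b. iso_class (join_bushes b)) -` \<Union> K"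
      then obtain k where k: "k \<in> K" "b \<in> (\<lambda>b. iso_class (join_bushes b)) -` k" by auto
      have "locally_determined ((\<lambda>b. iso_class (join_bushes b)) -` k)" using UN k(1) by blast
      with k(2) obtain r where "\<And>b'. agree r b b' \<Longrightarrow> b' \<in> (\<lambda>b. iso_class (join_bushes b)) -` k"
        unfolding locally_determined_def by blast
      with k(1) show "\<exists>r. \<forall>b'. agree r b b' \<longrightarrow> b' \<in> (\<lambda>b. iso_class (join_bushes b)) -` \<Union> K" by blast
    qed
  next
    case (Basis S)
    then obtain r T where S: "S = ball_event r T" by blast
    have "iso_class (join_bushes b') \<in> S" if b: "iso_class (join_bushes b) \<in> S" "agree r b b'" for b b'
    proof -
      have root: "root (tree_ball r (join_bushes b)) \<in> verts (tree_ball r (join_bushes b))" for b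
        using family_tree_join[of b] by (intro root_tree_ball) (simp add: family_tree_def)
      obtain T' where T': "T' \<in> iso_class (join_bushes b)" "tree_iso (tree_ball r T) (tree_ball r T')"
        using b(1) by (auto simp: S ball_event_def)
      obtain T'' where T'': "T'' \<in> iso_class (join_bushes b')" using iso_class_join(2) by blast
      have "tree_iso (tree_ball r (join_bushes b)) (tree_ball r T')"
        "tree_iso (tree_ball r (join_bushes b')) (tree_ball r T'')"
        using T'(1) T'' tree_iso_ball[OF family_tree_join] by (auto simp: iso_class_def)
      \<comment> \<open>The balls are linked in a chain: T, T', the tree of b, the tree of b',
        T''.\<close>
      then have "tree_iso (tree_ball r T) (tree_ball r T'')"
        using T'(2) join_ball_agree[OF b(2)] tree_iso_sym[OF root] tree_iso_trans by metis
      then show ?thesis using T'' iso_class_join(1) by (auto simp: S ball_event_def)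
    qed
    then show ?case unfolding locally_determined_def by blast
  qed
qed

lemma space_tree_space: "space tree_space = tree_classes"
  unfolding tree_space_def by (rule space_measure_of) (use openin_local_topology_subset in auto)

lemma sets_tree_space_open: "openin local_topology U \<Longrightarrow> U \<in> sets tree_space"
  unfolding tree_space_def
  by (subst sets_measure_of) (use openin_local_topology_subset in auto)

lemma measurable_iso_class_join:
  assumes "sets N = sets (Pi\<^sub>M UNIV (\<lambda>_ :: int. count_space (UNIV :: (nat \<times> ord_tree) set)))"
  shows "(\<lambda>b. iso_class (join_bushes b)) \<in> measurable N tree_space"
  unfolding tree_space_def
proof (rule measurable_measure_of)
  show "{U. openin local_topology U} \<subseteq> Pow tree_classes" using openin_local_topology_subset by auto
  show "(\<lambda>b. iso_class (join_bushes b)) \<in> space N \<rightarrow> tree_classes" using iso_class_join(1) by blast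
  fix U assume "U \<in> {U. openin local_topology U}"
  then have "(\<lambda>b. iso_class (join_bushes b)) -` U \<in> sets N"
    unfolding assms by (intro sets_locally_determined locally_determined_vimage_local_topology) simp
  moreover have "space N = UNIV"
    using sets_eq_imp_space_eq[OF assms] by (simp add: space_PiM)
  ultimately show "(\<lambda>b. iso_class (join_bushes b)) -` U \<inter> space N \<in> sets N" by simp
qed

section \<open>Measurability of the backward map\<close>

definition representative :: "nat rom_tree set \<Rightarrow> nat rom_tree" where
  "representative c = (SOME T. T \<in> c)"

lemma tree_iso_refl: "tree_iso T T"
  unfolding tree_iso_def by (rule exI[of _ id]) simp

lemma representative:
  assumes "c \<in> tree_classes"
  shows "representative c \<in> c" "family_tree (representative c)"
proof -
  obtain T :: "nat rom_tree" where T: "family_tree T" "c = iso_class T" using assms by (auto simp: tree_classes_def)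
  then have "T \<in> c" by (simp add: iso_class_def tree_iso_refl)
  then show r: "representative c \<in> c" unfolding representative_def by (rule someI)
  then show "family_tree (representative c)" using T by (simp add: iso_class_def)
qed

text \<open>The entry at (a, b) is decided by the ball whose radius exceeds both lengths, so the
  event is a union of ball events. The union is indexed by all trees with that entry, and is
  therefore taken in the topology rather than in the sigma-algebra.\<close>

lemma openin_diagram: "openin local_topology {c \<in> tree_classes. diagram (representative c) a b = y}"
proof -
  let ?r = "Suc (max (length a) (length b))"
  have "{c \<in> tree_classes. diagram (representative c) a b = y} =
    \<Union> {ball_event ?r T | T. family_tree T \<and> diagram T a b = y}" (is "?L = ?R")
  proof (intro equalityI subsetI)
    fix c assume c: "c \<in> ?L"
    then have "c \<in> ball_event ?r (representative c)"
      using representative[of c] tree_iso_refl by (auto simp: ball_event_def)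
    then show "c \<in> ?R" using c representative[of c] by blast
  next
    fix c assume "c \<in> ?R"
    then obtain T T' :: "nat rom_tree" where T: "family_tree T" "diagram T a b = y" "c \<in> tree_classes" "T' \<in> c"
      "tree_iso (tree_ball ?r T) (tree_ball ?r T')" by (auto simp: ball_event_def)
    then obtain T0 :: "nat rom_tree" where T0: "family_tree T0" "c = iso_class T0" by (auto simp: tree_classes_def)
    have T': "family_tree T'" "tree_iso T0 T'" using T(4) T0 by (simp_all add: iso_class_def)
    have R: "family_tree (representative c)" "tree_iso T0 (representative c)"
      using representative[OF T(3)] T0 by (simp_all add: iso_class_def)
    have "diagram T' a b = diagram T a b"
      using tree_iso_ball_diagram[OF T(1) T'(1) T(5)] by simp
    moreover have "diagram T' = diagram T0" "diagram (representative c) = diagram T0"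
      using tree_iso_diagram[OF T0(1) T'] tree_iso_diagram[OF T0(1) R] by blast+
    ultimately show "c \<in> ?L" using T(2,3) by simp
  qed
  moreover have "openin local_topology ?R"
    unfolding local_topology_eq by (intro openin_Union topology_generated_by_Basis) auto
  ultimately show ?thesis by simp
qed

lemma measurable_diagram:
  "(\<lambda>c. diagram (representative c) a b) \<in> measurable tree_space (count_space UNIV)"
  unfolding measurable_count_space_eq2_countable
proof (intro conjI ballI)
  fix y :: "bool \<times> bool \<times> bool \<times> int \<times> nat"
  have "(\<lambda>c. diagram (representative c) a b) -` {y} \<inter> space tree_space =
    {c \<in> tree_classes. diagram (representative c) a b = y}"
    by (auto simp: space_tree_space)
  then show "(\<lambda>c. diagram (representative c) a b) -` {y} \<inter> space tree_space \<in> sets tree_space"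
    using sets_tree_space_open[OF openin_diagram] by simp
qed auto

context
  fixes N :: "'c measure" and D :: "'c \<Rightarrow> diag"
  assumes D: "\<And>a b. (\<lambda>c. D c a b) \<in> measurable N (count_space UNIV)"
begin

lemma measurable_component: "(\<lambda>c. g (D c a b)) \<in> measurable N (count_space UNIV)"
  by (rule measurable_compose[OF D]) simp

lemma measurable_d_basic [measurable]:
  "Measurable.pred N (\<lambda>c. d_vert (D c) a)" "Measurable.pred N (\<lambda>c. d_eq (D c) a b)"
  "Measurable.pred N (\<lambda>c. d_sib (D c) a b)"
  "(\<lambda>c. d_mark (D c) a) \<in> measurable N (count_space UNIV)"
  "(\<lambda>c. d_num (D c) a) \<in> measurable N (count_space UNIV)"
  unfolding d_vert_def d_eq_def d_sib_def d_mark_def d_num_def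
  by (rule measurable_component)+

lemma measurable_d_rls [measurable]: "Measurable.pred N (\<lambda>c. d_rls (D c) a b)"
  unfolding d_rls_def by measurable

lemma measurable_d_iter:
  assumes P: "\<And>a b. Measurable.pred N (\<lambda>c. P c a b)"
  shows "Measurable.pred N (\<lambda>c. d_iter (D c) (P c) n a)"
proof -
  note P [measurable]
  have [measurable]: "Measurable.pred N (\<lambda>c. d_next (D c) (P c) a b)" for a b
    unfolding d_next_def by measurable
  have [measurable]: "Measurable.pred N (\<lambda>c. d_step (D c) (P c) a b)" for a b
    unfolding d_step_def by measurable
  show ?thesis
  proof (induction n arbitrary: a)
    case (Suc n)
    note this [measurable]
    show ?case unfolding d_iter.simps by measurable
  qed simp
qed

lemma measurable_d_backward: "Measurable.pred N (\<lambda>c. d_backward (D c) n z)"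
proof -
  have [measurable]: "Measurable.pred N (\<lambda>c. d_line (D c) n a)" for n a
    unfolding d_line_def
    using measurable_d_iter[of "\<lambda>c. d_rls (D c)" "nat n" a]
      measurable_d_iter[of "\<lambda>c a b. d_rls (D c) b a" "nat (- n)" a] by (cases "n \<ge> 0") simp_all
  have [measurable]: "Measurable.pred N (\<lambda>c. d_path (D c) a)" for a
    unfolding d_path_def by measurable
  \<comment> \<open>Naming the number of children and the mark by quantified variables leaves only
    measurable predicates under quantifiers over countable types.\<close>
  have "d_backward (D c) n z \<longleftrightarrow> (\<exists>a k m. d_line (D c) (n + 1) a \<and> d_num (D c) a = k \<and> d_mark (D c) a = m \<and>
      ((d_path (D c) a \<and> z = int k + m - 1) \<or> (\<not> d_path (D c) a \<and> z = int k - 1)))" for c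
    unfolding d_backward_def by auto
  then show ?thesis by simp
qed

end

lemma measurable_backward_map_coord: "(\<lambda>c. backward_map c n) \<in> measurable tree_space (count_space UNIV)"
  unfolding measurable_count_space_eq2_countable
proof (intro conjI ballI)
  fix z :: int
  have "(\<lambda>c. backward_map c n) -` {z} \<inter> space tree_space =
    {c \<in> space tree_space. d_backward (diagram (representative c)) n z}"
    using d_backward[OF representative(2)]
    by (auto simp: space_tree_space backward_map_def representative_def)
  then show "(\<lambda>c. backward_map c n) -` {z} \<inter> space tree_space \<in> sets tree_space"
    using measurable_d_backward[OF measurable_diagram] by (simp add: pred_def)
qed auto

lemma measurable_backward_map: "backward_map \<in> borel_measurable tree_space"
  by (rule measurable_int_sequence[OF measurable_backward_map_coord])

section \<open>Bushes and record blocks\<close>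

text \<open>The whole word counts as a prefix; \<open>record_word\<close> applies this to
  \<open>butlast\<close>, so that the last letter, and no earlier one, reaches the record.\<close>

definition neg_prefixes :: "int list \<Rightarrow> bool" where
  "neg_prefixes w \<longleftrightarrow> (\<forall>k. 0 < k \<and> k \<le> length w \<longrightarrow> sum_list (take k w) < 0)"

definition record_word :: "int list \<Rightarrow> bool" where
  "record_word w \<longleftrightarrow> w \<noteq> [] \<and> (\<forall>x\<in>set w. x \<ge> - 1) \<and> neg_prefixes (butlast w) \<and> sum_list w \<ge> 0"

lemma neg_prefixes_append: "neg_prefixes u \<Longrightarrow> neg_prefixes v \<Longrightarrow> neg_prefixes (u @ v)"
  unfolding neg_prefixes_def
proof (intro allI impI)
  fix k
  assume u: "\<forall>k. 0 < k \<and> k \<le> length u \<longrightarrow> sum_list (take k u) < 0"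
    and v: "\<forall>k. 0 < k \<and> k \<le> length v \<longrightarrow> sum_list (take k v) < 0"
    and k: "0 < k \<and> k \<le> length (u @ v)"
  have "sum_list u \<le> 0" using u[rule_format, of "length u"] by (cases "u = []") auto
  show "sum_list (take k (u @ v)) < 0"
  proof (cases "k \<le> length u")
    case True
    then show ?thesis using u k by simp
  next
    case False
    then have "sum_list (take (k - length u) v) < 0" using v k by simp
    with \<open>sum_list u \<le> 0\<close> False show ?thesis by simp
  qed
qed

lemma neg_prefixes_snoc: "neg_prefixes (w @ [x]) \<longleftrightarrow> neg_prefixes w \<and> sum_list w + x < 0"
proof
  assume l: "neg_prefixes (w @ [x])"
  have "sum_list (take k w) < 0" if "0 < k \<and> k \<le> length w" for k
    using l that unfolding neg_prefixes_def by (metis append_take_drop_id butlast_snoc le_SucI length_append_singleton take_append take_eq_Nil diff_is_0_eq append.right_neutral take0)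
  moreover have "sum_list (take (Suc (length w)) (w @ [x])) < 0"
    using l unfolding neg_prefixes_def by (metis le_refl length_append_singleton zero_less_Suc)
  ultimately show "neg_prefixes w \<and> sum_list w + x < 0" by (simp add: neg_prefixes_def)
next
  assume "neg_prefixes w \<and> sum_list w + x < 0"
  then show "neg_prefixes (w @ [x])"
    unfolding neg_prefixes_def by (auto simp: le_Suc_eq)
qed

lemma neg_prefixes_concat: "(\<And>w. w \<in> set ws \<Longrightarrow> neg_prefixes w) \<Longrightarrow> neg_prefixes (concat ws)"
  by (induction ws) (auto simp: neg_prefixes_append neg_prefixes_def[of "[]"])

lemma sum_list_concat_map_m1: "(\<And>t. t \<in> set ts \<Longrightarrow> sum_list (g t) = (- 1 :: int)) \<Longrightarrow>
  sum_list (concat (map g ts)) = - int (length ts)"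
  by (induction ts) auto

lemma degree_word: "sum_list (degree_word t) = - 1 \<and> neg_prefixes (degree_word t) \<and> (\<forall>x\<in>set (degree_word t). x \<ge> - 1)"
proof (induction t)
  case (Node ts)
  then have "sum_list (concat (map degree_word ts)) = - int (length ts)"
    by (intro sum_list_concat_map_m1) auto
  moreover have "neg_prefixes (concat (map degree_word ts))"
    using Node by (intro neg_prefixes_concat) auto
  ultimately show ?case using Node by (auto simp: neg_prefixes_snoc)
qed

lemma record_bush_word: "record_word (bush_word b)"
proof -
  obtain n ts where b: "b = (n, Node ts)" by (metis bush_word.cases)
  have "neg_prefixes (concat (map degree_word ts))"
    using degree_word by (intro neg_prefixes_concat) auto
  moreover have "sum_list (concat (map degree_word ts)) = - int (length ts)"
    using degree_word by (intro sum_list_concat_map_m1) auto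
  ultimately show ?thesis using degree_word by (auto simp: b record_word_def)
qed

lemma bush_word_nonempty: "bush_word b \<noteq> []"
  using record_bush_word[of b] by (simp add: record_word_def)

text \<open>The last letter x becomes the root of a tree made from the last x + 1 trees of the
  forest parsed so far. There are that many, because w has sum minus the number of trees and the sum
  remains negative after x.\<close>

lemma degree_words_surj:
  assumes "neg_prefixes w" "\<forall>x\<in>set w. x \<ge> - 1"
  shows "\<exists>ts. w = concat (map degree_word ts) \<and> sum_list w = - int (length ts)"
  using assms
proof (induction w rule: rev_induct)
  case Nil
  show ?case by (intro exI[of _ "[]"]) simp
next
  case (snoc x w)
  then obtain ts where ts: "w = concat (map degree_word ts)" "sum_list w = - int (length ts)"
    by (auto simp: neg_prefixes_snoc)
  define k where "k = nat (x + 1)"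
  define us where "us = take (length ts - k) ts"
  define vs where "vs = drop (length ts - k) ts"
  have k: "k \<le> length ts" "int k = x + 1" using snoc.prems ts by (auto simp: k_def neg_prefixes_snoc)
  have uv: "ts = us @ vs" "length vs = k" "length us = length ts - k" using k by (auto simp: us_def vs_def)
  have "w @ [x] = concat (map degree_word (us @ [Node vs]))" using ts(1) uv k by simp
  moreover have "sum_list (w @ [x]) = - int (length (us @ [Node vs]))" using ts(2) uv(3) k by (simp add: of_nat_diff)
  ultimately show ?case by blast
qed

lemma bush_word_surj:
  assumes "record_word w"
  shows "\<exists>b. bush_word b = w"
proof -
  obtain u y where w: "w = u @ [y]" using assms by (metis record_word_def append_butlast_last_id)
  then obtain ts where ts: "u = concat (map degree_word ts)" "sum_list u = - int (length ts)"
    using assms degree_words_surj[of u] by (auto simp: record_word_def)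
  \<comment> \<open>The difference is the sum of w, which is nonnegative for a record word; it
    becomes the mark.\<close>
  then have "bush_word (nat (y - int (length ts)), Node ts) = w"
    using assms w by (auto simp: record_word_def)
  then show ?thesis by blast
qed

text \<open>A stack machine that decodes degree words: the letter x replaces the top x + 1 trees by
  one tree having them as children, with \<open>rev\<close> because the latest tree is on top. Being
  a left inverse of the coding, it yields injectivity.\<close>

definition shift_reduce :: "ord_tree list \<Rightarrow> int \<Rightarrow> ord_tree list" where
  "shift_reduce st x = Node (rev (take (nat (x + 1)) st)) # drop (nat (x + 1)) st"

lemma foldl_concat_map:
  assumes "\<And>t st. t \<in> set ts \<Longrightarrow> foldl f st (g t) = t # st"
  shows "foldl f st (concat (map g ts)) = rev ts @ st"
  using assms by (induction ts arbitrary: st) auto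

lemma shift_reduce_degree_word: "foldl shift_reduce st (degree_word t) = t # st"
proof (induction t arbitrary: st)
  case (Node ts)
  then have "foldl shift_reduce st (concat (map degree_word ts)) = rev ts @ st"
    by (intro foldl_concat_map) auto
  then show ?case by (simp add: shift_reduce_def[of "rev ts @ st"])
qed

lemma bush_word_inj:
  assumes "bush_word b = bush_word b'"
  shows "b = b'"
proof -
  obtain n ts n' ts' where b: "b = (n, Node ts)" "b' = (n', Node ts')" by (metis bush_word.cases)
  have "foldl shift_reduce [] (concat (map degree_word us)) = rev us" for us
    using foldl_concat_map[of us shift_reduce degree_word "[]"] shift_reduce_degree_word by simp
  with assms show ?thesis unfolding b by (metis append1_eq_conv bush_word.simps nat_int add_right_cancel rev_rev_ident)
qed

section \<open>Record blocks along a path\<close>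

definition segment :: "(int \<Rightarrow> int) \<Rightarrow> int \<Rightarrow> nat \<Rightarrow> int list" where
  "segment x i n = map (\<lambda>k. x (i + int k)) [0..<n]"

lemma segment_add: "segment x i (m + n) = segment x i m @ segment x (i + int m) n"
  by (induction n) (auto simp: segment_def algebra_simps)

lemma length_segment [simp]: "length (segment x i n) = n"
  by (simp add: segment_def)

lemma take_segment: "m \<le> n \<Longrightarrow> take m (segment x i n) = segment x i m"
  by (simp add: segment_def take_map)

lemma nth_segment: "k < n \<Longrightarrow> segment x i n ! k = x (i + int k)"
  by (simp add: segment_def)

lemma sum_segment: "sum_list (segment x i n) = (\<Sum>l\<in>{i..<i + int n}. x l)"
proof (induction n)
  case (Suc n)
  have "{i..<i + int (Suc n)} = insert (i + int n) {i..<i + int n}" by auto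
  then show ?case using Suc by (simp add: segment_def)
qed (simp add: segment_def)

lemma record_word_sums:
  assumes "record_word (segment x i n)"
  shows "n > 0" "(\<Sum>l\<in>{i..<i + int n}. x l) \<ge> 0"
    "\<And>j. i < j \<Longrightarrow> j < i + int n \<Longrightarrow> (\<Sum>l\<in>{i..<j}. x l) < 0"
proof -
  show n: "n > 0" using assms by (auto simp: record_word_def segment_def)
  show "(\<Sum>l\<in>{i..<i + int n}. x l) \<ge> 0" using assms by (simp add: record_word_def sum_segment)
  fix j assume j: "i < j" "j < i + int n"
  define k where "k = nat (j - i)"
  have k: "0 < k" "k \<le> length (butlast (segment x i n))" "j = i + int k" using j by (auto simp: k_def)
  then have "sum_list (take k (butlast (segment x i n))) < 0"
    using assms by (simp add: record_word_def neg_prefixes_def)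
  moreover have "take k (butlast (segment x i n)) = segment x i k"
    using k by (simp add: take_butlast take_segment)
  ultimately show "(\<Sum>l\<in>{i..<j}. x l) < 0" using k by (simp add: sum_segment)
qed

lemma record_map_record_word:
  assumes "record_word (segment x i n)"
  shows "record_map x i = i + int n"
proof -
  note s = record_word_sums[OF assms]
  have "Inf {j. j > i \<and> (\<Sum>l\<in>{i..<j}. x l) \<ge> 0} = i + int n"
    by (rule cInf_eq_minimum) (use s in \<open>force+\<close>)
  then show ?thesis unfolding record_map_def using s(1,2) by (metis less_add_same_cancel1 of_nat_0_less_iff)
qed

lemma record_words_length_unique:
  assumes "record_word (segment x i m)" "record_word (segment x i n)"
  shows "m = n"
  using record_map_record_word[OF assms(1)] record_map_record_word[OF assms(2)] by simp

lemma record_word_exists: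
  assumes "\<And>l. x l \<ge> - 1" "\<exists>j>i. (\<Sum>l\<in>{i..<j}. x l) \<ge> 0"
  shows "\<exists>n. record_word (segment x i n)"
proof -
  define P where "P = (\<lambda>n. n > 0 \<and> (\<Sum>l\<in>{i..<i + int n}. x l) \<ge> 0)"
  from assms(2) obtain j where "j > i" "(\<Sum>l\<in>{i..<j}. x l) \<ge> 0" by blast
  then have "P (nat (j - i))" by (simp add: P_def)
  then have n: "P (Least P)" and least: "\<And>m. m < Least P \<Longrightarrow> \<not> P m"
    by (auto intro: LeastI dest: not_less_Least)
  define n where "n = Least P"
  have "sum_list (take k (butlast (segment x i n))) < 0" if "0 < k \<and> k \<le> length (butlast (segment x i n))" for k
  proof -
    have "k < n" using that by auto
    then have "\<not> P k" using least by (simp add: n_def)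
    moreover have "take k (butlast (segment x i n)) = segment x i k"
      using \<open>k < n\<close> by (simp add: take_butlast take_segment)
    ultimately show ?thesis using that by (simp add: P_def sum_segment)
  qed
  then have "record_word (segment x i n)"
    using n assms(1) unfolding record_word_def neg_prefixes_def n_def[symmetric]
    by (auto simp: P_def sum_segment) (auto simp: segment_def)
  then show ?thesis by blast
qed

definition bushes_word :: "(nat \<times> ord_tree) list \<Rightarrow> int list" where
  "bushes_word bs = concat (map bush_word bs)"

definition starts_with :: "(int \<Rightarrow> int) \<Rightarrow> int \<Rightarrow> int list \<Rightarrow> bool" where
  "starts_with x i w \<longleftrightarrow> segment x i (length w) = w"

lemma starts_with_append:
  "starts_with x i (u @ v) \<longleftrightarrow> starts_with x i u \<and> starts_with x (i + int (length u)) v"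
  by (auto simp: starts_with_def segment_add)

lemma bushes_word_simps [simp]:
  "bushes_word [] = []" "bushes_word (b # bs) = bush_word b @ bushes_word bs"
  "bushes_word (bs @ bs') = bushes_word bs @ bushes_word bs'"
  by (simp_all add: bushes_word_def)

lemma starts_with_Cons:
  "starts_with x i (bushes_word (b # bs)) \<longleftrightarrow>
    segment x i (length (bush_word b)) = bush_word b \<and>
    starts_with x (i + int (length (bush_word b))) (bushes_word bs)"
  by (simp add: starts_with_append starts_with_def[of x i "bush_word b"])

lemma length_bushes_word: "length bs \<le> length (bushes_word bs)"
proof (induction bs)
  case (Cons b bs)
  then show ?case using bush_word_nonempty[of b] by (cases "bush_word b") auto
qed simp

text \<open>A record word read from i ends exactly at the record of i, so the first blocks have
  equal lengths, are equal as words, and come from the same bush; the rest follows block by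
  block.\<close>

lemma bushes_unique:
  assumes "starts_with x i (bushes_word bs)" "starts_with x i (bushes_word bs')" "length bs = length bs'"
  shows "bs = bs'"
  using assms(3,1,2)
proof (induction bs bs' arbitrary: i rule: list_induct2)
  case (Cons b bs b' bs')
  then have s: "segment x i (length (bush_word b)) = bush_word b" "segment x i (length (bush_word b')) = bush_word b'"
    unfolding starts_with_Cons by simp_all
  have len: "length (bush_word b) = length (bush_word b')"
    by (rule record_words_length_unique[of x i]) (simp_all add: s record_bush_word)
  have "bush_word b = bush_word b'" using s(1) unfolding len s(2) by simp
  then have "b = b'" by (rule bush_word_inj)
  then show ?case using Cons unfolding starts_with_Cons by simp
qed simp

lemma bushes_exist:
  assumes "\<And>l. x l \<ge> - 1" "\<And>i. \<exists>j>i. (\<Sum>l\<in>{i..<j}. x l) \<ge> 0"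
  shows "\<exists>bs. length bs = n \<and> starts_with x i (bushes_word bs)"
proof (induction n arbitrary: i)
  case 0
  show ?case by (intro exI[of _ "[]"]) (simp add: starts_with_def segment_def)
next
  case (Suc n)
  obtain k where k: "record_word (segment x i k)" using record_word_exists assms by blast
  then obtain b where b: "bush_word b = segment x i k" using bush_word_surj by blast
  obtain bs where "length bs = n" "starts_with x (i + int k) (bushes_word bs)" using Suc by blast
  then have "length (b # bs) = Suc n \<and> starts_with x i (bushes_word (b # bs))"
    using b unfolding starts_with_Cons by simp
  then show ?case by blast
qed

lemma record_map_iterate:
  assumes "starts_with x i (bushes_word bs)"
  shows "(record_map x ^^ length bs) i = i + int (length (bushes_word bs))"
  using assms
proof (induction bs arbitrary: i)
  case (Cons b bs)
  have "segment x i (length (bush_word b)) = bush_word b"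
    using Cons.prems unfolding starts_with_Cons by simp
  then have "record_map x i = i + int (length (bush_word b))"
    by (intro record_map_record_word) (simp add: record_bush_word)
  then show ?case using Cons unfolding starts_with_Cons
    by (simp add: funpow_Suc_right del: funpow.simps)
qed simp

text \<open>The sequence spelled by the bushes \<open>bs\<close>, with the origin right after the first \<open>n\<close> of
  them.\<close>

definition window :: "nat \<Rightarrow> (nat \<times> ord_tree) list \<Rightarrow> int \<Rightarrow> int" where
  "window n bs j = bushes_word bs ! nat (int (length (bushes_word (take n bs))) + j)"

text \<open>Each bush word has at least one letter. The K positions before the origin are thus
  covered by n >= K bushes, and the positions 0 to K by K + 1 further ones.\<close>

lemma window_bounds:
  assumes "K \<le> n" "n + Suc K \<le> length bs" "\<bar>j\<bar> \<le> int K"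
  shows "0 \<le> int (length (bushes_word (take n bs))) + j"
    "int (length (bushes_word (take n bs))) + j < int (length (bushes_word bs))"
proof -
  have "K \<le> length (bushes_word (take n bs))" using length_bushes_word[of "take n bs"] assms by simp
  then show "0 \<le> int (length (bushes_word (take n bs))) + j" using assms(3) by linarith
  have "length (bushes_word bs) = length (bushes_word (take n bs)) + length (bushes_word (drop n bs))"
    by (metis append_take_drop_id bushes_word_simps(3) length_append)
  moreover have "Suc K \<le> length (bushes_word (drop n bs))"
    using length_bushes_word[of "drop n bs"] assms by simp
  ultimately show "int (length (bushes_word (take n bs))) + j < int (length (bushes_word bs))"
    using assms(3) by linarith
qed

text \<open>Together with \<open>backward_map_join_window\<close> this expresses the view from the
  n-th record and the limit through the same function \<open>window n\<close> of a list of bushes,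
  so that only the laws of the lists remain to be compared.\<close>

lemma rooted_line_record_window:
  assumes "starts_with x 0 (bushes_word bs)" "K \<le> n" "n + Suc K \<le> length bs" "\<bar>j\<bar> \<le> int K"
  shows "rooted_line ((record_map x ^^ n) 0) x j = window n bs j"
proof -
  note wb = window_bounds[OF assms(2-4)]
  have "starts_with x 0 (bushes_word (take n bs))"
    using assms(1) starts_with_append[of x 0 "bushes_word (take n bs)" "bushes_word (drop n bs)"]
    by (metis append_take_drop_id bushes_word_simps(3))
  from record_map_iterate[OF this] have "(record_map x ^^ n) 0 = int (length (bushes_word (take n bs)))"
    using assms(3) by simp
  moreover have "bushes_word bs ! k = x (int k)" if "k < length (bushes_word bs)" for k
    using assms(1) nth_segment[OF that, of x 0] by (simp add: starts_with_def)
  ultimately show ?thesis using wb by (simp add: window_def rooted_line_def add.commute)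
qed

text \<open>The condition 0 < n keeps bush 0, and with it the root of the joined tree, inside the
  window.\<close>

lemma backward_map_join_window:
  assumes "K \<le> n" "0 < n" "\<bar>j\<bar> \<le> int K"
  shows "backward_map (iso_class (join_bushes b)) j = window n (map b [1 - int n..int K + 1]) j"
proof -
  let ?bs = "map b [1 - int n..int K + 1]"
  have bs: "bushes_word (map b xs) = concat (map (\<lambda>i. bush_word (b i)) xs)" for xs
    by (simp add: bushes_word_def o_def)
  have "[1 - int n..int K + 1] = [1 - int n..0] @ [1..int K + 1]"
    using upto_split1[of "1 - int n" 1 "int K + 1"] upto_split2[of "1 - int n" 0 "int K + 1"] assms(2) by simp
  then have t: "take n ?bs = map b [1 - int n..0]" by (simp add: take_map)
  have len: "n + Suc K \<le> length ?bs" by simp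
  show ?thesis
    unfolding backward_map_join window_def t bs
    by (rule backward_tree_join)
      (use assms window_bounds[OF assms(1) len assms(3)] in \<open>simp_all add: t bs\<close>)
qed

text \<open>With k children the subtrees leave c^(-k), which meets c^(k-1) at the root; the factor
  1/c reproduces itself.\<close>

lemma gw_prob_degree_word:
  assumes "c \<noteq> 0" "\<And>k. \<pi> k = c powi (int k - 1) * p (int k - 1)"
  shows "gw_prob \<pi> t = prod_list (map p (degree_word t)) / c"
proof (induction t)
  case (Node ts)
  have "(\<Prod>t\<leftarrow>ts. gw_prob \<pi> t) = prod_list (map p (concat (map degree_word ts))) / c ^ length ts"
    using Node by (induction ts) (auto simp: field_simps)
  moreover have "\<pi> (length ts) = c ^ length ts * p (int (length ts) - 1) / c"
    using assms(1) by (simp add: assms(2) power_int_diff)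
  ultimately show ?case using assms(1) by simp
qed

lemma bush_prob_word:
  assumes "c \<noteq> 0" "\<And>k. \<pi> k = c powi (int k - 1) * p (int k - 1)"
    "\<And>n k. q n k = p (int (n + k)) * c ^ k"
  shows "bush_prob q \<pi> b = prod_list (map p (bush_word b))"
proof -
  obtain n ts where b: "b = (n, Node ts)" by (metis bush_word.cases)
  have "(\<Prod>t\<leftarrow>ts. gw_prob \<pi> t) = prod_list (map p (concat (map degree_word ts))) / c ^ length ts"
    using gw_prob_degree_word[where p = p, OF assms(1,2)] by (induction ts) (auto simp: field_simps)
  then show ?thesis using assms(1) by (simp add: b assms(3) field_simps)
qed

section \<open>The random walk\<close>

lemma starts_with_iff: "starts_with x i w \<longleftrightarrow> (\<forall>k<length w. x (i + int k) = w ! k)"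
  unfolding starts_with_def segment_def list_eq_iff_nth_eq by simp

locale skip_free_walk = prob_space M for M :: "'a measure" +
  fixes X :: "int \<Rightarrow> 'a \<Rightarrow> int"
  assumes indep: "indep_vars (\<lambda>_. count_space UNIV) X UNIV"
    and ident: "\<And>n. distr M (count_space UNIV) (X n) = distr M (count_space UNIV) (X 0)"
    and skip_free: "\<And>n. AE \<omega> in M. X n \<omega> \<ge> - 1"
    and integrable: "integrable M (\<lambda>\<omega>. real_of_int (X 0 \<omega>))"
    and mean_pos: "(\<integral>\<omega>. real_of_int (X 0 \<omega>) \<partial>M) > 0"
begin

definition path :: "'a \<Rightarrow> int \<Rightarrow> int" where
  "path \<omega> = (\<lambda>k. X k \<omega>)"

definition p :: "int \<Rightarrow> real" where
  "p z = prob {\<omega> \<in> space M. X 0 \<omega> = z}"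

lemma X_measurable [measurable]: "X n \<in> measurable M (count_space UNIV)"
  using indep by (simp add: indep_vars_def)

lemma path_measurable [measurable]: "(\<lambda>\<omega>. path \<omega> n) \<in> measurable M (count_space UNIV)"
  by (simp add: path_def)

lemma prob_X: "prob {\<omega> \<in> space M. X n \<omega> = z} = p z"
proof -
  have "prob {\<omega> \<in> space M. X m \<omega> = z} = measure (distr M (count_space UNIV) (X m)) {z}" for m
    by (subst measure_distr) (auto intro!: arg_cong[where f = prob])
  then show ?thesis using ident[of n] by (simp add: p_def)
qed

lemma prob_vimage: "prob (X n -` {z} \<inter> space M) = p z"
  unfolding prob_X[of n z, symmetric] by (intro arg_cong[where f = prob]) auto

lemma p_nonneg: "p z \<ge> 0"
  by (simp add: p_def)

lemma starts_with_measurable [measurable]: "Measurable.pred M (\<lambda>\<omega>. starts_with (path \<omega>) 0 w)"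
proof -
  have "starts_with (path \<omega>) 0 w \<longleftrightarrow> (\<forall>k\<in>{..<length w}. path \<omega> (int k) = w ! k)" for \<omega>
    by (auto simp: starts_with_iff)
  then show ?thesis by simp
qed

lemma prob_starts_with: "prob {\<omega> \<in> space M. starts_with (path \<omega>) 0 w} = prod_list (map p w)"
\<comment> \<open>The product rule \<open>indep_varsD\<close> asks for a nonempty set of
  indices.\<close>
proof (cases "w = []")
  case True
  then show ?thesis by (simp add: starts_with_iff prob_space)
next
  case False
  let ?J = "int ` {..<length w}"
  have "{\<omega> \<in> space M. starts_with (path \<omega>) 0 w} = (\<Inter>j\<in>?J. X j -` {w ! nat j} \<inter> space M)"
    using False by (auto simp: starts_with_iff path_def)
  also have "prob \<dots> = (\<Prod>j\<in>?J. prob (X j -` {w ! nat j} \<inter> space M))"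
    by (rule indep_varsD[OF indep]) (use False in auto)
  also have "\<dots> = (\<Prod>j\<in>?J. p (w ! nat j))"
    by (simp only: prob_vimage)
  also have "\<dots> = (\<Prod>k<length w. p (w ! k))"
    by (subst prod.reindex) (auto simp: inj_on_def)
  also have "\<dots> = prod_list (map p w)"
    by (subst prod.list_conv_set_nth) (simp add: atLeast0LessThan)
  finally show ?thesis .
qed

section \<open>Almost sure existence of records and the bushes of a path\<close>

lemma path_sum_ge_measurable [measurable]: "Measurable.pred M (\<lambda>\<omega>. (\<Sum>l\<in>I. path \<omega> l) \<ge> z)"
proof -
  have "(\<Sum>l\<in>I. path \<omega> l) \<ge> z \<longleftrightarrow> (\<Sum>l\<in>I. real_of_int (path \<omega> l)) \<ge> real_of_int z" for \<omega>
    unfolding of_int_sum[symmetric] of_int_le_iff ..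
  then show ?thesis by simp
qed

text \<open>Truncating the increments from above keeps the mean positive, and then Hoeffding's
  inequality applies.\<close>

lemma truncated_mean_pos:
  obtains L :: int where "L \<ge> 1" "(\<integral>\<omega>. real_of_int (min (X 0 \<omega>) L) \<partial>M) > 0"
proof -
  have "(\<lambda>n. \<integral>\<omega>. real_of_int (min (X 0 \<omega>) (int n)) \<partial>M) \<longlonglongrightarrow> (\<integral>\<omega>. real_of_int (X 0 \<omega>) \<partial>M)"
  proof (rule integral_dominated_convergence[where w = "\<lambda>\<omega>. \<bar>real_of_int (X 0 \<omega>)\<bar>"])
    show "(\<lambda>\<omega>. real_of_int (X 0 \<omega>)) \<in> borel_measurable M" using integrable by simp
    show "(\<lambda>\<omega>. real_of_int (min (X 0 \<omega>) (int n))) \<in> borel_measurable M" for n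
      by (rule measurable_compose[OF X_measurable]) simp
    show "integrable M (\<lambda>\<omega>. \<bar>real_of_int (X 0 \<omega>)\<bar>)" using integrable by simp
    show "AE \<omega> in M. (\<lambda>n. real_of_int (min (X 0 \<omega>) (int n))) \<longlonglongrightarrow> real_of_int (X 0 \<omega>)"
    proof (rule AE_I2)
      fix \<omega>
      have "\<forall>\<^sub>F n in sequentially. real_of_int (min (X 0 \<omega>) (int n)) = real_of_int (X 0 \<omega>)"
        using eventually_ge_at_top[of "nat \<bar>X 0 \<omega>\<bar>"] by eventually_elim (simp add: min_def nat_le_iff)
      then show "(\<lambda>n. real_of_int (min (X 0 \<omega>) (int n))) \<longlonglongrightarrow> real_of_int (X 0 \<omega>)"
        by (rule tendsto_eventually)
    qed
    show "AE \<omega> in M. norm (real_of_int (min (X 0 \<omega>) (int n))) \<le> \<bar>real_of_int (X 0 \<omega>)\<bar>" for n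
      by (rule AE_I2) (auto simp: min_def)
  qed
  from order_tendstoD(1)[OF this mean_pos] eventually_ge_at_top[of 1]
  have "\<forall>\<^sub>F n in sequentially. (\<integral>\<omega>. real_of_int (min (X 0 \<omega>) (int n)) \<partial>M) > 0 \<and> n \<ge> 1"
    by eventually_elim simp
  then obtain n where "(\<integral>\<omega>. real_of_int (min (X 0 \<omega>) (int n)) \<partial>M) > 0" "n \<ge> 1"
    by (auto simp: eventually_sequentially)
  then show thesis by (intro that[of "int n"]) auto
qed

text \<open>Without a record all sums from i are negative, and the truncated sums are no larger. For
  every n the truncated sum over n steps then lies at least n times its mean below expectation,
  which has probability exponentially small in n.\<close>

lemma AE_record_from: "AE \<omega> in M. \<exists>j>i. (\<Sum>l\<in>{i..<j}. path \<omega> l) \<ge> 0"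
proof -
  obtain L :: int where L: "L \<ge> 1" and pos: "(\<integral>\<omega>. real_of_int (min (X 0 \<omega>) L) \<partial>M) > 0"
    by (rule truncated_mean_pos)
  define \<mu> where "\<mu> = (\<integral>\<omega>. real_of_int (min (X 0 \<omega>) L) \<partial>M)"
  define Y where "Y l \<omega> = real_of_int (min (X l \<omega>) L)" for l \<omega>
  define N where "N = {\<omega> \<in> space M. \<not> (\<exists>j>i. (\<Sum>l\<in>{i..<j}. path \<omega> l) \<ge> 0)}"
  have N [measurable]: "N \<in> sets M" unfolding N_def by measurable
  have Y: "Y l \<in> borel_measurable M" for l
    unfolding Y_def by (rule measurable_compose[OF X_measurable]) simp
  have bound: "prob N \<le> exp (- (2 * \<mu>\<^sup>2 / (real_of_int L + 1)\<^sup>2) * real n)" if n: "n > 0" for n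
  proof -
    let ?I = "{i..<i + int n}"
    interpret H: Hoeffding_ineq_iid M ?I Y "Y 0" "- 1" "real_of_int L" \<mu>
    proof unfold_locales
      show "indep_vars (\<lambda>_. borel) Y ?I"
        unfolding Y_def by (rule indep_vars_compose2[OF indep_vars_subset[OF indep]]) auto
      show "distr M borel (Y l) = distr M borel (Y 0)" for l
      proof -
        have "distr M borel (Y l) = distr (distr M (count_space UNIV) (X l)) borel (\<lambda>z. real_of_int (min z L))" for l
          by (subst distr_distr) (auto simp: Y_def[abs_def] comp_def)
        then show ?thesis using ident[of l] by simp
      qed
      show "AE x in M. Y 0 x \<in> {- 1..real_of_int L}"
        using skip_free[of 0] by eventually_elim (use L in \<open>auto simp: Y_def min_def\<close>)
      show "\<mu> \<equiv> expectation (Y 0)" by (simp add: \<mu>_def Y_def[abs_def])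
    qed (use Y in auto)
    \<comment> \<open>The threshold is 0, written as the mean of the sum minus the deviation n \<mu>
      in order to fit Hoeffding's inequality.\<close>
    have "N \<subseteq> {\<omega> \<in> space M. (\<Sum>l\<in>?I. Y l \<omega>) \<le> real (card ?I) * \<mu> - real n * \<mu>}"
    proof
      fix \<omega> assume "\<omega> \<in> N"
      then have \<omega>: "\<omega> \<in> space M" "(\<Sum>l\<in>?I. path \<omega> l) < 0" using n by (auto simp: N_def not_le)
      have "(\<Sum>l\<in>?I. Y l \<omega>) \<le> (\<Sum>l\<in>?I. real_of_int (path \<omega> l))"
        by (intro sum_mono) (simp add: Y_def path_def)
      also have "\<dots> = real_of_int (\<Sum>l\<in>?I. path \<omega> l)" by simp
      also have "\<dots> \<le> 0" using \<omega>(2) unfolding of_int_le_0_iff by simp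
      finally show "\<omega> \<in> {\<omega> \<in> space M. (\<Sum>l\<in>?I. Y l \<omega>) \<le> real (card ?I) * \<mu> - real n * \<mu>}"
        using \<omega> by simp
    qed
    then have "prob N \<le> prob {\<omega> \<in> space M. (\<Sum>l\<in>?I. Y l \<omega>) \<le> real (card ?I) * \<mu> - real n * \<mu>}"
      using Y by (intro finite_measure_mono) measurable
    also have "\<dots> \<le> exp (- 2 * (real n * \<mu>)\<^sup>2 / (real (card ?I) * (real_of_int L - - 1)\<^sup>2))"
      using n L pos by (intro H.Hoeffding_ineq_le) (auto simp: \<mu>_def)
    also have "- 2 * (real n * \<mu>)\<^sup>2 / (real (card ?I) * (real_of_int L - - 1)\<^sup>2) =
        - (2 * \<mu>\<^sup>2 / (real_of_int L + 1)\<^sup>2) * real n"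
    proof -
      have "- 2 * (a * \<mu>)\<^sup>2 / (a * D\<^sup>2) = - (2 * \<mu>\<^sup>2 / D\<^sup>2) * a" if "a > 0" for a D :: real
        using that by (cases "D = 0") (simp_all add: power2_eq_square)
      from this[of "real n" "real_of_int L + 1"] n show ?thesis by simp
    qed
    finally show ?thesis .
  qed
  have "2 * \<mu>\<^sup>2 / (real_of_int L + 1)\<^sup>2 > 0" using pos L by (simp add: \<mu>_def)
  then have "(\<lambda>n. exp (- (2 * \<mu>\<^sup>2 / (real_of_int L + 1)\<^sup>2)) ^ n) \<longlonglongrightarrow> 0"
    by (intro LIMSEQ_realpow_zero) simp_all
  then have "(\<lambda>n. exp (- (2 * \<mu>\<^sup>2 / (real_of_int L + 1)\<^sup>2) * real n)) \<longlonglongrightarrow> 0"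
    by (simp only: exp_of_nat_mult[symmetric] mult.commute)
  then have "prob N \<le> 0"
    by (rule LIMSEQ_le_const) (use bound in \<open>auto intro!: exI[of _ 1]\<close>)
  then have "prob N = 0" by (simp add: measure_le_0_iff)
  then have "AE \<omega> in M. \<omega> \<notin> N" using N prob_eq_0 by blast
  then show ?thesis by (rule AE_mp) (auto simp: N_def intro!: AE_I2)
qed

lemma AE_bushes_exist: "AE \<omega> in M. \<forall>n. \<exists>bs. length bs = n \<and> starts_with (path \<omega>) 0 (bushes_word bs)"
proof -
  have "AE \<omega> in M. \<forall>l. path \<omega> l \<ge> - 1"
    using skip_free by (simp add: AE_all_countable path_def)
  moreover have "AE \<omega> in M. \<forall>i. \<exists>j>i. (\<Sum>l\<in>{i..<j}. path \<omega> l) \<ge> 0"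
    using AE_record_from by (simp add: AE_all_countable)
  ultimately show ?thesis by eventually_elim (blast intro: bushes_exist)
qed

text \<open>The list is empty on the null set of paths without \<open>n\<close> records.\<close>

definition bushes_of :: "nat \<Rightarrow> 'a \<Rightarrow> (nat \<times> ord_tree) list" where
  "bushes_of n \<omega> = (if \<exists>bs. length bs = n \<and> starts_with (path \<omega>) 0 (bushes_word bs)
     then SOME bs. length bs = n \<and> starts_with (path \<omega>) 0 (bushes_word bs) else [])"

text \<open>The choice has a single candidate by \<open>bushes_unique\<close>, so the graph is a
  countable combination of events about \<open>starts_with\<close>; this gives
  measurability.\<close>

lemma bushes_of_eq:
  "bushes_of n \<omega> = bs \<longleftrightarrow> (length bs = n \<and> starts_with (path \<omega>) 0 (bushes_word bs)) \<or>
     (bs = [] \<and> (\<forall>bs. length bs = n \<longrightarrow> \<not> starts_with (path \<omega>) 0 (bushes_word bs)))"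
proof (cases "\<exists>bs. length bs = n \<and> starts_with (path \<omega>) 0 (bushes_word bs)")
  case True
  then obtain bs' where bs': "length bs' = n" "starts_with (path \<omega>) 0 (bushes_word bs')" by blast
  from someI_ex[OF True] have s: "length (bushes_of n \<omega>) = n \<and> starts_with (path \<omega>) 0 (bushes_word (bushes_of n \<omega>))"
    using True by (simp add: bushes_of_def)
  show ?thesis
  proof
    assume "bushes_of n \<omega> = bs"
    with s show "(length bs = n \<and> starts_with (path \<omega>) 0 (bushes_word bs)) \<or>
      (bs = [] \<and> (\<forall>bs. length bs = n \<longrightarrow> \<not> starts_with (path \<omega>) 0 (bushes_word bs)))" by simp
  next
    assume "(length bs = n \<and> starts_with (path \<omega>) 0 (bushes_word bs)) \<or>
      (bs = [] \<and> (\<forall>bs. length bs = n \<longrightarrow> \<not> starts_with (path \<omega>) 0 (bushes_word bs)))"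
    with bs' have "length bs = n" "starts_with (path \<omega>) 0 (bushes_word bs)" by blast+
    with s show "bushes_of n \<omega> = bs" using bushes_unique by metis
  qed
qed (auto simp: bushes_of_def)

lemma bushes_of_measurable [measurable]: "bushes_of n \<in> measurable M (count_space UNIV)"
  unfolding measurable_count_space_eq2_countable
proof (intro conjI ballI)
  fix bs :: "(nat \<times> ord_tree) list"
  have "bushes_of n -` {bs} \<inter> space M = {\<omega> \<in> space M.
    (length bs = n \<and> starts_with (path \<omega>) 0 (bushes_word bs)) \<or>
     (bs = [] \<and> (\<forall>bs. length bs = n \<longrightarrow> \<not> starts_with (path \<omega>) 0 (bushes_word bs)))}"
    using bushes_of_eq by blast
  also have "\<dots> \<in> sets M" by measurable
  finally show "bushes_of n -` {bs} \<inter> space M \<in> sets M" .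
qed auto

lemma AE_bushes_of: "AE \<omega> in M. length (bushes_of n \<omega>) = n \<and> starts_with (path \<omega>) 0 (bushes_word (bushes_of n \<omega>))"
  using AE_bushes_exist
proof eventually_elim
  case (elim \<omega>)
  then show ?case using bushes_of_eq[of n \<omega> "bushes_of n \<omega>"] by blast
qed

lemma prob_bushes_of:
  assumes "length bs = n"
  shows "prob {\<omega> \<in> space M. bushes_of n \<omega> = bs} = (\<Prod>b\<leftarrow>bs. prod_list (map p (bush_word b)))"
proof -
  \<comment> \<open>For nonempty bs the default value cannot interfere, and for n = 0 the default is
    the genuine list, since every path starts with the empty word.\<close>
  have "bushes_of n \<omega> = bs \<longleftrightarrow> starts_with (path \<omega>) 0 (bushes_word bs)" for \<omega>
    using assms bushes_of_eq[of n \<omega> bs]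
    by (cases bs) (auto simp: starts_with_iff)
  moreover have "prod_list (map p (bushes_word bs)) = (\<Prod>b\<leftarrow>bs. prod_list (map p (bush_word b)))"
    by (induction bs) simp_all
  ultimately show ?thesis by (simp add: prob_starts_with)
qed

end

section \<open>The bush law and the i.i.d. sequence of bushes\<close>

locale skip_free_bushes = skip_free_walk +
  fixes c :: real and \<pi>t :: "nat \<Rightarrow> real" and q :: "nat \<Rightarrow> nat \<Rightarrow> real"
  assumes c_nonzero: "c \<noteq> 0"
    and offspring: "\<And>k. \<pi>t k = c powi (int k - 1) * p (int k - 1)"
    and mark_degree: "\<And>n k. q n k = p (int (n + k)) * c ^ k"
begin

lemma bush_prob_eq: "bush_prob q \<pi>t b = prod_list (map p (bush_word b))"
  by (rule bush_prob_word[OF c_nonzero offspring mark_degree])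

lemma sets_bush_law [measurable_cong]: "sets (bush_law q \<pi>t) = sets (count_space UNIV)"
  by (simp add: bush_law_def)

lemma emeasure_bush_law: "emeasure (bush_law q \<pi>t) {b} = ennreal (bush_prob q \<pi>t b)"
  unfolding bush_law_def by (subst emeasure_density) (auto simp: nn_integral_indicator_singleton')

text \<open>Both sides give a bush b the product of \<open>p\<close> over its word. As the law of
  the first record block, the bush law is seen to have total mass 1, which its density does not show
  directly.\<close>

lemma bush_law_distr: "bush_law q \<pi>t = distr M (count_space UNIV) (\<lambda>\<omega>. hd (bushes_of 1 \<omega>))"
proof (rule measure_eqI_countable[where A = UNIV])
  fix b
  have [measurable]: "(\<lambda>\<omega>. hd (bushes_of 1 \<omega>)) \<in> measurable M (count_space UNIV)"
    by (rule measurable_compose[OF bushes_of_measurable]) simp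
  have "emeasure (distr M (count_space UNIV) (\<lambda>\<omega>. hd (bushes_of 1 \<omega>))) {b} =
      prob {\<omega> \<in> space M. hd (bushes_of 1 \<omega>) = b}"
    by (subst emeasure_distr) (auto simp: emeasure_eq_measure intro!: arg_cong[where f = prob])
  also have "prob {\<omega> \<in> space M. hd (bushes_of 1 \<omega>) = b} = prob {\<omega> \<in> space M. bushes_of 1 \<omega> = [b]}"
  proof (rule finite_measure_eq_AE)
    show "AE \<omega> in M. \<omega> \<in> {\<omega> \<in> space M. hd (bushes_of 1 \<omega>) = b} \<longleftrightarrow> \<omega> \<in> {\<omega> \<in> space M. bushes_of 1 \<omega> = [b]}"
      using AE_bushes_of[of 1]
    proof eventually_elim
      case (elim \<omega>)
      then show ?case by (cases "bushes_of 1 \<omega>") auto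
    qed
  qed measurable
  also have "\<dots> = bush_prob q \<pi>t b" by (subst prob_bushes_of) (simp_all add: bush_prob_eq)
  finally show "emeasure (bush_law q \<pi>t) {b} = emeasure (distr M (count_space UNIV) (\<lambda>\<omega>. hd (bushes_of 1 \<omega>))) {b}"
    by (simp add: emeasure_bush_law)
qed (auto simp: sets_bush_law)

lemma prob_space_bush_law: "prob_space (bush_law q \<pi>t)"
  unfolding bush_law_distr
  by (intro prob_space_distr measurable_compose[OF bushes_of_measurable]) simp

abbreviation bushes_law :: "(int \<Rightarrow> nat \<times> ord_tree) measure" where
  "bushes_law \<equiv> Pi\<^sub>M UNIV (\<lambda>_ :: int. bush_law q \<pi>t)"

sublocale bushes: product_prob_space "\<lambda>_ :: int. bush_law q \<pi>t" UNIV
  by (intro product_prob_spaceI prob_space_bush_law)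

lemma sets_bushes_law: "sets bushes_law = sets (Pi\<^sub>M UNIV (\<lambda>_ :: int. count_space UNIV))"
  by (intro sets_PiM_cong refl) (simp add: sets_bush_law)

lemma bushes_measurable [measurable]:
  "(\<lambda>b. map b is) \<in> measurable bushes_law (count_space UNIV)"
proof -
  have "locally_determined {b :: int \<Rightarrow> nat \<times> ord_tree. map b is = bs}" for bs
    unfolding locally_determined_def
  proof
    fix b :: "int \<Rightarrow> nat \<times> ord_tree" assume b: "b \<in> {b. map b is = bs}"
    obtain r where r: "\<And>i. i \<in> set is \<Longrightarrow> i \<in> {- int r..int r}"
      using finite_int_bounded[of "set is"] by blast
    have eq: "map b' is = map b is" if "agree r b b'" for b'
      using that r unfolding agree_def by (intro map_cong refl) metis
    have "b' \<in> {b. map b is = bs}" if "agree r b b'" for b'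
      using eq[OF that] b by (simp only: mem_Collect_eq)
    then show "\<exists>r. \<forall>b'. agree r b b' \<longrightarrow> b' \<in> {b. map b is = bs}" by blast
  qed
  then have "{b. map b is = bs} \<in> sets bushes_law" for bs
    unfolding sets_bushes_law by (rule sets_locally_determined)
  moreover have "(\<lambda>b. map b is) -` {bs} \<inter> space bushes_law = {b. map b is = bs}" for bs
    using sets_eq_imp_space_eq[OF sets_bushes_law] by (auto simp: space_PiM)
  ultimately show ?thesis unfolding measurable_count_space_eq2_countable by simp
qed

lemma emeasure_bushes_law:
  assumes "length bs = n"
  shows "emeasure bushes_law {b \<in> space bushes_law. map b (map (\<lambda>k. a + int k) [0..<n]) = bs} =
    ennreal (\<Prod>b\<leftarrow>bs. bush_prob q \<pi>t b)"
proof -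
  let ?J = "(\<lambda>k. a + int k) ` {..<n}"
  have "{b \<in> space bushes_law. map b (map (\<lambda>k. a + int k) [0..<n]) = bs} =
      {b \<in> space bushes_law. \<forall>i\<in>?J. b i \<in> {bs ! nat (i - a)}}"
    using assms by (auto simp: list_eq_iff_nth_eq)
  also have "emeasure bushes_law \<dots> = (\<Prod>i\<in>?J. emeasure (bush_law q \<pi>t) {bs ! nat (i - a)})"
    by (rule bushes.emeasure_PiM_Collect) (auto simp: sets_bush_law)
  also have "\<dots> = (\<Prod>k<n. emeasure (bush_law q \<pi>t) {bs ! k})"
    by (subst prod.reindex) (auto simp: inj_on_def)
  also have "\<dots> = ennreal (\<Prod>k<n. bush_prob q \<pi>t (bs ! k))"
    unfolding emeasure_bush_law
    by (rule prod_ennreal) (auto simp: bush_prob_eq p_nonneg intro!: prod_list_nonneg)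
  also have "(\<Prod>k<n. bush_prob q \<pi>t (bs ! k)) = (\<Prod>b\<leftarrow>bs. bush_prob q \<pi>t b)"
    using assms by (subst prod.list_conv_set_nth) (simp add: atLeast0LessThan)
  finally show ?thesis .
qed

text \<open>There are countably many lists, so singletons suffice. The offset a is free because the
  bushes are i.i.d.; with a = 1 - n the first n of them end up just before the origin.\<close>

lemma distr_bushes_of:
  "distr M (count_space UNIV) (bushes_of n) =
   distr bushes_law (count_space UNIV) (\<lambda>b. map b (map (\<lambda>k. a + int k) [0..<n]))"
proof (rule measure_eqI_countable[where A = UNIV])
  fix bs :: "(nat \<times> ord_tree) list"
  have 1: "emeasure (distr M (count_space UNIV) (bushes_of n)) {bs} = prob {\<omega> \<in> space M. bushes_of n \<omega> = bs}"
    by (subst emeasure_distr) (auto simp: emeasure_eq_measure intro!: arg_cong[where f = prob])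
  have 2: "emeasure (distr bushes_law (count_space UNIV) (\<lambda>b. map b (map (\<lambda>k. a + int k) [0..<n]))) {bs} =
    emeasure bushes_law {b \<in> space bushes_law. map b (map (\<lambda>k. a + int k) [0..<n]) = bs}"
    by (subst emeasure_distr) (auto intro!: arg_cong[where f = "emeasure bushes_law"] simp del: map_map)
  show "emeasure (distr M (count_space UNIV) (bushes_of n)) {bs} =
    emeasure (distr bushes_law (count_space UNIV) (\<lambda>b. map b (map (\<lambda>k. a + int k) [0..<n]))) {bs}"
  proof (cases "length bs = n")
    case True
    then show ?thesis unfolding 1 2
      by (simp only: prob_bushes_of emeasure_bushes_law bush_prob_eq)
  next
    case False
    \<comment> \<open>A list of the wrong length can only be the default value, which is taken on a
      null set.\<close>
    have null: "prob {\<omega> \<in> space M. bushes_of n \<omega> = bs} = prob {}"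
      by (rule finite_measure_eq_AE)
        (use AE_bushes_of[of n] False in \<open>auto elim!: eventually_mono\<close>)
    have empty: "{b \<in> space bushes_law. map b (map (\<lambda>k. a + int k) [0..<n]) = bs} = {}"
      using False by auto
    show ?thesis unfolding 1 2 null empty by simp
  qed
qed auto

end

section \<open>Weak convergence\<close>

text \<open>The graph of the record map without \<open>Inf\<close>, in terms of countably many
  conditions on partial sums, as needed for measurability of the iterates.\<close>

lemma record_map_eq:
  "record_map x i = j \<longleftrightarrow>
     (i < j \<and> (\<Sum>l\<in>{i..<j}. x l) \<ge> 0 \<and> (\<forall>j'. i < j' \<and> j' < j \<longrightarrow> \<not> (\<Sum>l\<in>{i..<j'}. x l) \<ge> 0)) \<or>
     (j = i \<and> (\<forall>j'. i < j' \<longrightarrow> \<not> (\<Sum>l\<in>{i..<j'}. x l) \<ge> 0))"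
proof (cases "\<exists>j>i. (\<Sum>l\<in>{i..<j}. x l) \<ge> 0")
  case True
  define P where "P = (\<lambda>n. (\<Sum>l\<in>{i..<i + 1 + int n}. x l) \<ge> 0)"
  from True obtain j1 where "j1 > i" "(\<Sum>l\<in>{i..<j1}. x l) \<ge> 0" by blast
  then have "P (nat (j1 - i - 1))" by (simp add: P_def)
  then have least: "P (Least P)" "\<And>m. m < Least P \<Longrightarrow> \<not> P m"
    by (auto intro: LeastI dest: not_less_Least)
  define j0 where "j0 = i + 1 + int (Least P)"
  have j0: "i < j0" "(\<Sum>l\<in>{i..<j0}. x l) \<ge> 0" using least(1) by (auto simp: j0_def P_def)
  have min: "\<not> (\<Sum>l\<in>{i..<j'}. x l) \<ge> 0" if "i < j'" "j' < j0" for j'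
    using least(2)[of "nat (j' - i - 1)"] that by (simp add: j0_def P_def)
  have "Inf {j. j > i \<and> (\<Sum>l\<in>{i..<j}. x l) \<ge> 0} = j0"
    by (rule cInf_eq_minimum) (use j0 min in force)+
  then have R: "record_map x i = j0" using True by (simp add: record_map_def)
  show ?thesis unfolding R using j0 min True by (metis linorder_neqE)
next
  case False
  then show ?thesis by (auto simp: record_map_def)
qed

text \<open>All preimages under a function of finitely many coordinates are locally determined. This
  covers \<open>cyl_inf\<close> and \<open>cyl_sup\<close>, whose form as an infimum or supremum
  over uncountably many sequences does not show measurability.\<close>

lemma agree_measurable:
  fixes g :: "(int \<Rightarrow> int) \<Rightarrow> real"
  assumes g: "\<And>y y'. agree K y y' \<Longrightarrow> g y = g y'"
    and Y: "\<And>n. (\<lambda>x. Y x n) \<in> measurable N (count_space UNIV)"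
  shows "(\<lambda>x. g (Y x)) \<in> borel_measurable N"
proof -
  have "Y \<in> measurable N (Pi\<^sub>M UNIV (\<lambda>_. count_space UNIV))"
    using Y by (intro measurable_PiM_single') auto
  moreover have "g \<in> borel_measurable (Pi\<^sub>M UNIV (\<lambda>_. count_space UNIV))"
  proof (rule borel_measurableI)
    fix S :: "real set"
    have "locally_determined (g -` S)" unfolding locally_determined_def using g by (metis vimage_eq)
    then show "g -` S \<inter> space (Pi\<^sub>M UNIV (\<lambda>_. count_space UNIV)) \<in> sets (Pi\<^sub>M UNIV (\<lambda>_. count_space UNIV))"
      using sets_locally_determined by (simp add: space_PiM)
  qed
  ultimately show ?thesis by (rule measurable_compose)
qed

text \<open>Functions of finitely many coordinates that squeeze \<open>f\<close>.\<close>

definition cyl_inf :: "((int \<Rightarrow> int) \<Rightarrow> real) \<Rightarrow> nat \<Rightarrow> (int \<Rightarrow> int) \<Rightarrow> real" where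
  "cyl_inf f K y = (INF z\<in>{z. agree K y z}. f z)"

definition cyl_sup :: "((int \<Rightarrow> int) \<Rightarrow> real) \<Rightarrow> nat \<Rightarrow> (int \<Rightarrow> int) \<Rightarrow> real" where
  "cyl_sup f K y = (SUP z\<in>{z. agree K y z}. f z)"

lemma cyl_agree:
  assumes "agree K y y'"
  shows "cyl_inf f K y = cyl_inf f K y'" "cyl_sup f K y = cyl_sup f K y'"
proof -
  have "{z. agree K y z} = {z. agree K y' z}" using assms by (auto simp: agree_def)
  then show "cyl_inf f K y = cyl_inf f K y'" "cyl_sup f K y = cyl_sup f K y'"
    by (simp_all add: cyl_inf_def cyl_sup_def)
qed

context
  fixes f :: "(int \<Rightarrow> int) \<Rightarrow> real" and C :: real
  assumes bound: "\<And>y. \<bar>f y\<bar> \<le> C"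
begin

lemma bdd: "bdd_below (f ` A)" "bdd_above (f ` A)"
proof -
  have b: "- C \<le> f y \<and> f y \<le> C" for y using bound[of y] by linarith
  show "bdd_below (f ` A)" using b by (intro bdd_belowI[of _ "- C"]) auto
  show "bdd_above (f ` A)" using b by (intro bdd_aboveI[of _ C]) auto
qed

lemma agree_refl: "agree K y y"
  by (simp add: agree_def)

lemma cyl_bounds: "cyl_inf f K y \<le> f y" "f y \<le> cyl_sup f K y" "\<bar>cyl_inf f K y\<bar> \<le> C" "\<bar>cyl_sup f K y\<bar> \<le> C"
proof -
  show le: "cyl_inf f K y \<le> f y" "f y \<le> cyl_sup f K y"
    unfolding cyl_inf_def cyl_sup_def by (auto intro!: cINF_lower cSUP_upper bdd agree_refl)
  have "- C \<le> cyl_inf f K y" "cyl_sup f K y \<le> C"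
    unfolding cyl_inf_def cyl_sup_def
    using bound agree_refl by (auto intro!: cINF_greatest cSUP_least simp: abs_le_iff minus_le_iff)
  with le bound[of y] show "\<bar>cyl_inf f K y\<bar> \<le> C" "\<bar>cyl_sup f K y\<bar> \<le> C" by linarith+
qed

text \<open>Continuity at y bounds the oscillation of f over all sequences that agree with y on a
  long window. The length of that window depends on y, so the convergence is pointwise and the
  integrals are handled by dominated convergence.\<close>

lemma cyl_tendsto:
  assumes "continuous_on UNIV f"
  shows "(\<lambda>K. cyl_inf f K y) \<longlonglongrightarrow> f y" "(\<lambda>K. cyl_sup f K y) \<longlonglongrightarrow> f y"
proof -
  have near: "\<exists>r. \<forall>K\<ge>r. \<forall>z. agree K y z \<longrightarrow> \<bar>f z - f y\<bar> < e" if "e > 0" for e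
  proof -
    have "open (f -` ball (f y) e)" using assms by (intro open_vimage) auto
    then obtain r where r: "\<And>z. agree r y z \<Longrightarrow> z \<in> f -` ball (f y) e"
      using open_locally_determined \<open>e > 0\<close> unfolding locally_determined_def
      by (metis centre_in_ball vimageI2)
    have "\<bar>f z - f y\<bar> < e" if "K \<ge> r" "agree K y z" for K z
      using r[OF agree_mono[OF that(2,1)]] by (simp add: dist_real_def abs_minus_commute)
    then show ?thesis by blast
  qed
  have "\<exists>r. \<forall>K\<ge>r. \<bar>cyl_inf f K y - f y\<bar> < e \<and> \<bar>cyl_sup f K y - f y\<bar> < e" if "e > 0" for e
  proof -
    obtain r where r: "\<And>K z. K \<ge> r \<Longrightarrow> agree K y z \<Longrightarrow> \<bar>f z - f y\<bar> < e / 2"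
      using near[OF half_gt_zero[OF \<open>e > 0\<close>]] by blast
    have "\<bar>cyl_inf f K y - f y\<bar> < e \<and> \<bar>cyl_sup f K y - f y\<bar> < e" if "K \<ge> r" for K
    proof -
      have "f y - e / 2 \<le> cyl_inf f K y" unfolding cyl_inf_def
      proof (rule cINF_greatest)
        fix z assume "z \<in> {z. agree K y z}"
        then have "\<bar>f z - f y\<bar> < e / 2" using r[OF that] by simp
        then show "f y - e / 2 \<le> f z" by linarith
      qed (use agree_refl in auto)
      moreover have "cyl_sup f K y \<le> f y + e / 2" unfolding cyl_sup_def
      proof (rule cSUP_least)
        fix z assume "z \<in> {z. agree K y z}"
        then have "\<bar>f z - f y\<bar> < e / 2" using r[OF that] by simp
        then show "f z \<le> f y + e / 2" by linarith
      qed (use agree_refl in auto)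
      ultimately show ?thesis using cyl_bounds(1,2)[where K = K and y = y] \<open>e > 0\<close> by linarith
    qed
    then show ?thesis by blast
  qed
  then show "(\<lambda>K. cyl_inf f K y) \<longlonglongrightarrow> f y" "(\<lambda>K. cyl_sup f K y) \<longlonglongrightarrow> f y"
    unfolding LIMSEQ_iff real_norm_def by meson+
qed

end

section \<open>The view from the n-th record and the hitting probability\<close>

context skip_free_walk
begin

definition view :: "nat \<Rightarrow> 'a \<Rightarrow> int \<Rightarrow> int" where
  "view n \<omega> = rooted_line ((record_map (path \<omega>) ^^ n) 0) (path \<omega>)"

lemma view_measurable: "(\<lambda>\<omega>. view n \<omega> k) \<in> measurable M (count_space UNIV)"
proof -
  have [measurable]: "Measurable.pred M (\<lambda>\<omega>. record_map (path \<omega>) i = j)" for i j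
    unfolding record_map_eq by measurable
  have R [measurable]: "Measurable.pred M (\<lambda>\<omega>. (record_map (path \<omega>) ^^ n) 0 = j)" for j
  proof (induction n arbitrary: j)
    case (Suc n)
    note this [measurable]
    have "(record_map (path \<omega>) ^^ Suc n) 0 = j \<longleftrightarrow>
        (\<exists>i. (record_map (path \<omega>) ^^ n) 0 = i \<and> record_map (path \<omega>) i = j)" for \<omega>
      by simp
    then show ?case by (simp only:) measurable
  qed simp
  have "view n \<omega> k = z \<longleftrightarrow> (\<exists>i. (record_map (path \<omega>) ^^ n) 0 = i \<and> path \<omega> (k + i) = z)" for \<omega> z
    by (simp add: view_def rooted_line_def)
  then have "Measurable.pred M (\<lambda>\<omega>. view n \<omega> k = z)" for z by (simp only:) measurable
  then have "{\<omega> \<in> space M. view n \<omega> k = z} \<in> sets M" for z by (rule predE)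
  moreover have "(\<lambda>\<omega>. view n \<omega> k) -` {z} \<inter> space M = {\<omega> \<in> space M. view n \<omega> k = z}" for z by auto
  ultimately show ?thesis unfolding measurable_count_space_eq2_countable by simp
qed

text \<open>The event contains the case n = 1, a first increment equal to -1. This makes c nonzero,
  so the factors 1/c make sense.\<close>

lemma hit_prob_pos:
  assumes "p (- 1) > 0"
  shows "\<P>(\<omega> in M. \<exists>n>0. (\<Sum>k<n. X (int k) \<omega>) = - 1) > 0"
proof -
  have [measurable]: "Measurable.pred M (\<lambda>\<omega>. (\<Sum>k<n. X (int k) \<omega>) = - 1)" for n
  proof -
    have "(\<Sum>k<n. X (int k) \<omega>) = (\<Sum>l\<in>int ` {..<n}. path \<omega> l)" for \<omega>
      by (subst sum.reindex) (auto simp: path_def)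
    \<comment> \<open>An equation between integers becomes two inequalities, to which
      \<open>path_sum_ge_measurable\<close> applies.\<close>
    then have "(\<Sum>k<n. X (int k) \<omega>) = - 1 \<longleftrightarrow>
        (\<Sum>l\<in>int ` {..<n}. path \<omega> l) \<ge> - 1 \<and> \<not> (\<Sum>l\<in>int ` {..<n}. path \<omega> l) \<ge> 0" for \<omega> by auto
    then show ?thesis by simp
  qed
  have "p (- 1) \<le> \<P>(\<omega> in M. \<exists>n>0. (\<Sum>k<n. X (int k) \<omega>) = - 1)"
    unfolding p_def by (intro finite_measure_mono) (auto intro!: exI[of _ 1])
  with assms show ?thesis by linarith
qed

text \<open>Multiplied by c^k, this says that summing the joint law \<open>q\<close> over the marks
  gives the degree law \<open>\<pi>b\<close>.\<close>

lemma tail_prob_sums: "(\<lambda>n. p (int (n + k))) sums \<P>(\<omega> in M. X 0 \<omega> \<ge> int k)"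
proof -
  let ?A = "\<lambda>n. {\<omega> \<in> space M. X 0 \<omega> = int (n + k)}"
  have "(\<Union>n. ?A n) = {\<omega> \<in> space M. X 0 \<omega> \<ge> int k}"
  proof (intro equalityI subsetI)
    fix \<omega> assume "\<omega> \<in> {\<omega> \<in> space M. X 0 \<omega> \<ge> int k}"
    then have "\<omega> \<in> ?A (nat (X 0 \<omega> - int k))" by auto
    then show "\<omega> \<in> (\<Union>n. ?A n)" by blast
  qed auto
  moreover have "(\<lambda>n. prob (?A n)) sums prob (\<Union>n. ?A n)"
    by (rule finite_measure_UNION) (auto simp: disjoint_family_on_def)
  ultimately show ?thesis by (simp add: p_def)
qed

end

lemma upto_conv_upt: "[a..a + int N - 1] = map (\<lambda>k. a + int k) [0..<N]"
  by (rule nth_equalityI) (auto simp: nth_upto)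

section \<open>Comparison with the limit\<close>

context skip_free_bushes
begin

definition limit_view :: "(int \<Rightarrow> nat \<times> ord_tree) \<Rightarrow> int \<Rightarrow> int" where
  "limit_view b = backward_map (iso_class (join_bushes b))"

lemma join_measurable [measurable]: "(\<lambda>b. iso_class (join_bushes b)) \<in> measurable bushes_law tree_space"
  by (rule measurable_iso_class_join[OF sets_bushes_law])

lemma limit_view_measurable: "(\<lambda>b. limit_view b k) \<in> measurable bushes_law (count_space UNIV)"
  unfolding limit_view_def by (rule measurable_compose[OF join_measurable measurable_backward_map_coord])

lemma integral_view:
  assumes g: "\<And>y y'. agree K y y' \<Longrightarrow> g y = (g y' :: real)" and n: "K \<le> n" "0 < n"
  shows "(\<integral>\<omega>. g (view n \<omega>) \<partial>M) = (\<integral>b. g (limit_view b) \<partial>bushes_law)"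
proof -
  let ?N = "n + Suc K"
  let ?is = "map (\<lambda>k. 1 - int n + int k) [0..<?N]"
  have "1 - int n + int ?N - 1 = int K + 1" by simp
  then have is_eq: "?is = [1 - int n..int K + 1]"
    using upto_conv_upt[of "1 - int n" ?N] by (simp only:)
  have "(\<integral>\<omega>. g (view n \<omega>) \<partial>M) = (\<integral>\<omega>. g (window n (bushes_of ?N \<omega>)) \<partial>M)"
  proof (rule integral_cong_AE)
    show "(\<lambda>\<omega>. g (view n \<omega>)) \<in> borel_measurable M"
      by (rule agree_measurable[OF g view_measurable])
    show "(\<lambda>\<omega>. g (window n (bushes_of ?N \<omega>))) \<in> borel_measurable M"
      by (rule measurable_compose[OF bushes_of_measurable]) simp
    show "AE \<omega> in M. g (view n \<omega>) = g (window n (bushes_of ?N \<omega>))"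
      using AE_bushes_of[of ?N]
    proof eventually_elim
      case (elim \<omega>)
      then show ?case unfolding view_def
        using rooted_line_record_window[of "path \<omega>" "bushes_of ?N \<omega>" K n] n
        by (intro g) (auto simp: agree_def)
    qed
  qed
  also have "\<dots> = (\<integral>bs. g (window n bs) \<partial>distr M (count_space UNIV) (bushes_of ?N))"
    by (rule integral_distr[symmetric]) auto
  \<comment> \<open>Here the walk is exchanged for the i.i.d. bushes with indices 1 - n to K + 1,
    the block at the origin's left receiving index 0.\<close>
  also have "\<dots> = (\<integral>bs. g (window n bs) \<partial>distr bushes_law (count_space UNIV) (\<lambda>b. map b ?is))"
    by (simp only: distr_bushes_of[of ?N "1 - int n"])
  also have "\<dots> = (\<integral>b. g (window n (map b ?is)) \<partial>bushes_law)"
    by (rule integral_distr[OF bushes_measurable]) simp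
  also have "\<dots> = (\<integral>b. g (limit_view b) \<partial>bushes_law)"
  proof (rule Bochner_Integration.integral_cong[OF refl])
    fix b
    have "agree K (window n (map b ?is)) (limit_view b)"
      unfolding agree_def limit_view_def is_eq
    proof
      fix j assume "j \<in> {- int K..int K}"
      then have "\<bar>j\<bar> \<le> int K" by auto
      then show "window n (map b [1 - int n..int K + 1]) j = backward_map (iso_class (join_bushes b)) j"
        by (rule backward_map_join_window[OF n, symmetric])
    qed
    then show "g (window n (map b ?is)) = g (limit_view b)" by (rule g)
  qed
  finally show ?thesis .
qed

text \<open>The number K is chosen on the side of the bushes, where the integrals of the two bounds
  do not depend on n; the sandwich then holds for all n >= max K 1 at once.\<close>

lemma view_limit:
  assumes f: "continuous_on UNIV f" and bound: "\<And>y. \<bar>f y\<bar> \<le> (C :: real)"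
  shows "(\<lambda>n. \<integral>\<omega>. f (view n \<omega>) \<partial>M) \<longlonglongrightarrow> (\<integral>b. f (limit_view b) \<partial>bushes_law)"
proof -
  let ?I = "\<integral>b. f (limit_view b) \<partial>bushes_law"
  note cb = cyl_bounds[of f C, OF bound]
  have fb [measurable]: "f \<in> borel_measurable borel" using f by (rule borel_measurable_continuous_onI)
  have vb: "view n \<in> borel_measurable M" for n by (rule measurable_int_sequence[OF view_measurable])
  have lb: "limit_view \<in> borel_measurable bushes_law"
    by (rule measurable_int_sequence[OF limit_view_measurable])
  have meas: "(\<lambda>\<omega>. cyl_inf f K (view n \<omega>)) \<in> borel_measurable M"
    "(\<lambda>\<omega>. cyl_sup f K (view n \<omega>)) \<in> borel_measurable M"
    "(\<lambda>b. cyl_inf f K (limit_view b)) \<in> borel_measurable bushes_law"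
    "(\<lambda>b. cyl_sup f K (limit_view b)) \<in> borel_measurable bushes_law" for K n
    using cyl_agree by (intro agree_measurable[of K] view_measurable limit_view_measurable; blast)+
  have fm: "(\<lambda>\<omega>. f (view n \<omega>)) \<in> borel_measurable M" "(\<lambda>b. f (limit_view b)) \<in> borel_measurable bushes_law" for n
    using measurable_compose[OF vb fb] measurable_compose[OF lb fb] by simp_all
  have lim: "(\<lambda>K. \<integral>b. cyl_inf f K (limit_view b) \<partial>bushes_law) \<longlonglongrightarrow> ?I"
    "(\<lambda>K. \<integral>b. cyl_sup f K (limit_view b) \<partial>bushes_law) \<longlonglongrightarrow> ?I"
    using cyl_tendsto[OF bound f] cb(3,4)
    by (intro integral_dominated_convergence[where w = "\<lambda>_. C"] meas fm AE_I2; simp)+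
  have sandwich: "(\<integral>b. cyl_inf f K (limit_view b) \<partial>bushes_law) \<le> (\<integral>\<omega>. f (view n \<omega>) \<partial>M) \<and>
      (\<integral>\<omega>. f (view n \<omega>) \<partial>M) \<le> (\<integral>b. cyl_sup f K (limit_view b) \<partial>bushes_law)"
    if n: "K \<le> n" "0 < n" for K n
  proof -
    have int: "integrable M (\<lambda>\<omega>. cyl_inf f K (view n \<omega>))" "integrable M (\<lambda>\<omega>. cyl_sup f K (view n \<omega>))"
      "integrable M (\<lambda>\<omega>. f (view n \<omega>))"
      using cb(3,4) bound meas fm by (auto intro!: integrable_const_bound[where B = C])
    have eq: "(\<integral>\<omega>. cyl_inf f K (view n \<omega>) \<partial>M) = (\<integral>b. cyl_inf f K (limit_view b) \<partial>bushes_law)"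
      "(\<integral>\<omega>. cyl_sup f K (view n \<omega>) \<partial>M) = (\<integral>b. cyl_sup f K (limit_view b) \<partial>bushes_law)"
      using integral_view[of K "cyl_inf f K" n] integral_view[of K "cyl_sup f K" n] cyl_agree n by blast+
    show ?thesis unfolding eq[symmetric]
      using int cb(1,2) by (auto intro!: integral_mono)
  qed
  show ?thesis unfolding LIMSEQ_iff
  proof (intro allI impI)
    fix e :: real assume "e > 0"
    with lim obtain K where K: "\<bar>(\<integral>b. cyl_inf f K (limit_view b) \<partial>bushes_law) - ?I\<bar> < e"
        "\<bar>(\<integral>b. cyl_sup f K (limit_view b) \<partial>bushes_law) - ?I\<bar> < e"
      unfolding LIMSEQ_iff real_norm_def by (meson max.cobounded1 max.cobounded2)
    have "norm ((\<integral>\<omega>. f (view n \<omega>) \<partial>M) - ?I) < e" if "n \<ge> max K 1" for n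
      using sandwich[of K n] that K by (simp add: abs_less_iff)
    then show "\<exists>n0. \<forall>n\<ge>n0. norm ((\<integral>\<omega>. f (view n \<omega>) \<partial>M) - ?I) < e" by blast
  qed
qed

lemma R_probability: "is_R_probability M X (distr (MEKT q \<pi>t) borel backward_map)"
proof -
  have vb: "view n \<in> borel_measurable M" for n by (rule measurable_int_sequence[OF view_measurable])
  have lb: "limit_view \<in> borel_measurable bushes_law"
    by (rule measurable_int_sequence[OF limit_view_measurable])
  have D: "distr (MEKT q \<pi>t) borel backward_map = distr bushes_law borel limit_view"
    unfolding MEKT_def limit_view_def[abs_def]
    by (subst distr_distr[OF measurable_backward_map join_measurable]) (simp add: comp_def)
  have "(\<lambda>n. integral\<^sup>L (distr M borel (view n)) f) \<longlonglongrightarrow> integral\<^sup>L (distr bushes_law borel limit_view) f"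
    if f: "continuous_on UNIV f" "bounded (range f)" for f :: "(int \<Rightarrow> int) \<Rightarrow> real"
  proof -
    have fb: "f \<in> borel_measurable borel" using f(1) by (rule borel_measurable_continuous_onI)
    obtain C where "\<And>y. \<bar>f y\<bar> \<le> C" using f(2) by (auto simp: bounded_iff)
    from view_limit[OF f(1) this] show ?thesis
      by (simp add: integral_distr[OF vb fb] integral_distr[OF lb fb])
  qed
  moreover have "(\<lambda>\<omega>. let x = (\<lambda>k. X k \<omega>) in rooted_line ((record_map x ^^ n) 0) x) = view n" for n
    by (simp add: view_def[abs_def] path_def Let_def)
  moreover have "prob_space (distr bushes_law borel limit_view)"
    by (rule bushes.prob_space_distr[OF lb])
  ultimately show ?thesis unfolding is_R_probability_def weakly_converges_def D by simp
qed

end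

theorem theorem102:
  fixes M :: "'a measure" and X :: "int \<Rightarrow> 'a \<Rightarrow> int"
    and c :: real and \<pi>t \<pi>b :: "nat \<Rightarrow> real" and q :: "nat \<Rightarrow> nat \<Rightarrow> real"
  assumes "prob_space M"
    and "prob_space.indep_vars M (\<lambda>_. count_space UNIV) X UNIV"
    and "\<And>n. distr M (count_space UNIV) (X n) = distr M (count_space UNIV) (X 0)"
    and "\<And>n. AE \<omega> in M. X n \<omega> \<ge> - 1"
    and "\<P>(\<omega> in M. X 0 \<omega> = - 1) > 0"
    and "integrable M (\<lambda>\<omega>. real_of_int (X 0 \<omega>))"
    and "(\<integral>\<omega>. real_of_int (X 0 \<omega>) \<partial>M) > 0"
    and "c = \<P>(\<omega> in M. \<exists>n>0. (\<Sum>k<n. X (int k) \<omega>) = - 1)"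
    and "\<And>k. \<pi>t k = c powi (int k - 1) * \<P>(\<omega> in M. X 0 \<omega> = int k - 1)"
    and "\<And>k. \<pi>b k = c ^ k * \<P>(\<omega> in M. X 0 \<omega> \<ge> int k)"
    and "\<And>n k. q n k = \<P>(\<omega> in M. X 0 \<omega> = int (n + k)) * c ^ k"
  shows "(\<forall>k. (\<lambda>n. q n k) sums \<pi>b k) \<and>
         is_R_probability M X (distr (MEKT q \<pi>t) borel backward_map)"
proof -
  interpret prob_space M by (fact assms(1))
  interpret skip_free_walk M X
    by unfold_locales (rule assms)+
  have "c \<noteq> 0" using hit_prob_pos assms(5,8) by (simp add: p_def)
  interpret skip_free_bushes M X c \<pi>t q
    by unfold_locales (use \<open>c \<noteq> 0\<close> assms(9,11) in \<open>simp_all only: p_def not_False_eq_True\<close>)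
  have "(\<lambda>n. q n k) sums \<pi>b k" for k
    using sums_mult2[OF tail_prob_sums[of k], of "c ^ k"] assms(10) by (simp add: mark_degree mult.commute)
  then show ?thesis using R_probability by blast
qed

end
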